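(* Let $\mathfrak g=\mathfrak g_{\bar 0}\oplus\mathfrak g_{\bar 1}$ be a basic classical Lie superalgebra over $\mathbf k$ (from the list in the context, with the stated restrictions on $p$), with center $\mathcal Z(\mathfrak g)$ of $U(\mathfrak g)$ and $p$-center $\mathcal Z_p$. Then: (1) Each element of $\mathcal Z(\mathfrak g)$ has even degree, that is, $\mathcal Z(\mathfrak g)\subset U(\mathfrak g)_{\bar 0}$. (2) $\mathcal Z(\mathfrak g)$ is a finitely generated $\mathcal Z_p$-module, integral over $\mathcal Z_p$. In particular, $\mathcal Z(\mathfrak g)$ is a finitely generated commutative algebra over $\mathbf k$. (3) No nonzero element of $\mathcal Z(\mathfrak g)$ is a zero divisor in $U(\mathfrak g)$.
   Context: $\mathbf k$ is an algebraically closed field of characteristic $p>2$. A basic classical Lie superalgebra $\mathfrak g$ over $\mathbf k$ means one of: $\mathfrak{gl}(m|n)$ ($p>2$); $\mathfrak{sl}(m|n)$ ($p>2$, $p\nmid m-n$); $\mathfrak{osp}(m|n)$ ($p>2$); $F(4)$ ($p>15$); $G(3)$ ($p>15$); $D(2,1,\alpha)$ ($p>3$). $\mathfrak g$ is a restricted Lie superalgebra: $\mathfrak g_{\bar 0}$ is the Lie algebra of a connected reductive algebraic group, hence a restricted Lie algebra with $p$-mapping $x\mapsto x^{[p]}$, and $\mathfrak g_{\bar 1}$ is a restricted $\mathfrak g_{\bar 0}$-module. The center is $\mathcal Z(\mathfrak g)=\{u\in U(\mathfrak g)\mid \mathrm{ad}\,x(u)=0\ \forall x\in\mathfrak g\}$,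 where $\mathrm{ad}\,x(u)=xu-(-1)^{|x||u|}ux$ for homogeneous $x\in\mathfrak g$, $u\in U(\mathfrak g)$ (extended linearly). The $p$-center $\mathcal Z_p\subset\mathcal Z(\mathfrak g)$ is the subalgebra generated by $x^p-x^{[p]}$, $x\in\mathfrak g_{\bar 0}$. *)

theory Defs
  imports
    "HOL-Algebra.QuotRing"
    "HOL-Algebra.Generated_Rings"
    "HOL-Library.Poly_Mapping"
    "HOL-Library.Function_Algebras"
    "HOL-Library.Product_Plus"
    "HOL-Computational_Algebra.Polynomial"
    "HOL-Computational_Algebra.Primes"
begin

section \<open>Restricted Lie superalgebras\<close>

text \<open>Parities are Booleans, with \<^term>\<open>False\<close> for the even part; the parity of a product is
  the exclusive or of the parities.\<close>

record ('k, 'a) lsa =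
  smul :: "'k \<Rightarrow> 'a \<Rightarrow> 'a"
  part :: "bool \<Rightarrow> 'a set"
  bracket :: "'a \<Rightarrow> 'a \<Rightarrow> 'a"
  pmap :: "'a \<Rightarrow> 'a"

definition sspace :: "('k, 'a::ab_group_add) lsa \<Rightarrow> 'a set" where
  "sspace g = {x + y | x y. x \<in> part g False \<and> y \<in> part g True}"

definition koszul :: "bool \<Rightarrow> bool \<Rightarrow> 'b::ring_1" where
  "koszul e d = (if e \<and> d then - 1 else 1)"

text \<open>The axiom \<open>odd_cube\<close> follows from the Jacobi identity except in characteristic 3, where it
  is part of the definition of a Lie superalgebra.\<close>

locale lie_superalgebra =
  fixes g :: "('k::field, 'a::ab_group_add) lsa"
  assumes vector_space: "vector_space (smul g)"
    and part_zero: "0 \<in> part g e"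
    and part_add: "\<lbrakk>x \<in> part g e; y \<in> part g e\<rbrakk> \<Longrightarrow> x + y \<in> part g e"
    and part_smul: "x \<in> part g e \<Longrightarrow> smul g c x \<in> part g e"
    and part_direct: "part g False \<inter> part g True = {0}"
    and bracket_part: "\<lbrakk>x \<in> part g e; y \<in> part g d\<rbrakk> \<Longrightarrow> bracket g x y \<in> part g (e \<noteq> d)"
    and bracket_add_left: "\<lbrakk>x \<in> sspace g; y \<in> sspace g; z \<in> sspace g\<rbrakk>
          \<Longrightarrow> bracket g (x + y) z = bracket g x z + bracket g y z"
    and bracket_add_right: "\<lbrakk>x \<in> sspace g; y \<in> sspace g; z \<in> sspace g\<rbrakk>
          \<Longrightarrow> bracket g x (y + z) = bracket g x y + bracket g x z"
    and bracket_smul_left: "\<lbrakk>x \<in> sspace g; y \<in> sspace g\<rbrakk>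
          \<Longrightarrow> bracket g (smul g c x) y = smul g c (bracket g x y)"
    and bracket_smul_right: "\<lbrakk>x \<in> sspace g; y \<in> sspace g\<rbrakk>
          \<Longrightarrow> bracket g x (smul g c y) = smul g c (bracket g x y)"
    and super_skew: "\<lbrakk>x \<in> part g e; y \<in> part g d\<rbrakk>
          \<Longrightarrow> bracket g x y = - smul g (koszul e d) (bracket g y x)"
    and super_jacobi: "\<lbrakk>x \<in> part g e; y \<in> part g d; z \<in> sspace g\<rbrakk>
          \<Longrightarrow> bracket g x (bracket g y z)
            = bracket g (bracket g x y) z + smul g (koszul e d) (bracket g y (bracket g x z))"
    and odd_cube: "x \<in> part g True \<Longrightarrow> bracket g x (bracket g x x) = 0"

text \<open>Jacobson's \<open>s\<^sub>i(x, y)\<close>: the coefficient of \<open>t\<^sup>i\<^sup>-\<^sup>1\<close> in \<open>ad(tx + y)\<^sup>p\<^sup>-\<^sup>1(x)\<close> is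
  \<open>i s\<^sub>i(x, y)\<close>. The lists are the noncommutative monomials in \<open>ad x\<close> (for \<^term>\<open>True\<close>) and
  \<open>ad y\<close> (for \<^term>\<open>False\<close>).\<close>

definition jacobson :: "('k::field, 'a::ab_group_add) lsa \<Rightarrow> nat \<Rightarrow> 'a \<Rightarrow> 'a \<Rightarrow> 'a" where
  "jacobson g i x y = smul g (1 / of_nat i)
     (\<Sum>w | length w = CHAR('k) - 1 \<and> count_list w True = i - 1.
        foldr (\<lambda>b. bracket g (if b then x else y)) w x)"

text \<open>In \<open>pmap_ad\<close> the case of odd \<open>y\<close> says that the odd part is a restricted module.\<close>

locale restricted_lie_superalgebra = lie_superalgebra g
  for g :: "('k::field, 'a::ab_group_add) lsa" +
  assumes pmap_part: "x \<in> part g False \<Longrightarrow> pmap g x \<in> part g False"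
    and pmap_smul: "x \<in> part g False \<Longrightarrow> pmap g (smul g c x) = smul g (c ^ CHAR('k)) (pmap g x)"
    and pmap_add: "\<lbrakk>x \<in> part g False; y \<in> part g False\<rbrakk>
          \<Longrightarrow> pmap g (x + y) = pmap g x + pmap g y + (\<Sum>i = 1..CHAR('k) - 1. jacobson g i x y)"
    and pmap_ad: "\<lbrakk>x \<in> part g False; y \<in> sspace g\<rbrakk>
          \<Longrightarrow> bracket g (pmap g x) y = (bracket g x ^^ CHAR('k)) y"

definition lsa_isomorphic ::
    "('k::field, 'a::ab_group_add) lsa \<Rightarrow> ('k, 'b::ab_group_add) lsa \<Rightarrow> bool" where
  "lsa_isomorphic g h \<longleftrightarrow> (\<exists>f.
     bij_betw f (sspace g) (sspace h) \<and>
     (\<forall>e. f ` part g e = part h e) \<and>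
     (\<forall>x\<in>sspace g. \<forall>y\<in>sspace g. f (x + y) = f x + f y) \<and>
     (\<forall>c. \<forall>x\<in>sspace g. f (smul g c x) = smul h c (f x)) \<and>
     (\<forall>x\<in>sspace g. \<forall>y\<in>sspace g. f (bracket g x y) = bracket h (f x) (f y)) \<and>
     (\<forall>x\<in>part g False. f (pmap g x) = pmap h (f x)))"


section \<open>The basic classical Lie superalgebras\<close>

subsection \<open>Matrices\<close>

text \<open>An \<open>r \<times> c\<close> matrix is a function on pairs of natural numbers that vanishes outside
  \<open>{..<r} \<times> {..<c}\<close>.\<close>

type_synonym 'k nmat = "nat \<Rightarrow> nat \<Rightarrow> 'k"

definition mats :: "nat \<Rightarrow> nat \<Rightarrow> 'k::field nmat set" where
  "mats r c = {A. \<forall>i j. A i j \<noteq> 0 \<longrightarrow> i < r \<and> j < c}"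

definition mscale :: "'k::field \<Rightarrow> 'k nmat \<Rightarrow> 'k nmat" where
  "mscale c A = (\<lambda>i j. c * A i j)"

definition mtransp :: "'k nmat \<Rightarrow> 'k nmat" where
  "mtransp A = (\<lambda>i j. A j i)"

definition mmul :: "nat \<Rightarrow> 'k::field nmat \<Rightarrow> 'k nmat \<Rightarrow> 'k nmat" where
  "mmul N A B = (\<lambda>i j. \<Sum>k<N. A i k * B k j)"

definition mpow :: "nat \<Rightarrow> 'k::field nmat \<Rightarrow> nat \<Rightarrow> 'k nmat" where
  "mpow N A r = (mmul N A ^^ r) (\<lambda>i j. if i = j \<and> i < N then 1 else 0)"

definition mcomm :: "nat \<Rightarrow> 'k::field nmat \<Rightarrow> 'k nmat \<Rightarrow> 'k nmat" where
  "mcomm N A B = mmul N A B - mmul N B A"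

subsection \<open>The series gl, sl and osp\<close>

text \<open>The indices below \<open>m\<close> are even and the indices from \<open>m\<close> to \<open>m + n - 1\<close> are odd.\<close>

definition block :: "nat \<Rightarrow> bool \<Rightarrow> 'k::field nmat \<Rightarrow> 'k nmat" where
  "block m e A = (\<lambda>i j. if ((i < m) \<noteq> (j < m)) = e then A i j else 0)"

definition supercomm :: "nat \<Rightarrow> nat \<Rightarrow> 'k::field nmat \<Rightarrow> 'k nmat \<Rightarrow> 'k nmat" where
  "supercomm m n A B = mmul (m + n) A B
     - (\<Sum>e\<in>UNIV. \<Sum>d\<in>UNIV. mscale (koszul e d) (mmul (m + n) (block m d B) (block m e A)))"

definition gl :: "nat \<Rightarrow> nat \<Rightarrow> ('k::field, 'k nmat) lsa" where
  "gl m n = \<lparr>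
     smul = mscale,
     part = (\<lambda>e. {A \<in> mats (m + n) (m + n). \<forall>i j. A i j \<noteq> 0 \<longrightarrow> ((i < m) \<noteq> (j < m)) = e}),
     bracket = supercomm m n,
     pmap = (\<lambda>A. mpow (m + n) A CHAR('k))\<rparr>"

definition supertrace :: "nat \<Rightarrow> nat \<Rightarrow> 'k::field nmat \<Rightarrow> 'k" where
  "supertrace m n A = (\<Sum>i<m. A i i) - (\<Sum>i=m..<m + n. A i i)"

definition sl :: "nat \<Rightarrow> nat \<Rightarrow> ('k::field, 'k nmat) lsa" where
  "sl m n = (gl m n)\<lparr>part := (\<lambda>e. {A \<in> part (gl m n) e. supertrace m n A = 0})\<rparr>"

text \<open>The Gram matrix of the standard even nondegenerate supersymmetric form \<open>(_, _)\<close>: symmetric on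
  the even part, symplectic on the odd part, which has even dimension \<open>n\<close>.\<close>

definition osp_form :: "nat \<Rightarrow> nat \<Rightarrow> 'k::field nmat" where
  "osp_form m n = (\<lambda>i j.
     if i < m \<or> j < m then (if i = j then 1 else 0)
     else if j = i + n div 2 then 1 else if i = j + n div 2 then - 1 else 0)"

text \<open>The condition on \<open>A\<close> of parity \<open>e\<close> is \<open>(A v, w) + (-1)\<^bsup>e |v|\<^esup> (v, A w) = 0\<close>, read on basis
  vectors.\<close>

definition osp :: "nat \<Rightarrow> nat \<Rightarrow> ('k::field, 'k nmat) lsa" where
  "osp m n = (gl m n)\<lparr>part := (\<lambda>e. {A \<in> part (gl m n) e. \<forall>i<m + n. \<forall>j<m + n.
     (\<Sum>k<m + n. A k i * osp_form m n k j)
       + koszul e (i \<ge> m) * (\<Sum>k<m + n. osp_form m n i k * A k j) = 0})\<rparr>"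

subsection \<open>The family D(2,1,alpha)\<close>

definition psi :: "'k::field nmat" where
  "psi = (\<lambda>i j. if i = 0 \<and> j = 1 then 1 else if i = 1 \<and> j = 0 then - 1 else 0)"

definition sl2 :: "'k::field nmat set" where
  "sl2 = {A \<in> mats 2 2. A 0 0 + A 1 1 = 0}"

type_synonym 'k cube = "nat \<Rightarrow> nat \<Rightarrow> nat \<Rightarrow> 'k"

text \<open>With \<open>V\<close> the natural module of \<open>sl\<^sub>2\<close> and \<open>psi\<close> its invariant symplectic form, let
  \<open>p(x, y) z = psi(y, z) x + psi(x, z) y\<close> for \<open>x, y, z \<in> V\<close>; this is an element of \<open>sl\<^sub>2\<close>. On
  \<open>V \<otimes> V \<otimes> V\<close> the map below is
  \<open>(x\<^sub>1 \<otimes> x\<^sub>2 \<otimes> x\<^sub>3, y\<^sub>1 \<otimes> y\<^sub>2 \<otimes> y\<^sub>3) \<mapsto> psi(x\<^sub>2, y\<^sub>2) psi(x\<^sub>3, y\<^sub>3) p(x\<^sub>1, y\<^sub>1)\<close>.\<close>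

definition cube_sl2 :: "'k::field cube \<Rightarrow> 'k cube \<Rightarrow> 'k nmat" where
  "cube_sl2 u v = (\<lambda>a b. \<Sum>c<2. \<Sum>j<2. \<Sum>k<2. \<Sum>l<2. \<Sum>q<2.
     psi c b * psi j l * psi k q * (u a j k * v c l q + u c j k * v a l q))"

definition cube_act :: "'k::field nmat \<Rightarrow> 'k nmat \<Rightarrow> 'k nmat \<Rightarrow> 'k cube \<Rightarrow> 'k cube" where
  "cube_act A B C u = (\<lambda>i j k.
     (\<Sum>r<2. A i r * u r j k) + (\<Sum>r<2. B j r * u i r k) + (\<Sum>r<2. C k r * u i j r))"

text \<open>The even part is \<open>sl\<^sub>2 \<oplus> sl\<^sub>2 \<oplus> sl\<^sub>2\<close>, the odd part is \<open>V \<otimes> V \<otimes> V\<close>, and the three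
  components of the bracket of odd elements are weighted by
  \<open>(\<sigma>\<^sub>1, \<sigma>\<^sub>2, \<sigma>\<^sub>3) = (-1 - \<alpha>, 1, \<alpha>)\<close>, whose sum is 0.\<close>

definition D21 :: "'k::field \<Rightarrow> ('k, 'k nmat \<times> 'k nmat \<times> 'k nmat \<times> 'k cube) lsa" where
  "D21 \<alpha> = \<lparr>
     smul = (\<lambda>c (A, B, C, u). (mscale c A, mscale c B, mscale c C, \<lambda>i j k. c * u i j k)),
     part = (\<lambda>e. if e
        then {(0, 0, 0, u) | u. \<forall>i j k. u i j k \<noteq> 0 \<longrightarrow> i < 2 \<and> j < 2 \<and> k < 2}
        else {(A, B, C, 0) | A B C. A \<in> sl2 \<and> B \<in> sl2 \<and> C \<in> sl2}),
     bracket = (\<lambda>(A, B, C, u) (A', B', C', v).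
       (mcomm 2 A A' + mscale (- 1 - \<alpha>) (cube_sl2 u v),
        mcomm 2 B B' + cube_sl2 (\<lambda>b a c. u a b c) (\<lambda>b a c. v a b c),
        mcomm 2 C C' + mscale \<alpha> (cube_sl2 (\<lambda>c a b. u a b c) (\<lambda>c a b. v a b c)),
        cube_act A B C v - cube_act A' B' C' u)),
     pmap = (\<lambda>(A, B, C, u). (mpow 2 A CHAR('k), mpow 2 B CHAR('k), mpow 2 C CHAR('k), 0))\<rparr>"

subsection \<open>The exceptional algebras G(3) and F(4)\<close>

text \<open>Let \<open>h\<close> be a Lie algebra of \<open>7 \<times> 7\<close> matrices with an orthogonal representation \<open>\<rho>\<close> on the
  column space of dimension \<open>N\<close> and an equivariant alternating map \<open>Q\<close> from pairs of columns to
  \<open>h\<close>. In \<open>with_sl2 N h \<rho> Q\<close> the even part is \<open>h \<oplus> sl\<^sub>2\<close>, the odd part consists of the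
  \<open>N \<times> 2\<close> matrices, that is, the tensor product of the column space with \<open>V\<close>, and the bracket of
  odd elements is
  \<open>[s \<otimes> x, t \<otimes> y] = psi(x, y) Q(s, t) + (s, t) p(x, y)\<close>, where \<open>(_, _)\<close> is the dot product.
  The coefficients in \<open>G3\<close> and \<open>F4\<close> are the ones for which the Jacobi identity holds for three
  odd elements.\<close>

definition odd_h :: "nat \<Rightarrow> (nat \<Rightarrow> nat \<Rightarrow> 'k::field nmat) \<Rightarrow> 'k nmat \<Rightarrow> 'k nmat \<Rightarrow> 'k nmat" where
  "odd_h N Q u v = (\<lambda>i j. \<Sum>s<N. \<Sum>t<N. \<Sum>c<2. \<Sum>d<2. psi c d * u s c * v t d * Q s t i j)"

definition odd_sl2 :: "nat \<Rightarrow> 'k::field nmat \<Rightarrow> 'k nmat \<Rightarrow> 'k nmat" where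
  "odd_sl2 N u v = (\<lambda>a b. \<Sum>s<N. \<Sum>c<2. psi c b * (u s a * v s c + u s c * v s a))"

definition with_sl2 :: "nat \<Rightarrow> 'k::field nmat set \<Rightarrow> ('k nmat \<Rightarrow> 'k nmat)
    \<Rightarrow> (nat \<Rightarrow> nat \<Rightarrow> 'k nmat) \<Rightarrow> ('k, 'k nmat \<times> 'k nmat \<times> 'k nmat) lsa" where
  "with_sl2 N h \<rho> Q = \<lparr>
     smul = (\<lambda>c (A, B, u). (mscale c A, mscale c B, mscale c u)),
     part = (\<lambda>e. if e then {(0, 0, u) | u. u \<in> mats N 2}
                       else {(A, B, 0) | A B. A \<in> h \<and> B \<in> sl2}),
     bracket = (\<lambda>(A, B, u) (A', B', v).
       (mcomm 7 A A' + odd_h N Q u v,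
        mcomm 2 B B' + odd_sl2 N u v,
        (mmul N (\<rho> A) v + mmul 2 v (mtransp B)) - (mmul N (\<rho> A') u + mmul 2 u (mtransp B')))),
     pmap = (\<lambda>(A, B, u). (mpow 7 A CHAR('k), mpow 2 B CHAR('k), 0))\<rparr>"

text \<open>Structure constants of the cross product of imaginary octonions,
  \<open>e\<^sub>i \<times> e\<^sub>j = (\<Sum>k. octo i j k e\<^sub>k)\<close>, for the Fano plane with the lines \<open>{t, t + 1, t + 3}\<close> modulo 7.\<close>

definition octo :: "nat \<Rightarrow> nat \<Rightarrow> nat \<Rightarrow> 'k::field" where
  "octo i j k = (if i < 7 \<and> j < 7 \<and> k < 7 then
     (let d = ((j + 7 - i) mod 7, (k + 7 - i) mod 7)
      in if d \<in> {(1, 3), (2, 6), (4, 5)} then 1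
         else if d \<in> {(3, 1), (6, 2), (5, 4)} then - 1 else 0) else 0)"

text \<open>The Lie algebra of type \<open>G\<^sub>2\<close>: the derivations of the cross product.\<close>

definition g2 :: "'k::field nmat set" where
  "g2 = {D \<in> mats 7 7. \<forall>i<7. \<forall>j<7. \<forall>l<7.
     (\<Sum>k<7. octo i j k * D l k) = (\<Sum>k<7. D k i * octo k j l) + (\<Sum>k<7. D k j * octo i k l)}"

text \<open>Here \<open>Q(x, y)\<close> is the derivation
  \<open>z \<mapsto> 3/2 ((y, z) x - (x, z) y) + 1/2 (x \<times> y) \<times> z\<close>.\<close>

definition G3 :: "('k::field, 'k nmat \<times> 'k nmat \<times> 'k nmat) lsa" where
  "G3 = with_sl2 7 g2 (\<lambda>A. A) (\<lambda>s t i j.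
     3 / 2 * ((if t = j \<and> s = i then 1 else 0) - (if s = j \<and> t = i then 1 else 0))
     + 1 / 2 * (\<Sum>k<7. octo s t k * octo k j i))"

definition so7 :: "'k::field nmat set" where
  "so7 = {A \<in> mats 7 7. \<forall>i j. A i j = - A j i}"

text \<open>Left multiplication by the imaginary octonion \<open>e\<^sub>i\<close>, where index 7 stands for the unit. These
  matrices satisfy \<open>\<gamma>\<^sub>i \<gamma>\<^sub>j + \<gamma>\<^sub>j \<gamma>\<^sub>i = -2 \<delta>\<^sub>i\<^sub>j\<close>, so \<open>spin\<close> is the spin representation of \<open>so\<^sub>7\<close>,
  normalised by \<open>[spin A, \<gamma>\<^sub>j] = (\<Sum>i. A i j \<gamma>\<^sub>i)\<close>.\<close>

definition gam :: "nat \<Rightarrow> 'k::field nmat" where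
  "gam i = (\<lambda>a b. if a < 7 \<and> b < 7 then octo i b a
     else if b = 7 \<and> a = i then 1 else if a = 7 \<and> b = i then - 1 else 0)"

definition spin :: "'k::field nmat \<Rightarrow> 'k nmat" where
  "spin A = (\<lambda>a b. - (1 / 4) * (\<Sum>i<7. \<Sum>j<7. A i j * mmul 8 (gam i) (gam j) a b))"

text \<open>Here \<open>Q(s, t)\<close> has the entries \<open>-2/3 (s, \<gamma>\<^sub>i \<gamma>\<^sub>j t)\<close> for \<open>i \<noteq> j\<close>.\<close>

definition F4 :: "('k::field, 'k nmat \<times> 'k nmat \<times> 'k nmat) lsa" where
  "F4 = with_sl2 8 so7 spin (\<lambda>s t i j.
     if i < 7 \<and> j < 7 \<and> i \<noteq> j then - (2 / 3) * mmul 8 (gam i) (gam j) s t else 0)"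

subsection \<open>The list\<close>

definition basic_classical :: "('k::field, 'a::ab_group_add) lsa \<Rightarrow> bool" where
  "basic_classical g \<longleftrightarrow> restricted_lie_superalgebra g \<and>
     ((\<exists>m n. CHAR('k) > 2 \<and> lsa_isomorphic g (gl m n)) \<or>
      (\<exists>m n. CHAR('k) > 2 \<and> \<not> int CHAR('k) dvd int m - int n \<and> lsa_isomorphic g (sl m n)) \<or>
      (\<exists>m n. CHAR('k) > 2 \<and> even n \<and> lsa_isomorphic g (osp m n)) \<or>
      (CHAR('k) > 15 \<and> lsa_isomorphic g F4) \<or>
      (CHAR('k) > 15 \<and> lsa_isomorphic g G3) \<or>
      (\<exists>\<alpha>. CHAR('k) > 3 \<and> \<alpha> \<noteq> 0 \<and> \<alpha> \<noteq> - 1 \<and> lsa_isomorphic g (D21 \<alpha>)))"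


section \<open>The universal enveloping algebra and its center\<close>

datatype 'a fmon = FMon (letters: "'a list")

text \<open>The free monoid, written additively as \<^typ>\<open>'b \<Rightarrow>\<^sub>0 'k\<close> expects it: then
  \<^typ>\<open>'a fmon \<Rightarrow>\<^sub>0 'k\<close> with its convolution product is the free associative algebra on \<^typ>\<open>'a\<close>.\<close>

instantiation fmon :: (type) monoid_add
begin

definition "0 = FMon []"
definition "v + w = FMon (letters v @ letters w)"

instance
  by standard (simp_all add: zero_fmon_def plus_fmon_def)

end

definition free_algebra :: "'a set \<Rightarrow> ('a fmon \<Rightarrow>\<^sub>0 'k::field) ring" where
  "free_algebra X = \<lparr>carrier = {f. \<forall>w\<in>Poly_Mapping.keys f. set (letters w) \<subseteq> X},
     monoid.mult = (*), one = 1, zero = 0, add = (+)\<rparr>"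

definition gen :: "'a \<Rightarrow> ('a fmon \<Rightarrow>\<^sub>0 'k::field)" where
  "gen x = Poly_Mapping.single (FMon [x]) 1"

definition const :: "'k::field \<Rightarrow> ('a fmon \<Rightarrow>\<^sub>0 'k)" where
  "const c = Poly_Mapping.single 0 c"

text \<open>The first two families of relations turn the free algebra on the set \<^term>\<open>sspace g\<close> into the
  tensor algebra of the vector space.\<close>

definition uea_relations :: "('k::field, 'a::ab_group_add) lsa \<Rightarrow> ('a fmon \<Rightarrow>\<^sub>0 'k) set" where
  "uea_relations g =
     {gen (x + y) - gen x - gen y | x y. x \<in> sspace g \<and> y \<in> sspace g} \<union>
     {gen (smul g c x) - const c * gen x | c x. x \<in> sspace g} \<union>
     {gen x * gen y - koszul e d * (gen y * gen x) - gen (bracket g x y) | x y e d.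
        x \<in> part g e \<and> y \<in> part g d}"

definition uea_ideal :: "('k::field, 'a::ab_group_add) lsa \<Rightarrow> ('a fmon \<Rightarrow>\<^sub>0 'k) set" where
  "uea_ideal g = Idl\<^bsub>free_algebra (sspace g)\<^esub> (uea_relations g)"

definition uea :: "('k::field, 'a::ab_group_add) lsa \<Rightarrow> ('a fmon \<Rightarrow>\<^sub>0 'k) set ring" where
  "uea g = free_algebra (sspace g) Quot uea_ideal g"

definition uea_class ::
    "('k::field, 'a::ab_group_add) lsa \<Rightarrow> ('a fmon \<Rightarrow>\<^sub>0 'k) \<Rightarrow> ('a fmon \<Rightarrow>\<^sub>0 'k) set" where
  "uea_class g f = uea_ideal g +>\<^bsub>free_algebra (sspace g)\<^esub> f"

definition uea_gen :: "('k::field, 'a::ab_group_add) lsa \<Rightarrow> 'a \<Rightarrow> ('a fmon \<Rightarrow>\<^sub>0 'k) set" where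
  "uea_gen g x = uea_class g (gen x)"

definition uea_scalar :: "('k::field, 'a::ab_group_add) lsa \<Rightarrow> 'k \<Rightarrow> ('a fmon \<Rightarrow>\<^sub>0 'k) set" where
  "uea_scalar g c = uea_class g (const c)"

text \<open>Linear combinations of products of homogeneous elements whose parities add up to \<open>e\<close>.\<close>

definition uea_part ::
    "('k::field, 'a::ab_group_add) lsa \<Rightarrow> bool \<Rightarrow> ('a fmon \<Rightarrow>\<^sub>0 'k) set set" where
  "uea_part g e = uea_class g ` {f. \<forall>w\<in>Poly_Mapping.keys f. \<exists>ds.
     list_all2 (\<lambda>x d. x \<in> part g d) (letters w) ds \<and> odd (count_list ds True) = e}"

definition lsa_component :: "('k, 'a::ab_group_add) lsa \<Rightarrow> bool \<Rightarrow> 'a \<Rightarrow> 'a" where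
  "lsa_component g e x = (THE y. y \<in> part g e \<and> (\<exists>z\<in>part g (\<not> e). x = y + z))"

definition uea_component ::
    "('k::field, 'a::ab_group_add) lsa \<Rightarrow> bool \<Rightarrow> ('a fmon \<Rightarrow>\<^sub>0 'k) set \<Rightarrow> ('a fmon \<Rightarrow>\<^sub>0 'k) set" where
  "uea_component g e u =
     (THE v. v \<in> uea_part g e \<and> (\<exists>w\<in>uea_part g (\<not> e). u = v \<oplus>\<^bsub>uea g\<^esub> w))"

definition ad_homogeneous :: "('k::field, 'a::ab_group_add) lsa \<Rightarrow> bool \<Rightarrow> bool \<Rightarrow> 'a
    \<Rightarrow> ('a fmon \<Rightarrow>\<^sub>0 'k) set \<Rightarrow> ('a fmon \<Rightarrow>\<^sub>0 'k) set" where
  "ad_homogeneous g e d x u =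
     (uea_gen g x \<otimes>\<^bsub>uea g\<^esub> u)
       \<ominus>\<^bsub>uea g\<^esub> (uea_scalar g (koszul e d) \<otimes>\<^bsub>uea g\<^esub> (u \<otimes>\<^bsub>uea g\<^esub> uea_gen g x))"

definition ad ::
    "('k::field, 'a::ab_group_add) lsa \<Rightarrow> 'a \<Rightarrow> ('a fmon \<Rightarrow>\<^sub>0 'k) set \<Rightarrow> ('a fmon \<Rightarrow>\<^sub>0 'k) set" where
  "ad g x u = (\<Oplus>\<^bsub>uea g\<^esub>e\<in>UNIV. \<Oplus>\<^bsub>uea g\<^esub>d\<in>UNIV.
     ad_homogeneous g e d (lsa_component g e x) (uea_component g d u))"

definition center :: "('k::field, 'a::ab_group_add) lsa \<Rightarrow> ('a fmon \<Rightarrow>\<^sub>0 'k) set set" where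
  "center g = {u \<in> carrier (uea g). \<forall>x\<in>sspace g. ad g x u = \<zero>\<^bsub>uea g\<^esub>}"

definition uea_subalgebra :: "('k::field, 'a::ab_group_add) lsa
    \<Rightarrow> ('a fmon \<Rightarrow>\<^sub>0 'k) set set \<Rightarrow> ('a fmon \<Rightarrow>\<^sub>0 'k) set set" where
  "uea_subalgebra g S = generate_ring (uea g) (range (uea_scalar g) \<union> S)"

definition p_center :: "('k::field, 'a::ab_group_add) lsa \<Rightarrow> ('a fmon \<Rightarrow>\<^sub>0 'k) set set" where
  "p_center g = uea_subalgebra g
     {(uea_gen g x [^]\<^bsub>uea g\<^esub> CHAR('k)) \<ominus>\<^bsub>uea g\<^esub> uea_gen g (pmap g x) | x. x \<in> part g False}"


section \<open>Finiteness conditions\<close>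

text \<open>For a subring \<open>A\<close> and a subset \<open>M\<close> of \<open>R\<close>; that \<open>M\<close> is closed under addition and under
  multiplication by \<open>A\<close> is part of the condition.\<close>

definition finitely_generated_module :: "('a, 'b) ring_scheme \<Rightarrow> 'a set \<Rightarrow> 'a set \<Rightarrow> bool" where
  "finitely_generated_module R A M \<longleftrightarrow> (\<exists>S. finite S \<and> S \<subseteq> M \<and>
     M = {(\<Oplus>\<^bsub>R\<^esub>s\<in>S. c s \<otimes>\<^bsub>R\<^esub> s) | c. c \<in> S \<rightarrow> A})"

definition integral_over :: "('a, 'b) ring_scheme \<Rightarrow> 'a set \<Rightarrow> 'a \<Rightarrow> bool" where
  "integral_over R A z \<longleftrightarrow> (\<exists>(n::nat) c. c \<in> {..<n} \<rightarrow> A \<and>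
     (z [^]\<^bsub>R\<^esub> n) \<oplus>\<^bsub>R\<^esub> (\<Oplus>\<^bsub>R\<^esub>i\<in>{..<n}. c i \<otimes>\<^bsub>R\<^esub> (z [^]\<^bsub>R\<^esub> i)) = \<zero>\<^bsub>R\<^esub>)"

definition finitely_generated_commutative_algebra ::
    "('k::field, 'a::ab_group_add) lsa \<Rightarrow> ('a fmon \<Rightarrow>\<^sub>0 'k) set set \<Rightarrow> bool" where
  "finitely_generated_commutative_algebra g A \<longleftrightarrow>
     (\<exists>S. finite S \<and> A = uea_subalgebra g S) \<and>
     (\<forall>a\<in>A. \<forall>b\<in>A. a \<otimes>\<^bsub>uea g\<^esub> b = b \<otimes>\<^bsub>uea g\<^esub> a)"

definition zero_divisor :: "('a, 'b) ring_scheme \<Rightarrow> 'a \<Rightarrow> bool" where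
  "zero_divisor R z \<longleftrightarrow> (\<exists>u\<in>carrier R. u \<noteq> \<zero>\<^bsub>R\<^esub> \<and>
     (z \<otimes>\<^bsub>R\<^esub> u = \<zero>\<^bsub>R\<^esub> \<or> u \<otimes>\<^bsub>R\<^esub> z = \<zero>\<^bsub>R\<^esub>))"

end

theory Submission
  imports Defs "HOL-Library.Multiset_Order"
begin

text \<open>By the Poincare-Birkhoff-Witt theorem \<open>U(g)\<close> has a basis of normal words in a homogeneous basis of
  \<open>g\<close>. For every algebra in the list there is a linear form \<open>\<chi>\<close> on \<open>g\<^sub>0\<close> such that
  \<open>\<chi>([y, y'])\<close> is nondegenerate on \<open>g\<^sub>1\<close>. Choose the basis of \<open>g\<^sub>0\<close> such that \<open>\<chi>\<close> is 1 on its last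
  element \<open>x\<close> and 0 on the others, and give odd elements weight 2, \<open>x\<close> weight 4 and the other even
  elements weight 3. The associated graded algebra is a polynomial ring tensored with a
  Clifford-like algebra, in which \<open>ad y\<close> acts on leading terms, for odd \<open>y\<close>, as \<open>x\<close> times a
  contraction. As the form is nondegenerate, the leading term of a supercentral element is
  annihilated by all contractions, hence is a polynomial in the even letters. So the element is even,
  and its product with a nonzero element has a nonzero leading term. For (2), \<open>U(g)\<close> is spanned over
  the polynomials in the \<open>x\<^sub>i\<^sup>p - x\<^sub>i\<^sup>[\<^sup>p\<^sup>]\<close> by the words in which every letter occurs fewer than \<open>p\<close>
  times, and Hilbert's basis theorem applies to the submodule \<open>Z(g)\<close>.\<close>

section \<open>Linear extension of maps on words\<close>

text \<open>Odd elements of square zero make \<open>U(g)\<close> rich in zero divisors: in the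
  standard filtration the graded ring contains an exterior algebra, where products of leading terms
  can vanish. The weights are chosen so that exactly one bracket survives in top weight. Two odd
  letters weigh 4 together, and only the component of their bracket along \<open>x\<close> weighs 4
  again; a bracket of an even with an odd letter falls from at least 5 to 2, one of two even letters
  from at least 6 to at most 4. What has to be known about \<open>g\<close> is then a single linear
  form. The Poincare-Birkhoff-Witt theorem is obtained by letting \<open>g\<close> act on the span
  of the normal words; the normal form of an element is its value on the empty word. The bracket
  relations are checked on overlaps of three letters, where the Jacobi identity and, for a tripled
  odd letter, \<open>odd_cube\<close> enter. The axioms hold for \<open>g\<close> by
  \<open>basic_classical\<close>, so the explicit models only have to provide linear functionals,
  transported along the isomorphism.\<close>

abbreviation lookup :: "('w \<Rightarrow>\<^sub>0 'k::zero) \<Rightarrow> 'w \<Rightarrow> 'k" where "lookup \<equiv> Poly_Mapping.lookup"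
abbreviation keys :: "('w \<Rightarrow>\<^sub>0 'k::zero) \<Rightarrow> 'w set" where "keys \<equiv> Poly_Mapping.keys"
abbreviation single :: "'w \<Rightarrow> 'k::zero \<Rightarrow> ('w \<Rightarrow>\<^sub>0 'k)" where "single \<equiv> Poly_Mapping.single"

definition scl :: "'k::field \<Rightarrow> ('w \<Rightarrow>\<^sub>0 'k) \<Rightarrow> ('w \<Rightarrow>\<^sub>0 'k)" where
  "scl c p = Poly_Mapping.map ((*) c) p"

lemma lookup_scl [simp]: "lookup (scl c p) w = c * lookup p w"
  unfolding scl_def by transfer (simp add: when_def)

interpretation pm: vector_space "scl :: 'k::field \<Rightarrow> ('w \<Rightarrow>\<^sub>0 'k) \<Rightarrow> ('w \<Rightarrow>\<^sub>0 'k)"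
  by standard (auto intro!: poly_mapping_eqI simp: lookup_add algebra_simps)

lemma keys_scl_subset: "keys (scl c p) \<subseteq> keys p"
  by (auto simp: in_keys_iff)

definition lin :: "('v \<Rightarrow> ('w \<Rightarrow>\<^sub>0 'k)) \<Rightarrow> ('v \<Rightarrow>\<^sub>0 'k) \<Rightarrow> ('w \<Rightarrow>\<^sub>0 'k::field)" where
  "lin f p = (\<Sum>v\<in>keys p. scl (lookup p v) (f v))"

lemma lin_superset:
  assumes "finite A" "keys p \<subseteq> A"
  shows "lin f p = (\<Sum>v\<in>A. scl (lookup p v) (f v))"
  unfolding lin_def by (rule sum.mono_neutral_left) (use assms in \<open>auto simp: in_keys_iff\<close>)

lemma lin_cong:
  assumes "\<And>v. v \<in> keys p \<Longrightarrow> f v = h v"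
  shows "lin f p = lin h p"
  unfolding lin_def by (rule sum.cong) (use assms in auto)

lemma lin_add: "lin f (p + q) = lin f p + lin f q"
proof -
  let ?A = "keys p \<union> keys q"
  have "lin f (p + q) = (\<Sum>v\<in>?A. scl (lookup (p + q) v) (f v))"
    by (rule lin_superset) (use keys_add[of p q] in auto)
  also have "\<dots> = (\<Sum>v\<in>?A. scl (lookup p v) (f v))
      + (\<Sum>v\<in>?A. scl (lookup q v) (f v))"
    by (simp add: lookup_add pm.scale_left_distrib sum.distrib)
  also have "\<dots> = lin f p + lin f q"
    by (simp add: lin_superset[of ?A])
  finally show ?thesis .
qed

lemma lin_scl: "lin f (scl c p) = scl c (lin f p)"
proof -
  have "lin f (scl c p) = (\<Sum>v\<in>keys p. scl (lookup (scl c p) v) (f v))"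
    by (rule lin_superset) (simp_all add: keys_scl_subset)
  then show ?thesis
    by (simp add: lin_def pm.scale_sum_right)
qed

lemma lin_zero [simp]: "lin f 0 = 0"
  by (simp add: lin_def)

lemma lin_single [simp]: "lin f (single v c) = scl c (f v)"
  by (cases "c = 0") (auto simp: lin_def)

lemma lin_uminus: "lin f (- p) = - lin f p"
  using lin_add[of f p "- p"] by (simp add: eq_neg_iff_add_eq_0 add.commute)

lemma lin_diff: "lin f (p - q) = lin f p - lin f q"
  using lin_add[of f p "- q"] by (simp add: lin_uminus)

lemma lin_sum: "lin f (sum p A) = (\<Sum>a\<in>A. lin f (p a))"
  by (induction A rule: infinite_finite_induct) (auto simp: lin_add)

lemma lin_fun_add: "lin (\<lambda>v. f v + h v) p = lin f p + lin h p"
  by (simp add: lin_def pm.scale_right_distrib sum.distrib)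

lemma lin_fun_zero [simp]: "lin (\<lambda>v. 0) p = 0"
  by (simp add: lin_def)

lemma lin_fun_scl: "lin (\<lambda>v. scl c (f v)) p = scl c (lin f p)"
  by (simp add: lin_def pm.scale_sum_right mult.commute)

lemma lin_fun_sum: "lin (\<lambda>v. \<Sum>a\<in>A. f a v) p = (\<Sum>a\<in>A. lin (f a) p)"
  by (induction A rule: infinite_finite_induct) (auto simp: lin_fun_add)

lemma lin_lin: "lin f (lin h p) = lin (\<lambda>v. lin f (h v)) p"
  by (simp add: lin_def[of h] lin_def[of "\<lambda>v. lin f (h v)"] lin_sum lin_scl)

lemma lin_single_id [simp]: "lin (\<lambda>v. single v 1) p = p"
  by (rule poly_mapping_eqI)
     (auto simp: lin_def lookup_sum lookup_single when_def in_keys_iff if_distrib sum.delta cong: if_cong)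

lemma lookup_lin:
  "lookup (lin f p) w
     = (\<Sum>v\<in>keys p. lookup p v * lookup (f v) w)"
  by (simp add: lin_def lookup_sum)

lemma keys_sum_subset:
  assumes "\<And>a. a \<in> I \<Longrightarrow> keys (p a) \<subseteq> A"
  shows "keys (sum p I) \<subseteq> A"
  using assms by (induction I rule: infinite_finite_induct) (auto dest!: subsetD[OF keys_add])

lemma keys_lin_subset:
  assumes "\<And>v. v \<in> keys p \<Longrightarrow> keys (f v) \<subseteq> A"
  shows "keys (lin f p) \<subseteq> A"
  unfolding lin_def by (rule keys_sum_subset) (rule subset_trans[OF keys_scl_subset assms])

lemma keys_add_subset:
  "\<lbrakk>keys p \<subseteq> A; keys q \<subseteq> A\<rbrakk> \<Longrightarrow> keys (p + q) \<subseteq> A"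
  using keys_add[of p q] by auto

text \<open>For an odd basis element the defining relation determines only twice its square; this is
  the division by 2 that yields the square itself.\<close>

lemma pm_half_double:
  assumes "(2::'k::field) \<noteq> 0" "p + p = (q :: 'w \<Rightarrow>\<^sub>0 'k)"
  shows "p = scl (1 / 2) q"
  using assms by (auto intro!: poly_mapping_eqI simp: lookup_add field_simps)

section \<open>The action of a Lie superalgebra on normal words\<close>

lemma koszul_simps [simp]:
  "koszul False d = 1" "koszul e False = 1" "koszul True True = - 1"
  by (auto simp: koszul_def)

section \<open>Closure and additivity on the sum of the two parts\<close>

context lie_superalgebra
begin

sublocale gv: vector_space "smul g"
  by (rule vector_space)

lemma part_sspace: "x \<in> part g e \<Longrightarrow> x \<in> sspace g"
  using part_zero[of False] part_zero[of True]
  by (cases e) (force simp: sspace_def)+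

lemma part_neg: "x \<in> part g e \<Longrightarrow> - x \<in> part g e"
  using part_smul[of x e "- 1"] by simp

lemma part_diff: "x \<in> part g e \<Longrightarrow> y \<in> part g e \<Longrightarrow> x - y \<in> part g e"
  using part_add[of x e "- y"] part_neg[of y e] by simp

lemma sspace_add: "x \<in> sspace g \<Longrightarrow> y \<in> sspace g \<Longrightarrow> x + y \<in> sspace g"
proof -
  assume "x \<in> sspace g" "y \<in> sspace g"
  then obtain x0 x1 y0 y1 where "x = x0 + x1" "y = y0 + y1"
      "x0 \<in> part g False" "x1 \<in> part g True" "y0 \<in> part g False" "y1 \<in> part g True"
    by (auto simp: sspace_def)
  moreover from this have "x + y = (x0 + y0) + (x1 + y1)" by simp
  ultimately show ?thesis
    unfolding sspace_def using part_add[of x0 False y0] part_add[of x1 True y1] by blast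
qed

lemma sspace_smul: "x \<in> sspace g \<Longrightarrow> smul g c x \<in> sspace g"
  using part_smul by (fastforce simp: sspace_def gv.scale_right_distrib)

lemma sspace_zero: "0 \<in> sspace g"
  using part_sspace part_zero by blast

lemma sspace_sum: "(\<And>a. a \<in> A \<Longrightarrow> f a \<in> sspace g) \<Longrightarrow> sum f A \<in> sspace g"
  by (induction A rule: infinite_finite_induct) (auto simp: sspace_add sspace_zero)

lemma bracket_zero_left: "y \<in> sspace g \<Longrightarrow> bracket g 0 y = 0"
  using bracket_smul_left[of 0 y 0] sspace_zero by simp

lemma bracket_zero_right: "y \<in> sspace g \<Longrightarrow> bracket g y 0 = 0"
  using bracket_smul_right[of y 0 0] sspace_zero by simp

lemma bracket_sspace: "x \<in> sspace g \<Longrightarrow> y \<in> sspace g \<Longrightarrow> bracket g x y \<in> sspace g"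
proof -
  assume "x \<in> sspace g" "y \<in> sspace g"
  then obtain x0 x1 y0 y1 where xy: "x = x0 + x1" "y = y0 + y1"
      and p: "x0 \<in> part g False" "x1 \<in> part g True" "y0 \<in> part g False" "y1 \<in> part g True"
    by (auto simp: sspace_def)
  note s = p[THEN part_sspace]
  have "bracket g x y = bracket g x0 y0 + bracket g x0 y1 + (bracket g x1 y0 + bracket g x1 y1)"
    using s by (simp add: xy bracket_add_left bracket_add_right sspace_add)
  then show ?thesis
    by (simp only:) (intro sspace_add; rule part_sspace, rule bracket_part; rule p)
qed

lemma bracket_sum_left:
  "\<lbrakk>\<And>a. a \<in> A \<Longrightarrow> f a \<in> sspace g; y \<in> sspace g\<rbrakk>
    \<Longrightarrow> bracket g (sum f A) y = (\<Sum>a\<in>A. bracket g (f a) y)"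
  by (induction A rule: infinite_finite_induct)
     (auto simp: bracket_zero_left bracket_add_left sspace_sum)

lemma bracket_sum_right:
  "\<lbrakk>\<And>a. a \<in> A \<Longrightarrow> f a \<in> sspace g; y \<in> sspace g\<rbrakk>
    \<Longrightarrow> bracket g y (sum f A) = (\<Sum>a\<in>A. bracket g y (f a))"
  by (induction A rule: infinite_finite_induct)
     (auto simp: bracket_zero_right bracket_add_right sspace_sum)

end

text \<open>A finite homogeneous basis with its coordinates; \<open>g\<close> lives on a subset of
  its type, so linearity is asked on \<open>sspace g\<close>. With the odd letters first, a normal
  word is an increasing string of distinct odd letters followed by a sorted even string, and
  appending the letter \<open>n - 1\<close>, when it is even, preserves normality.\<close>

locale based_superalgebra = lie_superalgebra g
  for g :: "('k::field, 'a::ab_group_add) lsa" +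
  fixes n :: nat and par :: "nat \<Rightarrow> bool" and b :: "nat \<Rightarrow> 'a" and coord :: "'a \<Rightarrow> nat \<Rightarrow> 'k"
  assumes two: "(2::'k) \<noteq> 0"
    and b_part: "i < n \<Longrightarrow> b i \<in> part g (par i)"
    and coord_add: "x \<in> sspace g \<Longrightarrow> y \<in> sspace g \<Longrightarrow> coord (x + y) i = coord x i + coord y i"
    and coord_smul: "x \<in> sspace g \<Longrightarrow> coord (smul g c x) i = c * coord x i"
    and coord_b: "i < n \<Longrightarrow> j < n \<Longrightarrow> coord (b i) j = (if i = j then 1 else 0)"
    and coord_sum: "x \<in> sspace g \<Longrightarrow> x = (\<Sum>i<n. smul g (coord x i) (b i))"
    and coord_part: "x \<in> part g e \<Longrightarrow> i < n \<Longrightarrow> coord x i \<noteq> 0 \<Longrightarrow> par i = e"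
    and odd_first: "i < n \<Longrightarrow> j < n \<Longrightarrow> par i \<Longrightarrow> \<not> par j \<Longrightarrow> i < j"
begin

lemma b_sspace: "i < n \<Longrightarrow> b i \<in> sspace g"
  using b_part part_sspace by blast

text \<open>Even letters may be repeated and odd ones may not, because the square of an odd element
  is half of its bracket with itself.\<close>

definition before :: "nat \<Rightarrow> nat \<Rightarrow> bool" where
  "before i j \<longleftrightarrow> i < j \<or> i = j \<and> \<not> par i"

definition normal :: "nat list \<Rightarrow> bool" where
  "normal w \<longleftrightarrow> (\<forall>i\<in>set w. i < n) \<and> sorted_wrt before w"

lemma normal_Nil [simp]: "normal []"
  by (simp add: normal_def)

lemma normal_Cons: "normal (i # w) \<longleftrightarrow> i < n \<and> (\<forall>j\<in>set w. before i j) \<and> normal w"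
  by (auto simp: normal_def)

lemma normal_Cons_Cons:
  "normal (i # j # w) \<longleftrightarrow> i < n \<and> before i j \<and> normal (j # w)"
  by (auto simp: normal_Cons before_def)

text \<open>In the last case \<open>b\<^sub>j (b\<^sub>i t)\<close> is needed, where \<open>b\<^sub>i t\<close> contains words longer than \<open>t\<close>; these
  start with a letter after \<open>j\<close>, so that prepending \<open>j\<close> gives the action and the recursion is
  well-founded.\<close>

function act :: "nat \<Rightarrow> nat list \<Rightarrow> (nat list \<Rightarrow>\<^sub>0 'k)" where
  "act i [] = single [i] 1"
| "act i (j # t) =
    (if before i j then single (i # j # t) 1
     else if i = j then scl (1 / 2) (\<Sum>k<n. scl (coord (bracket g (b i) (b i)) k) (act k t))
     else scl (koszul (par i) (par j))
            (lin (\<lambda>w. if length w \<le> length t then act j w else single (j # w) 1) (act i t))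
          + (\<Sum>k<n. scl (coord (bracket g (b i) (b j)) k) (act k t)))"
  by pat_completeness auto
termination
  by (relation "measure (\<lambda>(i, w). length w)") auto

definition rho :: "'a \<Rightarrow> nat list \<Rightarrow> (nat list \<Rightarrow>\<^sub>0 'k)" where
  "rho x w = (\<Sum>i<n. scl (coord x i) (act i w))"

declare act.simps(2) [simp del]

lemma act_normal: "normal (i # w) \<Longrightarrow> act i w = single (i # w) 1"
  by (cases w) (auto simp: normal_Cons act.simps(2))

lemma act_square: "\<not> before i i \<Longrightarrow>
    act i (i # t) = scl (1 / 2) (rho (bracket g (b i) (b i)) t)"
  by (simp add: act.simps(2) rho_def)

lemma act_swap: "j < i \<Longrightarrow> act i (j # t) =
    scl (koszul (par i) (par j))
      (lin (\<lambda>w. if length w \<le> length t then act j w else single (j # w) 1) (act i t))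
    + rho (bracket g (b i) (b j)) t"
  by (simp add: act.simps(2) rho_def before_def)

lemma not_before: "\<not> before i j \<longleftrightarrow> j < i \<or> i = j \<and> par i"
  by (auto simp: before_def)

text \<open>With these weights \<open>ad y\<close>, for odd \<open>y\<close>, has the leading term
  \<open>b\<^sub>j \<mapsto> coord (bracket g y b\<^sub>j) (n - 1) b\<^sub>n\<^sub>-\<^sub>1\<close> on the odd letters, and even letters commute up to
  terms of lower weight.\<close>

definition wt :: "nat \<Rightarrow> nat" where
  "wt i = (if par i then 2 else if Suc i = n then 4 else 3)"

definition weight :: "nat list \<Rightarrow> nat" where
  "weight w = sum_list (map wt w)"

definition parity :: "nat list \<Rightarrow> bool" where
  "parity w \<longleftrightarrow> odd (length (filter par w))"

lemma weight_simps [simp]: "weight [] = 0" "weight (i # w) = wt i + weight w"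
    "weight (v @ w) = weight v + weight w"
  by (simp_all add: weight_def)

lemma parity_simps [simp]: "parity [] = False" "parity (i # w) = (par i \<noteq> parity w)"
  by (auto simp: parity_def)

text \<open>Collects what the induction on \<open>act\<close> has to carry along. The letters are
  controlled only for words that gained a letter: there they guarantee that a smaller letter may be
  put in front. The parity clause later gives the grading of \<open>U(g)\<close>, the weight clause
  its filtration.\<close>

definition reach :: "nat \<Rightarrow> nat list \<Rightarrow> nat list set" where
  "reach i w = {v. normal v \<and> length v \<le> Suc (length w) \<and>
     (length v = Suc (length w) \<longrightarrow> set v \<subseteq> insert i (set w)) \<and>
     parity v = (par i \<noteq> parity w) \<and> weight v \<le> wt i + weight w}"

lemma coord_bracket:
  assumes "i < n" "j < n" "k < n" "coord (bracket g (b i) (b j)) k \<noteq> 0"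
  shows "par k = (par i \<noteq> par j)"
  using coord_part[OF bracket_part[OF b_part b_part]] assms by blast

lemma wt_bounds: "2 \<le> wt i" "wt i \<le> 4"
  by (auto simp: wt_def)

text \<open>A bracket replaces two letters by one. The new letter weighs at most 4 and the two old
  ones together at least 4, so the weight does not grow; the resulting words are too short for the
  clause on letters to apply.\<close>

lemma keys_rho_bracket:
  assumes "i < n" "j < n" and IH: "\<And>k. k < n \<Longrightarrow> keys (act k t) \<subseteq> reach k t"
  shows "keys (rho (bracket g (b i) (b j)) t) \<subseteq> reach i (j # t)"
proof -
  have "keys (scl (coord (bracket g (b i) (b j)) k) (act k t)) \<subseteq> reach i (j # t)"
    if k: "k < n" for k
  proof (cases "coord (bracket g (b i) (b j)) k = 0")
    case False
    then have "par k = (par i \<noteq> par j)" using coord_bracket assms k by blast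
    moreover have "wt k \<le> wt i + wt j"
      using wt_bounds(1)[of i] wt_bounds(1)[of j] wt_bounds(2)[of k] by linarith
    ultimately have "reach k t \<subseteq> reach i (j # t)"
      by (auto simp: reach_def)
    then show ?thesis using IH[OF k] by (intro subset_trans[OF keys_scl_subset]) simp
  qed simp
  then show ?thesis
    unfolding rho_def by (intro keys_sum_subset) auto
qed

text \<open>A word of this maximal length consists of letters of \<open>t\<close> and of
  \<open>i\<close>, all of which \<open>j\<close> precedes.\<close>

lemma normal_Cons_reach:
  assumes "v \<in> reach i t" "length v = Suc (length t)" "normal (j # t)" "before j i"
  shows "normal (j # v)"
  using assms by (auto simp: reach_def normal_Cons)

text \<open>The induction follows the recursion of \<open>act\<close>. When two letters are swapped,
  the words of \<open>act i t\<close> are either no longer than \<open>t\<close>, and the induction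
  hypothesis covers \<open>act j\<close> on them, or of maximal length, and
  \<open>normal_Cons_reach\<close> applies.\<close>

lemma keys_act: "i < n \<Longrightarrow> normal w \<Longrightarrow> keys (act i w) \<subseteq> reach i w"
proof (induction w arbitrary: i rule: measure_induct_rule[of length])
  case (less w)
  show ?case
  proof (cases w)
    case Nil
    then show ?thesis using less.prems by (auto simp: reach_def normal_Cons)
  next
    case (Cons j t)
    have j: "j < n" and t: "normal t" using less.prems Cons by (auto simp: normal_Cons)
    have IHt: "keys (act k t) \<subseteq> reach k t" if "k < n" for k
      using less.IH[of t k] Cons that t by simp
    show ?thesis
    proof (cases "before i j")
      case True
      then have "normal (i # w)" using less.prems Cons by (auto simp: normal_Cons_Cons)
      then show ?thesis using Cons by (auto simp: act_normal reach_def)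
    next
      case nb: False
      show ?thesis
      proof (cases "i = j")
        case True
        have "keys (rho (bracket g (b i) (b i)) t) \<subseteq> reach i (i # t)"
          using keys_rho_bracket[OF less.prems(1) less.prems(1) IHt] by blast
        then show ?thesis
          using nb unfolding Cons True[symmetric]
          by (simp only: act_square not_False_eq_True) (rule subset_trans[OF keys_scl_subset])
      next
        case False
        then have ji: "j < i" using nb by (auto simp: before_def)
        let ?f = "\<lambda>v. if length v \<le> length t then act j v else single (j # v) 1"
        have "keys (?f v) \<subseteq> reach i (j # t)" if v: "v \<in> keys (act i t)" for v
        proof -
          have vr: "v \<in> reach i t" using v IHt less.prems(1) by blast
          show ?thesis
          proof (cases "length v \<le> length t")
            case True
            then have "keys (act j v) \<subseteq> reach j v"
              using less.IH[of v j] Cons j vr by (auto simp: reach_def)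
            moreover have "reach j v \<subseteq> reach i (j # t)"
              using vr True by (auto simp: reach_def)
            ultimately show ?thesis using True by auto
          next
            case False
            then have l: "length v = Suc (length t)" using vr by (auto simp: reach_def)
            have "normal (j # v)"
              using normal_Cons_reach[OF vr l] less.prems Cons ji by (auto simp: before_def)
            then show ?thesis using vr l by (auto simp: reach_def)
          qed
        qed
        then have "keys (scl (koszul (par i) (par j)) (lin ?f (act i t))) \<subseteq> reach i (j # t)"
          by (intro subset_trans[OF keys_scl_subset] keys_lin_subset)
        then show ?thesis
          unfolding Cons act_swap[OF ji]
          using keys_rho_bracket[OF less.prems(1) j IHt] by (intro keys_add_subset) auto
      qed
    qed
  qed
qed

lemma act_normal_keys: "\<lbrakk>i < n; normal w; v \<in> keys (act i w)\<rbrakk> \<Longrightarrow> normal v"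
  using keys_act[of i w] unfolding reach_def by blast

end

section \<open>The bracket relations on the span of the normal words\<close>

context based_superalgebra
begin

definition op :: "'a \<Rightarrow> (nat list \<Rightarrow>\<^sub>0 'k) \<Rightarrow> (nat list \<Rightarrow>\<^sub>0 'k)" where
  "op x = lin (rho x)"

text \<open>\<open>act\<close> is a total function, but the bracket relations are proved on this
  span; it is the module on which \<open>U(g)\<close> acts.\<close>

definition NP :: "(nat list \<Rightarrow>\<^sub>0 'k) set" where
  "NP = {p. \<forall>w\<in>keys p. normal w}"

lemma rho_b: "i < n \<Longrightarrow> rho (b i) w = act i w"
proof -
  assume i: "i < n"
  have "rho (b i) w = (\<Sum>k<n. if k = i then act i w else 0)"
    unfolding rho_def by (rule sum.cong) (use i in \<open>auto simp: coord_b\<close>)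
  then show ?thesis using i by simp
qed

lemma rho_add: "x \<in> sspace g \<Longrightarrow> y \<in> sspace g \<Longrightarrow> rho (x + y) w = rho x w + rho y w"
  by (simp add: rho_def coord_add pm.scale_left_distrib sum.distrib)

lemma rho_smul: "x \<in> sspace g \<Longrightarrow> rho (smul g c x) w = scl c (rho x w)"
  by (simp add: rho_def coord_smul pm.scale_sum_right)

lemma rho_zero [simp]: "rho 0 w = 0"
  using rho_smul[of 0 0 w] sspace_zero by simp

lemma rho_uminus: "x \<in> sspace g \<Longrightarrow> rho (- x) w = - rho x w"
  using rho_smul[of x "- 1" w] by simp

lemma rho_diff: "x \<in> sspace g \<Longrightarrow> y \<in> sspace g \<Longrightarrow> rho (x - y) w = rho x w - rho y w"
  using rho_add[of x "- y" w] rho_uminus[of y w] sspace_smul[of y "- 1"] by simp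

lemma rho_sum: "(\<And>a. a \<in> A \<Longrightarrow> f a \<in> sspace g) \<Longrightarrow> rho (sum f A) w = (\<Sum>a\<in>A. rho (f a) w)"
  by (induction A rule: infinite_finite_induct) (auto simp: rho_add sspace_sum)

lemma op_add: "op x (p + q) = op x p + op x q"
  by (simp add: op_def lin_add)

lemma op_diff: "op x (p - q) = op x p - op x q"
  by (simp add: op_def lin_diff)

lemma op_scl: "op x (scl c p) = scl c (op x p)"
  by (simp add: op_def lin_scl)

lemma op_zero [simp]: "op x 0 = 0"
  by (simp add: op_def)

lemma op_sum: "op x (sum p A) = (\<Sum>a\<in>A. op x (p a))"
  by (simp add: op_def lin_sum)

lemma op_single [simp]: "op x (single w 1) = rho x w"
  by (simp add: op_def)

lemma op_add_left: "x \<in> sspace g \<Longrightarrow> y \<in> sspace g \<Longrightarrow> op (x + y) p = op x p + op y p"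
  unfolding op_def lin_fun_add[symmetric] by (rule lin_cong) (rule rho_add)

lemma op_smul_left: "x \<in> sspace g \<Longrightarrow> op (smul g c x) p = scl c (op x p)"
  unfolding op_def lin_fun_scl[symmetric] by (rule lin_cong) (rule rho_smul)

lemma op_zero_left [simp]: "op 0 p = 0"
  using op_smul_left[of 0 0 p] sspace_zero by simp

lemma op_b: "i < n \<Longrightarrow> op (b i) p = lin (act i) p"
  unfolding op_def by (rule lin_cong) (rule rho_b)

lemma op_expand: "op x p = (\<Sum>i<n. scl (coord x i) (op (b i) p))"
proof -
  have "op x p = lin (\<lambda>w. \<Sum>i<n. scl (coord x i) (act i w)) p"
    unfolding op_def by (rule lin_cong) (simp add: rho_def)
  also have "\<dots> = (\<Sum>i<n. scl (coord x i) (lin (act i) p))"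
    by (simp add: lin_fun_sum lin_fun_scl)
  also have "\<dots> = (\<Sum>i<n. scl (coord x i) (op (b i) p))"
    by (rule sum.cong) (auto simp: op_b)
  finally show ?thesis .
qed

lemma NP_zero [simp]: "0 \<in> NP"
  by (simp add: NP_def)

lemma NP_add: "p \<in> NP \<Longrightarrow> q \<in> NP \<Longrightarrow> p + q \<in> NP"
  using keys_add[of p q] by (auto simp: NP_def)

lemma NP_scl: "p \<in> NP \<Longrightarrow> scl c p \<in> NP"
  using keys_scl_subset[of c p] by (auto simp: NP_def)

lemma NP_sum: "(\<And>a. a \<in> A \<Longrightarrow> f a \<in> NP) \<Longrightarrow> sum f A \<in> NP"
  by (induction A rule: infinite_finite_induct) (auto simp: NP_add)

lemma NP_single [simp]: "normal w \<Longrightarrow> single w c \<in> NP"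
  by (simp add: NP_def)

lemma NP_act: "i < n \<Longrightarrow> normal w \<Longrightarrow> act i w \<in> NP"
  by (simp add: NP_def act_normal_keys)

lemma NP_rho: "normal w \<Longrightarrow> rho x w \<in> NP"
  unfolding rho_def by (intro NP_sum NP_scl NP_act) auto

lemma NP_lin: "p \<in> NP \<Longrightarrow> (\<And>w. normal w \<Longrightarrow> f w \<in> NP) \<Longrightarrow> lin f p \<in> NP"
  unfolding lin_def by (intro NP_sum NP_scl) (auto simp: NP_def)

lemma NP_op: "p \<in> NP \<Longrightarrow> op x p \<in> NP"
  unfolding op_def by (rule NP_lin) (auto intro: NP_rho)

text \<open>One defining relation tested on one word. With both the pair of indices and the word as
  parameters, an induction on the length of the word can use pairs that are already known on longer
  words.\<close>

definition rel :: "nat \<Rightarrow> nat \<Rightarrow> nat list \<Rightarrow> bool" where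
  "rel i j w \<longleftrightarrow> op (b i) (act j w) =
     scl (koszul (par i) (par j)) (op (b j) (act i w)) + rho (bracket g (b i) (b j)) w"

text \<open>The clause of \<open>act\<close> for a larger letter is this relation, except that it
  prepends \<open>j\<close> to the words of maximal length; there prepending and acting agree
  because the result is normal.\<close>

lemma rel_direct:
  assumes "i < n" "j < n" "j < i" "normal (j # w)"
  shows "rel i j w"
proof -
  have w: "normal w" using assms(4) by (simp add: normal_Cons)
  have "lin (\<lambda>v. if length v \<le> length w then act j v else single (j # v) 1) (act i w)
      = lin (act j) (act i w)"
  proof (rule lin_cong)
    fix v assume "v \<in> keys (act i w)"
    then have v: "v \<in> reach i w" using keys_act[OF assms(1) w] by blast
    show "(if length v \<le> length w then act j v else single (j # v) 1) = act j v"
    proof (cases "length v \<le> length w")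
      case False
      then have "length v = Suc (length w)" using v by (auto simp: reach_def)
      then have "normal (j # v)"
        using normal_Cons_reach[OF v] assms by (auto simp: before_def)
      then show ?thesis using False by (simp add: act_normal)
    qed simp
  qed
  then show ?thesis
    using act_swap[OF assms(3), of w] assms
    by (simp add: rel_def act_normal op_b rho_b)
qed

lemma act_act_square:
  assumes "i < n" "par i" "normal (i # w)"
  shows "op (b i) (act i w) = scl (1 / 2) (rho (bracket g (b i) (b i)) w)"
  using assms by (simp add: act_normal rho_b act_square before_def)

lemma bracket_swap_b:
  assumes "i < n" "j < n"
  shows "bracket g (b i) (b j) = - smul g (koszul (par i) (par j)) (bracket g (b j) (b i))"
  using super_skew[OF b_part[OF assms(1)] b_part[OF assms(2)]] .

lemma rel_swap:
  assumes "i < n" "j < n" "rel i j w"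
  shows "rel j i w"
proof -
  let ?s = "koszul (par i) (par j) :: 'k"
  have s: "koszul (par j) (par i) = ?s" by (simp add: koszul_def)
  have B: "bracket g (b i) (b j) \<in> sspace g" using assms b_sspace bracket_sspace by blast
  have r: "rho (bracket g (b j) (b i)) w = - scl ?s (rho (bracket g (b i) (b j)) w)"
    unfolding bracket_swap_b[OF assms(2,1)] s using B by (simp add: rho_uminus rho_smul sspace_smul)
  show ?thesis
    using assms(3) unfolding rel_def s r
    by (cases "par i \<and> par j") (auto simp: koszul_def)
qed

text \<open>Skew-symmetry makes the bracket its own negative, and 2 is invertible.\<close>

lemma rel_even: "i < n \<Longrightarrow> \<not> par i \<Longrightarrow> rel i i w"
proof -
  assume i: "i < n" "\<not> par i"
  have B: "bracket g (b i) (b i) \<in> sspace g" using i b_sspace bracket_sspace by blast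
  have "bracket g (b i) (b i) = - bracket g (b i) (b i)"
    using bracket_swap_b[OF i(1) i(1)] i by simp
  then have "rho (bracket g (b i) (b i)) w = - rho (bracket g (b i) (b i)) w"
    using rho_uminus[OF B, of w] by simp
  then have "rho (bracket g (b i) (b i)) w + rho (bracket g (b i) (b i)) w = 0"
    by (simp add: eq_neg_iff_add_eq_0)
  then have "rho (bracket g (b i) (b i)) w = 0"
    using pm_half_double[OF two] by fastforce
  then show ?thesis using i by (simp add: rel_def)
qed

text \<open>Both sides are bilinear in \<open>x\<close> and \<open>y\<close>. A nonzero product of
  coordinates forces the parities of the two basis elements to be \<open>e\<close> and
  \<open>d\<close>, so the sign in \<open>rel\<close> is the one in the claim.\<close>

lemma op_op:
  assumes p: "\<And>w i j. \<lbrakk>w \<in> keys p; i < n; j < n\<rbrakk> \<Longrightarrow> rel i j w"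
    and x: "x \<in> part g e" and y: "y \<in> part g d"
  shows "op x (op y p) = scl (koszul e d) (op y (op x p)) + op (bracket g x y) p"
proof -
  note xs = part_sspace[OF x] and ys = part_sspace[OF y]
  have W: "op x (rho y w) = scl (koszul e d) (op y (rho x w)) + rho (bracket g x y) w"
    if w: "w \<in> keys p" for w
  proof -
    have "op x (rho y w) = (\<Sum>i<n. \<Sum>j<n. scl (coord x i * coord y j) (op (b i) (act j w)))"
      by (subst op_expand) (simp add: rho_def op_sum op_scl pm.scale_sum_right)
    also have "\<dots> = (\<Sum>i<n. \<Sum>j<n. scl (coord x i * coord y j)
        (scl (koszul e d) (op (b j) (act i w)) + rho (bracket g (b i) (b j)) w))"
    proof (intro sum.cong refl)
      fix i j assume ij: "i \<in> {..<n}" "j \<in> {..<n}"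
      show "scl (coord x i * coord y j) (op (b i) (act j w)) = scl (coord x i * coord y j)
          (scl (koszul e d) (op (b j) (act i w)) + rho (bracket g (b i) (b j)) w)"
      proof (cases "coord x i * coord y j = 0")
        case False
        then have "par i = e" "par j = d" using coord_part x y ij by auto
        then show ?thesis using p[OF w, of i j] ij by (simp add: rel_def)
      qed simp
    qed
    also have "\<dots> = scl (koszul e d) (\<Sum>i<n. \<Sum>j<n. scl (coord x i * coord y j) (op (b j) (act i w)))
        + (\<Sum>i<n. \<Sum>j<n. scl (coord x i * coord y j) (rho (bracket g (b i) (b j)) w))"
      by (simp add: pm.scale_right_distrib sum.distrib pm.scale_sum_right mult.commute)
    also have "(\<Sum>i<n. \<Sum>j<n. scl (coord x i * coord y j) (op (b j) (act i w))) = op y (rho x w)"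
      by (subst sum.swap, subst op_expand)
         (simp add: rho_def op_sum op_scl pm.scale_sum_right mult.commute)
    also have "(\<Sum>i<n. \<Sum>j<n. scl (coord x i * coord y j) (rho (bracket g (b i) (b j)) w))
        = rho (\<Sum>i<n. \<Sum>j<n. smul g (coord x i * coord y j) (bracket g (b i) (b j))) w"
    proof -
      have B: "bracket g (b i) (b j) \<in> sspace g" if "i < n" "j < n" for i j
        using that by (simp add: bracket_sspace b_sspace)
      have "rho (\<Sum>i<n. \<Sum>j<n. smul g (coord x i * coord y j) (bracket g (b i) (b j))) w
          = (\<Sum>i<n. rho (\<Sum>j<n. smul g (coord x i * coord y j) (bracket g (b i) (b j))) w)"
        by (rule rho_sum) (auto intro!: sspace_sum sspace_smul B)
      also have "\<dots> = (\<Sum>i<n. \<Sum>j<n. rho (smul g (coord x i * coord y j) (bracket g (b i) (b j))) w)"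
        by (rule sum.cong[OF refl], rule rho_sum) (auto intro!: sspace_smul B)
      also have "\<dots> = (\<Sum>i<n. \<Sum>j<n. scl (coord x i * coord y j) (rho (bracket g (b i) (b j)) w))"
        by (intro sum.cong refl rho_smul B) auto
      finally show ?thesis by simp
    qed
    also have "(\<Sum>i<n. \<Sum>j<n. smul g (coord x i * coord y j) (bracket g (b i) (b j)))
        = bracket g (\<Sum>i<n. smul g (coord x i) (b i)) (\<Sum>j<n. smul g (coord y j) (b j))"
    proof -
      have "bracket g (\<Sum>i<n. smul g (coord x i) (b i)) (\<Sum>j<n. smul g (coord y j) (b j))
          = (\<Sum>i<n. bracket g (smul g (coord x i) (b i)) (\<Sum>j<n. smul g (coord y j) (b j)))"
        by (rule bracket_sum_left) (auto intro!: sspace_sum sspace_smul b_sspace)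
      also have "\<dots> = (\<Sum>i<n. \<Sum>j<n. bracket g (smul g (coord x i) (b i)) (smul g (coord y j) (b j)))"
        by (rule sum.cong[OF refl], rule bracket_sum_right) (auto intro!: sspace_smul b_sspace)
      also have "\<dots> = (\<Sum>i<n. \<Sum>j<n. smul g (coord x i * coord y j) (bracket g (b i) (b j)))"
        by (intro sum.cong refl) (simp add: bracket_smul_left bracket_smul_right sspace_smul b_sspace)
      finally show ?thesis by simp
    qed
    also have "\<dots> = bracket g x y"
      using coord_sum[OF xs] coord_sum[OF ys] by simp
    finally show ?thesis .
  qed
  have "op x (op y p) = lin (\<lambda>w. op x (rho y w)) p"
    by (simp add: op_def lin_lin)
  also have "\<dots> = lin (\<lambda>w. scl (koszul e d) (op y (rho x w)) + rho (bracket g x y) w) p"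
    by (rule lin_cong) (rule W)
  also have "\<dots> = scl (koszul e d) (op y (op x p)) + op (bracket g x y) p"
    by (simp add: op_def lin_lin lin_fun_add lin_fun_scl)
  finally show ?thesis .
qed

lemma op_rho:
  assumes "\<And>i j. \<lbrakk>i < n; j < n\<rbrakk> \<Longrightarrow> rel i j t" "x \<in> part g e" "y \<in> part g d"
  shows "op x (rho y t) = scl (koszul e d) (op y (rho x t)) + rho (bracket g x y) t"
  using op_op[of "single t 1" x e y d] assms by simp

text \<open>Asks for the relation for a single pair of indices, which is all that is known on words
  as long as the one under induction.\<close>

lemma op_op_b:
  assumes "\<And>w. w \<in> keys p \<Longrightarrow> rel i j w" "i < n" "j < n"
  shows "op (b i) (op (b j) p)
    = scl (koszul (par i) (par j)) (op (b j) (op (b i) p)) + op (bracket g (b i) (b j)) p"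
proof -
  have "op (b i) (op (b j) p) = lin (\<lambda>w. op (b i) (act j w)) p"
    using assms by (simp add: op_b[of j] op_def[of "b i"] lin_lin)
  also have "\<dots> = lin (\<lambda>w. scl (koszul (par i) (par j)) (op (b j) (act i w))
      + rho (bracket g (b i) (b j)) w) p"
    by (rule lin_cong) (use assms in \<open>auto simp: rel_def\<close>)
  also have "\<dots> = scl (koszul (par i) (par j)) (op (b j) (op (b i) p)) + op (bracket g (b i) (b j)) p"
    using assms by (simp add: op_b[of i] op_def[of "b j"] op_def[of "bracket g (b i) (b j)"]
        lin_lin lin_fun_add lin_fun_scl)
  finally show ?thesis .
qed

lemma b_bracket_part:
  "i < n \<Longrightarrow> j < n \<Longrightarrow> bracket g (b i) (b j) \<in> part g (par i \<noteq> par j)"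
  using bracket_part b_part by blast

lemma reach_lt:
  assumes "i < n" "normal t" "v \<in> keys (act i t)"
  shows "normal v" "length v \<le> Suc (length t)" "v \<in> reach i t"
  using keys_act[OF assms(1,2)] assms(3) by (auto simp: reach_def)

text \<open>The overlap \<open>b_i b_j b_k\<close> with the smallest letter \<open>k\<close> at the
  front of \<open>w\<close>. Moving \<open>b_k\<close> to the left through both products reduces the
  claim to relations on \<open>t\<close>; the remaining double brackets cancel by the Jacobi
  identity.\<close>

lemma rel_lower:
  assumes IH: "\<And>v i j. \<lbrakk>length v < length w; normal v; i < n; j < n\<rbrakk> \<Longrightarrow> rel i j v"
    and ij: "i < n" "j < n" "j \<le> i" and w: "normal w" "w = k # t" and k: "k < j"
  shows "rel i j w"
proof -
  have kn: "k < n" and t: "normal t" and kt: "normal (k # t)" using w by (auto simp: normal_Cons)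
  let ?si = "koszul (par i) (par k) :: 'k" and ?sj = "koszul (par j) (par k) :: 'k"
  have rt: "rel i j t" if "i < n" "j < n" for i j using IH[of t] t w that by simp
  \<comment> \<open>The words of \<open>act j t\<close> can be as long as \<open>w\<close>, out of
    reach of the induction hypothesis; but then \<open>k # v\<close> is normal and the relation
    holds directly.\<close>
  have step: "op (b i) (op (b k) (act j t)) = scl (koszul (par i) (par k)) (op (b k) (op (b i) (act j t)))
      + op (bracket g (b i) (b k)) (act j t)" if "i < n" "j < n" "k < i" "k < j" for i j
  proof (rule op_op_b)
    fix v assume v: "v \<in> keys (act j t)"
    note r = reach_lt[OF that(2) t v]
    show "rel i k v"
    proof (cases "length v \<le> length t")
      case True
      then show ?thesis using IH[of v i k] r w that kn by simp
    next
      case False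
      then have "normal (k # v)"
        using r that kt by (intro normal_Cons_reach[OF r(3)]) (auto simp: before_def)
      then show ?thesis using rel_direct[of i k v] that kn by simp
    qed
  qed (use that kn in auto)
  have half: "op (b i) (act j w) =
      scl (koszul (par j) (par k)) (scl (koszul (par i) (par k)) (op (b k) (op (b i) (act j t)))
        + op (bracket g (b i) (b k)) (act j t))
      + (scl (koszul (par i) (par j \<noteq> par k)) (op (bracket g (b j) (b k)) (act i t))
        + rho (bracket g (b i) (bracket g (b j) (b k))) t)"
    if "i < n" "j < n" "k < i" "k < j" for i j
  proof -
    have "act j w = op (b j) (act k t)"
      using w kt that by (simp add: act_normal rho_b)
    also have "\<dots> = scl (koszul (par j) (par k)) (op (b k) (act j t)) + rho (bracket g (b j) (b k)) t"
      using rt[of j k] that kn by (simp add: rel_def)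
    finally have "op (b i) (act j w) = scl (koszul (par j) (par k)) (op (b i) (op (b k) (act j t)))
        + op (b i) (rho (bracket g (b j) (b k)) t)"
      by (simp add: op_add op_scl)
    moreover have "op (b i) (rho (bracket g (b j) (b k)) t) =
        scl (koszul (par i) (par j \<noteq> par k)) (op (bracket g (b j) (b k)) (act i t))
        + rho (bracket g (b i) (bracket g (b j) (b k))) t"
      using op_rho[OF rt b_part[OF that(1)] b_bracket_part[OF that(2) kn]] that by (simp add: rho_b)
    ultimately show ?thesis using step[OF that] by simp
  qed
  have ki: "k < i" using k ij by simp
  have X: "op (b k) (op (b i) (act j t)) = scl (koszul (par i) (par j)) (op (b k) (op (b j) (act i t)))
      + op (b k) (rho (bracket g (b i) (b j)) t)"
    using rt[OF ij(1,2)] by (simp add: rel_def op_add op_scl)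
  have act_k: "w = k # t \<Longrightarrow> rho x w = op x (act k t)" for x using kt by (simp add: act_normal)
  \<comment> \<open>Here \<open>b k\<close> is moved back to the right, where it turns
    \<open>t\<close> into \<open>w\<close>.\<close>
  have C: "op (b k) (rho (bracket g (b i) (b j)) t) =
      scl (koszul (par k) (par i \<noteq> par j)) (rho (bracket g (b i) (b j)) w)
      + rho (bracket g (b k) (bracket g (b i) (b j))) t"
    using op_rho[OF rt b_part[OF kn] b_bracket_part[OF ij(1,2)]] kn
    by (simp add: rho_b act_k[OF w(2)])
  have sk: "bracket g (bracket g (b i) (b j)) (b k) =
      - smul g (koszul (par i \<noteq> par j) (par k)) (bracket g (b k) (bracket g (b i) (b j)))"
    using super_skew[OF b_bracket_part[OF ij(1,2)] b_part[OF kn]] .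
  have jac: "bracket g (b i) (bracket g (b j) (b k)) =
      - smul g (koszul (par i \<noteq> par j) (par k)) (bracket g (b k) (bracket g (b i) (b j)))
      + smul g (koszul (par i) (par j)) (bracket g (b j) (bracket g (b i) (b k)))"
    using super_jacobi[OF b_part[OF ij(1)] b_part[OF ij(2)] b_sspace[OF kn]] by (simp only: sk)
  have ss: "bracket g (b k) (bracket g (b i) (b j)) \<in> sspace g"
      "bracket g (b j) (bracket g (b i) (b k)) \<in> sspace g"
    using ij kn by (simp_all add: bracket_sspace b_sspace)
  have J: "rho (bracket g (b i) (bracket g (b j) (b k))) t =
      - scl (koszul (par i \<noteq> par j) (par k)) (rho (bracket g (b k) (bracket g (b i) (b j))) t)
      + scl (koszul (par i) (par j)) (rho (bracket g (b j) (bracket g (b i) (b k))) t)"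
    unfolding jac using ss by (simp add: rho_diff rho_smul sspace_smul)
  \<comment> \<open>The signs depend on three parities; in each of the eight cases the claim is a
    linear identity.\<close>
  show ?thesis
    unfolding rel_def half[OF ij(1,2) ki k] half[OF ij(2,1) k ki] X C J
    by (cases "par i"; cases "par j"; cases "par k") (simp_all add: algebra_simps)
qed

text \<open>The overlap \<open>b_i b_j b_j\<close> with \<open>b_j\<close> odd. The square of
  \<open>b_j\<close> acts as half of \<open>[b_j, b_j]\<close>, and the Jacobi identity makes
  \<open>[b_i, [b_j, b_j]]\<close> equal to twice \<open>[b_j, [b_i, b_j]]\<close> up to sign;
  dividing by 2 matches the two sides.\<close>

lemma rel_repeat:
  assumes IH: "\<And>v i j. \<lbrakk>length v < length w; normal v; i < n; j < n\<rbrakk> \<Longrightarrow> rel i j v"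
    and ij: "i < n" "j < n" "j < i" and w: "normal w" "w = j # t" and j: "par j"
  shows "rel i j w"
proof -
  have t: "normal t" and jt: "normal (j # t)" using w by (auto simp: normal_Cons)
  let ?s = "koszul (par i) (par j) :: 'k"
  let ?jj = "bracket g (b j) (b j)" and ?ij = "bracket g (b i) (b j)"
  have jjp: "?jj \<in> part g False" using b_bracket_part[OF ij(2) ij(2)] by simp
  have rt: "rel i j t" if "i < n" "j < n" for i j using IH[of t] t w that by simp
  \<comment> \<open>Short words satisfy \<open>rel j j\<close> by induction, which says that twice
    the square is the bracket; to the long ones \<open>j\<close> can be prepended, and the clause of
    \<open>act\<close> for a repeated odd letter applies.\<close>
  have sq: "op (b j) (act j v) = scl (1 / 2) (rho ?jj v)" if v: "v \<in> keys (act i t)" for v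
  proof (cases "length v \<le> length t")
    note r = reach_lt[OF ij(1) t v]
    case True
    then have "rel j j v" using IH[of v j j] r w ij by simp
    then have "op (b j) (act j v) = rho ?jj v - op (b j) (act j v)"
      using j by (simp add: rel_def)
    then have "op (b j) (act j v) + op (b j) (act j v) = rho ?jj v"
      by (simp only: eq_diff_eq)
    then show ?thesis using pm_half_double[OF two] by blast
  next
    note r = reach_lt[OF ij(1) t v]
    case False
    then have "normal (j # v)"
      using r ij jt by (intro normal_Cons_reach[OF r(3)]) (auto simp: before_def)
    then show ?thesis using act_act_square ij j by blast
  qed
  have jj: "op (b j) (op (b j) (act i t)) = scl (1 / 2) (op ?jj (act i t))"
  proof -
    have "op (b j) (op (b j) (act i t)) = lin (\<lambda>v. op (b j) (act j v)) (act i t)"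
      using ij by (simp add: op_b[of j] lin_lin)
    also have "\<dots> = lin (\<lambda>v. scl (1 / 2) (rho ?jj v)) (act i t)"
      by (rule lin_cong) (rule sq)
    finally show ?thesis by (simp add: lin_fun_scl op_def)
  qed
  have ajw: "act j w = scl (1 / 2) (rho ?jj t)"
    using act_act_square[OF ij(2) j jt] w jt ij by (simp add: act_normal rho_b)
  have aiw: "act i w = scl ?s (op (b j) (act i t)) + rho ?ij t"
    using rel_direct[OF ij jt] w jt ij by (simp add: rel_def act_normal rho_b)
  have L: "op (b i) (act j w) = scl (1 / 2) (op ?jj (act i t) + rho (bracket g (b i) ?jj) t)"
    using op_rho[OF rt b_part[OF ij(1)] jjp] ij by (simp add: ajw op_scl rho_b)
  have Rw: "rho ?ij w = op ?ij (act j t)" using w jt by (simp add: act_normal)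
  have R: "op (b j) (act i w) = scl ?s (scl (1 / 2) (op ?jj (act i t)))
      + (scl (koszul True (par i \<noteq> par j)) (rho ?ij w) + rho (bracket g (b j) ?ij) t)"
    using op_rho[OF rt b_part[OF ij(2)] b_bracket_part[OF ij(1,2)]] ij j
    by (simp add: aiw op_add op_scl jj rho_b Rw)
  have ss: "bracket g (b j) ?ij \<in> sspace g" "bracket g (b i) ?jj \<in> sspace g"
    using ij by (simp_all add: bracket_sspace b_sspace)
  have sk: "bracket g ?ij (b j) = - smul g (koszul (par i \<noteq> par j) (par j)) (bracket g (b j) ?ij)"
    using super_skew[OF b_bracket_part[OF ij(1,2)] b_part[OF ij(2)]] .
  have jac: "bracket g (b i) ?jj = smul g ?s (bracket g (b j) ?ij) + smul g ?s (bracket g (b j) ?ij)"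
    using super_jacobi[OF b_part[OF ij(1)] b_part[OF ij(2)] b_sspace[OF ij(2)]] j
    by (cases "par i") (simp_all add: sk)
  have "rho (bracket g (b i) ?jj) t =
      scl ?s (rho (bracket g (b j) ?ij) t) + scl ?s (rho (bracket g (b j) ?ij) t)"
    unfolding jac using ss by (simp add: rho_add rho_smul sspace_smul)
  then have J: "scl (1 / 2) (rho (bracket g (b i) ?jj) t) = scl ?s (rho (bracket g (b j) ?ij) t)"
    using pm_half_double[OF two] by metis
  show ?thesis
    unfolding rel_def L R pm.scale_right_distrib J using j by (cases "par i") simp_all
qed

text \<open>The overlap \<open>b_i b_i b_i\<close>. Here \<open>b_i\<close> has to commute with
  \<open>[b_i, b_i]\<close>, which is the axiom \<open>odd_cube\<close>; in characteristic 3 the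
  Jacobi identity does not give it.\<close>

lemma rel_cube:
  assumes IH: "\<And>v i j. \<lbrakk>length v < length w; normal v; i < n; j < n\<rbrakk> \<Longrightarrow> rel i j v"
    and i: "i < n" "par i" and w: "normal w" "w = i # t"
  shows "rel i i w"
proof -
  have t: "normal t" and it: "normal (i # t)" using w by (auto simp: normal_Cons)
  let ?ii = "bracket g (b i) (b i)"
  have iip: "?ii \<in> part g False" using b_bracket_part[OF i(1) i(1)] by simp
  have rt: "rel i j t" if "i < n" "j < n" for i j using IH[of t] t w that by simp
  have cube: "bracket g (b i) ?ii = 0" using odd_cube b_part i by metis
  have "act i w = scl (1 / 2) (rho ?ii t)"
    using act_act_square[OF i it] w it i by (simp add: act_normal rho_b)
  then have "op (b i) (act i w) = scl (1 / 2) (op (b i) (rho ?ii t))"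
    by (simp add: op_scl)
  also have "op (b i) (rho ?ii t) = rho ?ii w"
    using op_rho[OF rt b_part[OF i(1)] iip] i w it by (simp add: rho_b cube act_normal)
  finally have "op (b i) (act i w) = scl (1 / 2) (rho ?ii w)" .
  then have "op (b i) (act i w) + op (b i) (act i w) = scl (1 / 2 + 1 / 2) (rho ?ii w)"
    by (simp only: pm.scale_left_distrib)
  also have "(1 / 2 + 1 / 2 :: 'k) = 1" using two by (simp add: field_simps)
  finally show ?thesis using i by (simp add: rel_def algebra_simps)
qed

text \<open>By \<open>rel_swap\<close> it suffices to take \<open>j \<le> i\<close>. If
  \<open>j # w\<close> is normal, the relation comes from the definition of \<open>act\<close> or
  from \<open>rel_even\<close>. Otherwise \<open>w\<close> starts with a letter smaller than
  \<open>j\<close>, or with \<open>j\<close> itself, which is then odd; this leads to the three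
  overlaps.\<close>

lemma rel_normal: "\<lbrakk>normal w; i < n; j < n\<rbrakk> \<Longrightarrow> rel i j w"
proof (induction w arbitrary: i j rule: measure_induct_rule[of length])
  case (less w)
  have le: "rel i j w" if ij: "i < n" "j < n" "j \<le> i" for i j
  proof (cases "normal (j # w)")
    case True
    show ?thesis
    proof (cases "j < i")
      case False
      then have e: "j = i" using ij by simp
      show ?thesis
      proof (cases "par i")
        case odd: True
        have h: "op (b i) (act i w) = scl (1 / 2) (rho (bracket g (b i) (b i)) w)"
          using act_act_square[OF ij(1) odd] True e by simp
        have "op (b i) (act i w) + op (b i) (act i w)
            = scl (1 / 2 + 1 / 2) (rho (bracket g (b i) (b i)) w)"
          unfolding h by (simp only: pm.scale_left_distrib)
        also have "(1 / 2 + 1 / 2 :: 'k) = 1" using two by (simp add: field_simps)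
        finally show ?thesis using odd e by (simp add: rel_def algebra_simps)
      qed (use ij e rel_even in auto)
    qed (use ij True rel_direct in auto)
  next
    case False
    then obtain k t where w: "w = k # t" and k: "\<not> before j k"
      using less.prems ij by (cases w) (auto simp: normal_Cons before_def)
    note IH = less.IH
    from k consider "k < j" | "k = j" "par j" "j < i" | "k = j" "par j" "j = i"
      using ij(3) unfolding not_before by force
    then show ?thesis
    proof cases
      case 1
      then show ?thesis using rel_lower[OF IH ij less.prems(1) w] by blast
    next
      case 2
      then show ?thesis using rel_repeat[OF IH ij(1,2) _ less.prems(1)] w by blast
    next
      case 3
      then show ?thesis using rel_cube[OF IH ij(1) _ less.prems(1)] w by blast
    qed
  qed
  show ?case
    using le[OF less.prems(2,3)] rel_swap[OF less.prems(3,2) le[OF less.prems(3,2)]]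
    by (cases "j \<le> i") auto
qed

text \<open>The span of the normal words is thereby a representation of \<open>g\<close>; it carries
  the independence half of the Poincare-Birkhoff-Witt theorem.\<close>

theorem op_commute:
  assumes "p \<in> NP" "x \<in> part g e" "y \<in> part g d"
  shows "op x (op y p) = scl (koszul e d) (op y (op x p)) + op (bracket g x y) p"
  by (rule op_op) (use assms rel_normal in \<open>auto simp: NP_def\<close>)

end

section \<open>The universal enveloping algebra acting on normal words\<close>

lemma pm_sum_single: "(\<Sum>v\<in>keys p. single v (lookup p v)) = p"
  by (rule poly_mapping_eqI)
     (auto simp: lookup_sum lookup_single when_def in_keys_iff sum.delta)

lemma letters_zero [simp]: "letters 0 = []"
  by (simp add: zero_fmon_def)

lemma letters_plus [simp]: "letters (v + w) = letters v @ letters w"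
  by (simp add: plus_fmon_def)

lemma const_mult: "const c * f = scl c f"
  by (simp add: const_def scl_def mult_map_scale_conv_mult)

lemma free_algebra_simps [simp]:
  "monoid.mult (free_algebra X) = (*)" "one (free_algebra X) = 1"
  "zero (free_algebra X) = 0" "add (free_algebra X) = (+)"
  by (simp_all add: free_algebra_def)

lemma carrier_free_algebra:
  "carrier (free_algebra X) = {f. \<forall>w\<in>keys f. set (letters w) \<subseteq> X}"
  by (simp add: free_algebra_def)

lemma free_algebra_closed:
  fixes f h :: "'a fmon \<Rightarrow>\<^sub>0 'k::field"
  shows "f \<in> carrier (free_algebra X) \<Longrightarrow> h \<in> carrier (free_algebra X) \<Longrightarrow> f + h \<in> carrier (free_algebra X)"
    and "f \<in> carrier (free_algebra X) \<Longrightarrow> - f \<in> carrier (free_algebra X)"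
    and "f \<in> carrier (free_algebra X) \<Longrightarrow> h \<in> carrier (free_algebra X) \<Longrightarrow> f - h \<in> carrier (free_algebra X)"
    and "f \<in> carrier (free_algebra X) \<Longrightarrow> h \<in> carrier (free_algebra X) \<Longrightarrow> f * h \<in> carrier (free_algebra X)"
    and "f \<in> carrier (free_algebra X) \<Longrightarrow> scl c f \<in> carrier (free_algebra X)"
    and "(1 :: 'a fmon \<Rightarrow>\<^sub>0 'k) \<in> carrier (free_algebra X)"
    and "(0 :: 'a fmon \<Rightarrow>\<^sub>0 'k) \<in> carrier (free_algebra X)"
    and "(const c :: 'a fmon \<Rightarrow>\<^sub>0 'k) \<in> carrier (free_algebra X)"
    and "x \<in> X \<Longrightarrow> (gen x :: 'a fmon \<Rightarrow>\<^sub>0 'k) \<in> carrier (free_algebra X)"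
proof -
  show a: "f \<in> carrier (free_algebra X) \<Longrightarrow> h \<in> carrier (free_algebra X) \<Longrightarrow> f + h \<in> carrier (free_algebra X)"
    for f h :: "'a fmon \<Rightarrow>\<^sub>0 'k"
    using keys_add[of f h] by (auto simp: carrier_free_algebra)
  show m: "f \<in> carrier (free_algebra X) \<Longrightarrow> - f \<in> carrier (free_algebra X)" for f :: "'a fmon \<Rightarrow>\<^sub>0 'k"
    by (simp add: carrier_free_algebra)
  show "f \<in> carrier (free_algebra X) \<Longrightarrow> h \<in> carrier (free_algebra X) \<Longrightarrow> f - h \<in> carrier (free_algebra X)"
    using a[of f "- h"] m[of h] by simp
  show "f \<in> carrier (free_algebra X) \<Longrightarrow> h \<in> carrier (free_algebra X) \<Longrightarrow> f * h \<in> carrier (free_algebra X)"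
    using keys_mult[of f h] by (fastforce simp: carrier_free_algebra)
  show "f \<in> carrier (free_algebra X) \<Longrightarrow> scl c f \<in> carrier (free_algebra X)"
    using keys_scl_subset[of c f] by (auto simp: carrier_free_algebra)
qed (auto simp: carrier_free_algebra const_def gen_def keys_one split: if_splits)

lemma ring_free_algebra: "ring (free_algebra X :: ('a fmon \<Rightarrow>\<^sub>0 'k::field) ring)"
proof (intro ringI abelian_groupI monoidI)
  fix f :: "'a fmon \<Rightarrow>\<^sub>0 'k" assume f: "f \<in> carrier (free_algebra X)"
  show "\<exists>h\<in>carrier (free_algebra X). h \<oplus>\<^bsub>free_algebra X\<^esub> f = \<zero>\<^bsub>free_algebra X\<^esub>"
    by (rule bexI[of _ "- f"]) (use f in \<open>auto simp: free_algebra_closed\<close>)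
qed (simp_all add: free_algebra_closed algebra_simps)

section \<open>The action of the free algebra and its annihilator\<close>

context based_superalgebra
begin

abbreviation FA :: "('a fmon \<Rightarrow>\<^sub>0 'k) ring" where
  "FA \<equiv> free_algebra (sspace g)"

abbreviation C :: "('a fmon \<Rightarrow>\<^sub>0 'k) set" where
  "C \<equiv> carrier FA"

abbreviation I :: "('a fmon \<Rightarrow>\<^sub>0 'k) set" where
  "I \<equiv> uea_ideal g"

sublocale FA: ring FA
  by (rule ring_free_algebra)

lemmas C_closed = free_algebra_closed[where X = "sspace g"]

lemma C_sum: "(\<And>a. a \<in> A \<Longrightarrow> f a \<in> C) \<Longrightarrow> sum f A \<in> C"
  by (induction A rule: infinite_finite_induct) (auto simp: C_closed)

lemma C_power: "f \<in> C \<Longrightarrow> f ^ k \<in> C"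
  by (induction k) (auto simp: C_closed)

definition eval :: "('a fmon \<Rightarrow>\<^sub>0 'k) \<Rightarrow> (nat list \<Rightarrow>\<^sub>0 'k) \<Rightarrow> (nat list \<Rightarrow>\<^sub>0 'k)" where
  "eval f p = lin (\<lambda>w. foldr op (letters w) p) f"

text \<open>The normal form: the image of the empty word under \<open>f\<close> will determine the
  class of \<open>f\<close> in \<open>U(g)\<close>.\<close>

definition val :: "('a fmon \<Rightarrow>\<^sub>0 'k) \<Rightarrow> (nat list \<Rightarrow>\<^sub>0 'k)" where
  "val f = eval f (single [] 1)"

lemma foldr_op_add: "foldr op xs (p + q) = foldr op xs p + foldr op xs q"
  by (induction xs) (auto simp: op_add)

lemma foldr_op_scl: "foldr op xs (scl c p) = scl c (foldr op xs p)"
  by (induction xs) (auto simp: op_scl)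

lemma foldr_op_zero [simp]: "foldr op xs 0 = 0"
  by (induction xs) auto

lemma foldr_op_sum: "foldr op xs (sum p A) = (\<Sum>a\<in>A. foldr op xs (p a))"
  by (induction A rule: infinite_finite_induct) (auto simp: foldr_op_add)

lemma eval_add: "eval (f + h) p = eval f p + eval h p"
  by (simp add: eval_def lin_add)

lemma eval_diff: "eval (f - h) p = eval f p - eval h p"
  by (simp add: eval_def lin_diff)

lemma eval_uminus: "eval (- f) p = - eval f p"
  by (simp add: eval_def lin_uminus)

lemma eval_zero [simp]: "eval 0 p = 0"
  by (simp add: eval_def)

lemma eval_scl: "eval (scl c f) p = scl c (eval f p)"
  by (simp add: eval_def lin_scl)

lemma eval_sum: "eval (sum f A) p = (\<Sum>a\<in>A. eval (f a) p)"
  by (simp add: eval_def lin_sum)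

lemma eval_single: "eval (single v c) p = scl c (foldr op (letters v) p)"
  by (simp add: eval_def)

lemma eval_add_right: "eval f (p + q) = eval f p + eval f q"
  by (simp add: eval_def foldr_op_add lin_fun_add)

lemma eval_scl_right: "eval f (scl c p) = scl c (eval f p)"
  by (simp add: eval_def foldr_op_scl lin_fun_scl)

lemma eval_zero_right [simp]: "eval f 0 = 0"
  by (simp add: eval_def)

lemma eval_sum_right: "eval f (sum p A) = (\<Sum>a\<in>A. eval f (p a))"
  by (induction A rule: infinite_finite_induct) (auto simp: eval_add_right)

lemma eval_lin: "eval f (lin h p) = lin (\<lambda>w. eval f (h w)) p"
  by (simp add: lin_def eval_sum_right eval_scl_right)

lemma eval_mult: "eval (f * h) p = eval f (eval h p)"
proof -
  have "f * h = (\<Sum>v\<in>keys f. \<Sum>w\<in>keys h.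
      single (v + w) (lookup f v * lookup h w))"
    by (subst (1 2) pm_sum_single[symmetric]) (simp only: sum_product mult_single)
  then have "eval (f * h) p = (\<Sum>v\<in>keys f. \<Sum>w\<in>keys h.
      scl (lookup f v * lookup h w)
        (foldr op (letters v) (foldr op (letters w) p)))"
    by (simp add: eval_sum eval_single)
  also have "\<dots> = eval f (eval h p)"
    by (simp add: eval_def lin_def foldr_op_sum foldr_op_scl pm.scale_sum_right)
  finally show ?thesis .
qed

lemma eval_gen [simp]: "eval (gen x) p = op x p"
  by (simp add: gen_def eval_single)

lemma eval_const [simp]: "eval (const c) p = scl c p"
  by (simp add: const_def eval_single)

lemma eval_one [simp]: "eval 1 p = p"
  using eval_const[of 1 p] by (simp add: const_def)

lemma NP_foldr_op: "p \<in> NP \<Longrightarrow> foldr op xs p \<in> NP"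
  by (induction xs) (auto intro: NP_op)

lemma NP_eval: "p \<in> NP \<Longrightarrow> eval f p \<in> NP"
  unfolding eval_def lin_def by (intro NP_sum NP_scl NP_foldr_op)

lemma NP_val: "val f \<in> NP"
  unfolding val_def by (rule NP_eval) simp

lemma val_mult: "val (f * h) = eval f (val h)"
  by (simp add: val_def eval_mult)

lemma val_add: "val (f + h) = val f + val h"
  by (simp add: val_def eval_add)

lemma val_diff: "val (f - h) = val f - val h"
  by (simp add: val_def eval_diff)

lemma val_scl: "val (scl c f) = scl c (val f)"
  by (simp add: val_def eval_scl)

lemma relations_carrier: "uea_relations g \<subseteq> C"
proof -
  have k: "koszul e d * (gen y * gen x) = scl (koszul e d) (gen y * gen x)"
    for e d and x y :: 'a
    by (auto simp: koszul_def)
  show ?thesis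
    unfolding uea_relations_def
    by (auto simp: const_mult k C_closed sspace_add sspace_smul bracket_sspace dest!: part_sspace)
qed

lemma ideal_I: "ideal I FA"
  unfolding uea_ideal_def by (rule FA.genideal_ideal[OF relations_carrier])

lemma relations_I: "uea_relations g \<subseteq> I"
  unfolding uea_ideal_def by (rule FA.genideal_self[OF relations_carrier])

lemma I_add: "f \<in> I \<Longrightarrow> h \<in> I \<Longrightarrow> f + h \<in> I"
  using additive_subgroup.a_closed[OF ideal.axioms(1)[OF ideal_I]] by simp

lemma I_zero [simp]: "0 \<in> I"
  using additive_subgroup.zero_closed[OF ideal.axioms(1)[OF ideal_I]] by simp

lemma I_mult_left: "f \<in> I \<Longrightarrow> h \<in> C \<Longrightarrow> h * f \<in> I"
  using ideal.I_l_closed[OF ideal_I] by simp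

lemma I_mult_right: "f \<in> I \<Longrightarrow> h \<in> C \<Longrightarrow> f * h \<in> I"
  using ideal.I_r_closed[OF ideal_I] by simp

lemma I_scl: "f \<in> I \<Longrightarrow> scl c f \<in> I"
  using I_mult_left[of f "const c"] by (simp add: C_closed const_mult)

lemma I_uminus: "f \<in> I \<Longrightarrow> - f \<in> I"
  using I_scl[of f "- 1"] by simp

lemma I_diff: "f \<in> I \<Longrightarrow> h \<in> I \<Longrightarrow> f - h \<in> I"
  using I_add[of f "- h"] I_uminus[of h] by simp

lemma FA_minus: "f \<in> C \<Longrightarrow> \<ominus>\<^bsub>FA\<^esub> f = - f"
  using FA.minus_equality[of "- f" f] by (simp add: C_closed)

lemma eval_relation: "f \<in> uea_relations g \<Longrightarrow> p \<in> NP \<Longrightarrow> eval f p = 0"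
proof -
  assume f: "f \<in> uea_relations g" and p: "p \<in> NP"
  have k: "koszul e d * (gen y * gen x) = scl (koszul e d) (gen y * gen x)"
    for e d and x y :: 'a
    by (auto simp: koszul_def)
  from f consider
      x y where "f = gen (x + y) - gen x - gen y" "x \<in> sspace g" "y \<in> sspace g"
    | c x where "f = gen (smul g c x) - const c * gen x" "x \<in> sspace g"
    | x y e d where "f = gen x * gen y - koszul e d * (gen y * gen x) - gen (bracket g x y)"
        "x \<in> part g e" "y \<in> part g d"
    unfolding uea_relations_def by blast
  then show ?thesis
  proof cases
    case 3
    then show ?thesis
      using op_commute[OF p 3(2,3)] by (simp add: k eval_diff eval_scl eval_mult)
  qed (simp_all add: eval_diff op_add_left op_smul_left eval_mult)
qed

text \<open>The elements that annihilate all of \<open>NP\<close> form a two-sided ideal containing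
  the relations; closure under right multiples uses that \<open>NP\<close> is stable under the
  action.\<close>

lemma eval_ideal:
  assumes "f \<in> I" "p \<in> NP"
  shows "eval f p = 0"
proof -
  let ?K = "{f \<in> C. \<forall>p\<in>NP. eval f p = 0}"
  have "ideal ?K FA"
  proof (rule idealI)
    show "subgroup ?K (add_monoid FA)"
    proof (rule subgroup.intro)
      fix f assume f: "f \<in> ?K"
      then have "inv\<^bsub>add_monoid FA\<^esub> f = - f"
        using FA_minus[of f] unfolding a_inv_def by blast
      then show "inv\<^bsub>add_monoid FA\<^esub> f \<in> ?K"
        using f by (simp only:) (simp add: C_closed eval_uminus)
    qed (auto simp: C_closed eval_add)
  qed (auto simp: C_closed eval_mult NP_eval FA.ring_axioms)
  moreover have "uea_relations g \<subseteq> ?K"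
    using relations_carrier eval_relation by auto
  ultimately have "I \<subseteq> ?K"
    unfolding uea_ideal_def by (rule FA.genideal_minimal)
  then show ?thesis using assms by auto
qed

text \<open>Congruence modulo the ideal, on representatives. Computations stay in the free algebra
  with its type class arithmetic; cosets appear when statements about \<open>uea g\<close> are
  made.\<close>

definition eqv :: "('a fmon \<Rightarrow>\<^sub>0 'k) \<Rightarrow> ('a fmon \<Rightarrow>\<^sub>0 'k) \<Rightarrow> bool" where
  "eqv f h \<longleftrightarrow> f - h \<in> I"

lemma eqv_refl [simp]: "eqv f f"
  by (simp add: eqv_def)

lemma eqv_sym: "eqv f h \<Longrightarrow> eqv h f"
  using I_uminus[of "f - h"] by (simp add: eqv_def)

lemma eqv_trans [trans]: "eqv f h \<Longrightarrow> eqv h k \<Longrightarrow> eqv f k"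
  using I_add[of "f - h" "h - k"] by (simp add: eqv_def)

lemma eqv_add: "eqv f h \<Longrightarrow> eqv f' h' \<Longrightarrow> eqv (f + f') (h + h')"
  using I_add[of "f - h" "f' - h'"] by (simp add: eqv_def algebra_simps)

lemma eqv_scl: "eqv f h \<Longrightarrow> eqv (scl c f) (scl c h)"
  using I_scl[of "f - h" c] by (simp add: eqv_def pm.scale_right_diff_distrib)

lemma eqv_sum: "(\<And>a. a \<in> A \<Longrightarrow> eqv (f a) (h a)) \<Longrightarrow> eqv (sum f A) (sum h A)"
  by (induction A rule: infinite_finite_induct) (auto intro: eqv_add)

lemma eqv_lin: "(\<And>w. w \<in> keys p \<Longrightarrow> eqv (f w) (h w)) \<Longrightarrow> eqv (lin f p) (lin h p)"
  unfolding lin_def by (intro eqv_sum eqv_scl)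

lemma eqv_mult_left: "eqv f h \<Longrightarrow> k \<in> C \<Longrightarrow> eqv (k * f) (k * h)"
  using I_mult_left[of "f - h" k] by (simp add: eqv_def right_diff_distrib)

lemma eqv_mult_right: "eqv f h \<Longrightarrow> k \<in> C \<Longrightarrow> eqv (f * k) (h * k)"
  using I_mult_right[of "f - h" k] by (simp add: eqv_def left_diff_distrib)

lemma eqv_gen_add: "x \<in> sspace g \<Longrightarrow> y \<in> sspace g \<Longrightarrow> eqv (gen (x + y)) (gen x + gen y)"
  using relations_I unfolding eqv_def uea_relations_def diff_diff_eq[symmetric] by blast

lemma eqv_gen_smul: "x \<in> sspace g \<Longrightarrow> eqv (gen (smul g c x)) (scl c (gen x))"
  using relations_I unfolding eqv_def uea_relations_def const_mult[symmetric] by blast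

lemma eqv_gen_swap:
  assumes "x \<in> part g e" "y \<in> part g d"
  shows "eqv (gen x * gen y) (scl (koszul e d) (gen y * gen x) + gen (bracket g x y))"
proof -
  have "gen x * gen y - koszul e d * (gen y * gen x) - gen (bracket g x y) \<in> I"
    using relations_I assms unfolding uea_relations_def by blast
  moreover have "koszul e d * (gen y * gen x) = scl (koszul e d :: 'k) (gen y * gen x)"
    by (auto simp: koszul_def)
  ultimately show ?thesis by (simp add: eqv_def diff_diff_eq)
qed

lemma eqv_gen_zero: "eqv (gen 0) 0"
  using eqv_gen_smul[of 0 0] sspace_zero by simp

lemma eqv_gen_sum:
  "(\<And>a. a \<in> A \<Longrightarrow> f a \<in> sspace g) \<Longrightarrow> eqv (gen (sum f A)) (\<Sum>a\<in>A. gen (f a))"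
proof (induction A rule: infinite_finite_induct)
  case (insert a A)
  have "eqv (gen (f a + sum f A)) (gen (f a) + gen (sum f A))"
    by (rule eqv_gen_add) (use insert in \<open>auto intro: sspace_sum\<close>)
  also have "eqv \<dots> (gen (f a) + (\<Sum>a\<in>A. gen (f a)))"
    by (rule eqv_add) (use insert in auto)
  finally show ?case using insert by simp
qed (auto simp: eqv_gen_zero)

lemma eqv_gen_coord:
  assumes "x \<in> sspace g"
  shows "eqv (gen x) (\<Sum>i<n. scl (coord x i) (gen (b i)))"
proof -
  have "eqv (gen (\<Sum>i<n. smul g (coord x i) (b i))) (\<Sum>i<n. gen (smul g (coord x i) (b i)))"
    by (rule eqv_gen_sum) (auto intro: sspace_smul b_sspace)
  also have "eqv \<dots> (\<Sum>i<n. scl (coord x i) (gen (b i)))"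
    by (rule eqv_sum, rule eqv_gen_smul) (auto intro: b_sspace)
  finally show ?thesis using coord_sum[OF assms] by simp
qed

section \<open>Normal forms: independence and spanning\<close>

definition mon :: "nat list \<Rightarrow> ('a fmon \<Rightarrow>\<^sub>0 'k)" where
  "mon w = single (FMon (map b w)) 1"

definition nf :: "(nat list \<Rightarrow>\<^sub>0 'k) \<Rightarrow> ('a fmon \<Rightarrow>\<^sub>0 'k)" where
  "nf p = lin mon p"

lemma mon_Cons: "mon (i # w) = gen (b i) * mon w"
  by (simp add: mon_def gen_def mult_single plus_fmon_def)

lemma mon_Nil: "mon [] = 1"
  by (simp add: mon_def zero_fmon_def[symmetric])

lemma mon_C: "(\<And>i. i \<in> set w \<Longrightarrow> i < n) \<Longrightarrow> mon w \<in> C"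
  by (auto simp: mon_def carrier_free_algebra intro: b_sspace)

lemma mon_normal_C: "normal w \<Longrightarrow> mon w \<in> C"
  by (rule mon_C) (auto simp: normal_def)

lemma nf_C: "p \<in> NP \<Longrightarrow> nf p \<in> C"
  unfolding nf_def lin_def by (intro C_sum C_closed mon_normal_C) (auto simp: NP_def)

lemma gen_b_C: "i < n \<Longrightarrow> gen (b i) \<in> C"
  by (intro C_closed b_sspace)

text \<open>In a normal word each letter acts by prepending itself, so the word is its own normal
  form. Together with \<open>eval_ideal\<close> this makes the normal words independent in
  \<open>U(g)\<close>.\<close>

lemma val_mon: "normal w \<Longrightarrow> val (mon w) = single w 1"
proof (induction w)
  case Nil
  then show ?case by (simp add: mon_Nil val_def)
next
  case (Cons i w)
  then have "val (mon w) = single w 1" "i < n" by (auto simp: normal_Cons)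
  then show ?case using act_normal[OF Cons.prems] by (simp add: mon_Cons val_mult rho_b)
qed

lemma val_nf: "p \<in> NP \<Longrightarrow> val (nf p) = p"
proof -
  assume p: "p \<in> NP"
  have "val (nf p) = lin (\<lambda>w. val (mon w)) p"
    by (simp add: nf_def val_def lin_def eval_sum eval_scl)
  also have "\<dots> = lin (\<lambda>w. single w 1) p"
    by (rule lin_cong) (use p in \<open>auto simp: val_mon NP_def\<close>)
  finally show ?thesis by simp
qed

lemma nf_rho:
  assumes "x \<in> sspace g" "normal t"
    and IH: "\<And>k. k < n \<Longrightarrow> eqv (gen (b k) * mon t) (nf (act k t))"
  shows "eqv (gen x * mon t) (nf (rho x t))"
proof -
  have "eqv (gen x * mon t) ((\<Sum>i<n. scl (coord x i) (gen (b i))) * mon t)"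
    using assms by (intro eqv_mult_right eqv_gen_coord mon_normal_C)
  also have "\<dots> = (\<Sum>i<n. scl (coord x i) (gen (b i) * mon t))"
    by (simp add: sum_distrib_right const_mult[symmetric] mult.assoc)
  also have "eqv \<dots> (\<Sum>i<n. scl (coord x i) (nf (act i t)))"
    by (intro eqv_sum eqv_scl IH) auto
  also have "\<dots> = nf (rho x t)"
    by (simp add: nf_def rho_def lin_sum lin_scl)
  finally show ?thesis .
qed

lemma const_commute: "f * scl c h = scl c (f * h :: 'a fmon \<Rightarrow>\<^sub>0 'k)"
proof -
  let ?s = "\<Sum>v\<in>keys f. single v (lookup f v)"
  have "?s * const c = const c * ?s"
    by (simp add: const_def sum_distrib_left sum_distrib_right mult_single mult.commute)
  then have c: "f * const c = const c * f"
    by (simp only: pm_sum_single)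
  have "f * scl c h = (f * const c) * h"
    by (simp only: const_mult[symmetric] mult.assoc)
  also have "\<dots> = scl c (f * h)"
    by (simp only: c mult.assoc) (simp only: const_mult)
  finally show ?thesis .
qed

lemma scl_mult_left: "scl c f * h = scl c (f * h :: 'a fmon \<Rightarrow>\<^sub>0 'k)"
  by (simp add: const_mult[symmetric] mult.assoc)

text \<open>Retraces the recursion of \<open>act\<close> with congruences, each clause being a
  consequence of the defining relations of \<open>U(g)\<close>. For a repeated odd letter these give
  a congruence for \<open>?m + ?m\<close>, whence the factor 1/2.\<close>

lemma nf_act: "i < n \<Longrightarrow> normal w \<Longrightarrow> eqv (gen (b i) * mon w) (nf (act i w))"
proof (induction w arbitrary: i rule: measure_induct_rule[of length])
  case (less w)
  show ?case
  proof (cases w)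
    case Nil
    then show ?thesis by (simp add: nf_def mon_Cons mon_Nil)
  next
    case (Cons j t)
    have j: "j < n" and t: "normal t" using less.prems Cons by (auto simp: normal_Cons)
    have IHt: "eqv (gen (b k) * mon t) (nf (act k t))" if "k < n" for k
      using less.IH[of t k] that t Cons by simp
    have bs: "bracket g (b i) (b j) \<in> sspace g"
      using less.prems j by (simp add: bracket_sspace b_sspace)
    have sw: "eqv (gen (b i) * (gen (b j) * mon t))
        (scl (koszul (par i) (par j)) (gen (b j) * (gen (b i) * mon t))
          + gen (bracket g (b i) (b j)) * mon t)"
      using eqv_mult_right[OF eqv_gen_swap[OF b_part b_part] mon_normal_C[OF t], OF less.prems(1) j]
      by (simp add: distrib_right scl_mult_left mult.assoc)
    show ?thesis
    proof (cases "before i j")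
      case True
      then have "normal (i # w)" using less.prems Cons by (simp add: normal_Cons_Cons)
      then show ?thesis by (simp add: act_normal nf_def mon_Cons)
    next
      case nb: False
      show ?thesis
      proof (cases "i = j")
        case True
        let ?m = "gen (b i) * (gen (b i) * mon t)"
        have "par i" using nb True by (simp add: before_def)
        then have "eqv ?m (- ?m + gen (bracket g (b i) (b i)) * mon t)"
          using sw True by simp
        then have "?m + ?m - gen (bracket g (b i) (b i)) * mon t \<in> I"
          by (simp add: eqv_def algebra_simps)
        then have "scl (1 / 2) (?m + ?m - gen (bracket g (b i) (b i)) * mon t) \<in> I"
          by (rule I_scl)
        moreover have "scl (1 / 2) (?m + ?m) = ?m"
          using pm_half_double[OF two, of ?m] by simp
        ultimately have "eqv ?m (scl (1 / 2) (gen (bracket g (b i) (b i)) * mon t))"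
          by (simp add: eqv_def pm.scale_right_diff_distrib)
        also have "eqv \<dots> (scl (1 / 2) (nf (rho (bracket g (b i) (b i)) t)))"
          using nf_rho[OF bs t IHt] True by (intro eqv_scl) simp
        also have "\<dots> = nf (act i w)"
          using nb True Cons by (simp add: act_square nf_def lin_scl)
        finally show ?thesis using Cons True by (simp add: mon_Cons)
      next
        case False
        then have ji: "j < i" using nb by (auto simp: before_def)
        let ?f = "\<lambda>w. if length w \<le> length t then act j w else single (j # w) 1"
        have "eqv (gen (b j) * (gen (b i) * mon t)) (gen (b j) * nf (act i t))"
          by (intro eqv_mult_left IHt less.prems gen_b_C j)
        also have "\<dots> = lin (\<lambda>v. gen (b j) * mon v) (act i t)"
          by (simp add: nf_def lin_def sum_distrib_left const_commute)
        also have "eqv \<dots> (lin (\<lambda>v. nf (?f v)) (act i t))"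
        proof (rule eqv_lin)
          fix v assume v: "v \<in> keys (act i t)"
          show "eqv (gen (b j) * mon v) (nf (?f v))"
            using less.IH[of v j] reach_lt[OF less.prems(1) t v] j Cons
            by (auto simp: nf_def mon_Cons)
        qed
        also have "\<dots> = nf (lin ?f (act i t))"
          by (simp add: nf_def lin_lin)
        finally have "eqv (scl (koszul (par i) (par j)) (gen (b j) * (gen (b i) * mon t))
            + gen (bracket g (b i) (b j)) * mon t)
          (scl (koszul (par i) (par j)) (nf (lin ?f (act i t))) + nf (rho (bracket g (b i) (b j)) t))"
          by (intro eqv_add eqv_scl nf_rho bs t IHt)
        then have "eqv (gen (b i) * (gen (b j) * mon t)) (nf (act i w))"
          using eqv_trans[OF sw] unfolding Cons act_swap[OF ji] nf_def by (simp add: lin_add lin_scl)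
        then show ?thesis using Cons by (simp add: mon_Cons)
      qed
    qed
  qed
qed

lemma eqv_nf: "f \<in> C \<Longrightarrow> eqv f (nf (val f))"
proof -
  assume f: "f \<in> C"
  have W: "eqv (single (FMon xs) 1)
      (nf (foldr op xs (single [] 1)))" if "set xs \<subseteq> sspace g" for xs
    using that
  proof (induction xs)
    case Nil
    then show ?case by (simp add: nf_def mon_def)
  next
    case (Cons x xs)
    let ?p = "foldr op xs (single [] 1)"
    have p: "?p \<in> NP" by (rule NP_foldr_op) simp
    have x: "x \<in> sspace g" using Cons by simp
    have "single (FMon (x # xs)) 1 = gen x * single (FMon xs) 1"
      by (simp add: gen_def mult_single plus_fmon_def)
    also have "eqv \<dots> (gen x * nf ?p)"
      using Cons by (intro eqv_mult_left C_closed) auto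
    also have "\<dots> = lin (\<lambda>v. gen x * mon v) ?p"
      by (simp add: nf_def lin_def sum_distrib_left const_commute)
    also have "eqv \<dots> (lin (\<lambda>v. nf (rho x v)) ?p)"
      by (rule eqv_lin) (use p in \<open>auto intro!: nf_rho nf_act x simp: NP_def\<close>)
    also have "\<dots> = nf (foldr op (x # xs) (single [] 1))"
      by (simp add: nf_def op_def lin_lin)
    finally show ?case .
  qed
  have "eqv (lin (\<lambda>w. single w 1) f)
      (lin (\<lambda>w. nf (foldr op (letters w) (single [] 1))) f)"
  proof (rule eqv_lin)
    fix w assume "w \<in> keys f"
    then have "set (letters w) \<subseteq> sspace g" using f by (auto simp: carrier_free_algebra)
    from W[OF this] show "eqv (single w 1)
        (nf (foldr op (letters w) (single [] 1)))" by simp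
  qed
  also have "lin (\<lambda>w. nf (foldr op (letters w) (single [] 1))) f = nf (val f)"
    by (simp add: val_def eval_def nf_def lin_lin)
  finally show ?thesis by simp
qed

text \<open>The Poincare-Birkhoff-Witt theorem in usable form: an identity in \<open>U(g)\<close>
  may be checked on normal forms.\<close>

theorem mem_ideal_iff: "f \<in> C \<Longrightarrow> f \<in> I \<longleftrightarrow> val f = 0"
proof
  assume "f \<in> I"
  then show "val f = 0" unfolding val_def by (rule eval_ideal) simp
next
  assume "f \<in> C" "val f = 0"
  then show "f \<in> I" using eqv_nf[of f] by (simp add: eqv_def nf_def)
qed

lemma eqv_iff: "f \<in> C \<Longrightarrow> h \<in> C \<Longrightarrow> eqv f h \<longleftrightarrow> val f = val h"
  using mem_ideal_iff[of "f - h"] by (simp add: eqv_def C_closed val_diff)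

lemma eval_cong: "f \<in> C \<Longrightarrow> h \<in> C \<Longrightarrow> val f = val h \<Longrightarrow> p \<in> NP \<Longrightarrow> eval f p = eval h p"
  using eval_ideal[of "f - h" p] eqv_iff[of f h] by (simp add: eqv_def eval_diff)

end

section \<open>Hilbert's basis theorem for commuting operators\<close>

locale operator_space = vector_space scale
  for scale :: "'a::field \<Rightarrow> 'b::ab_group_add \<Rightarrow> 'b"
begin

text \<open>The operators play the part of the variables of a polynomial ring and the stable
  subspaces that of the submodules, so the basis theorem is proved without forming
  polynomials.\<close>

definition stable :: "('b \<Rightarrow> 'b) set \<Rightarrow> 'b set \<Rightarrow> bool" where
  "stable Ts M \<longleftrightarrow> local.subspace M \<and> (\<forall>T\<in>Ts. T ` M \<subseteq> M)"

lemma stable_app: "stable Ts M \<Longrightarrow> T \<in> Ts \<Longrightarrow> x \<in> M \<Longrightarrow> T x \<in> M"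
  by (auto simp: stable_def)

text \<open>Finite generation is expressed by minimality among the stable subspaces containing
  \<open>S\<close>, which avoids linear combinations with polynomial coefficients.\<close>

definition noetherian :: "('b \<Rightarrow> 'b) set \<Rightarrow> 'b set \<Rightarrow> bool" where
  "noetherian Ts E \<longleftrightarrow> (\<forall>M. stable Ts M \<and> M \<subseteq> E \<longrightarrow>
     (\<exists>S. finite S \<and> S \<subseteq> M \<and> (\<forall>N. stable Ts N \<and> S \<subseteq> N \<longrightarrow> M \<subseteq> N)))"

definition endo :: "('b \<Rightarrow> 'b) \<Rightarrow> bool" where
  "endo T \<longleftrightarrow> (\<forall>x y. T (x + y) = T x + T y) \<and> (\<forall>c x. T (scale c x) = scale c (T x))"

lemma endo_add: "endo T \<Longrightarrow> T (x + y) = T x + T y"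
  by (simp add: endo_def)

lemma endo_scale: "endo T \<Longrightarrow> T (scale c x) = scale c (T x)"
  by (simp add: endo_def)

lemma endo_zero: "endo T \<Longrightarrow> T 0 = 0"
  using endo_scale[of T 0 0] by simp

lemma endo_funpow: "endo T \<Longrightarrow> endo (T ^^ k)"
  by (induction k) (auto simp: endo_def)

lemma noetherian_span:
  assumes "finite B"
  shows "noetherian {} (local.span B)"
  unfolding noetherian_def
proof (intro allI impI)
  fix M assume M: "stable {} M \<and> M \<subseteq> local.span B"
  obtain S where S: "S \<subseteq> M" "local.independent S" "M \<subseteq> local.span S"
    by (rule maximal_independent_subset[of M])
  have "S \<subseteq> local.span B" using subset_trans[OF S(1) conjunct2[OF M]] .
  then have "finite S"
    using independent_span_bound[OF assms S(2)] by simp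
  moreover have "M \<subseteq> N" if "stable {} N" "S \<subseteq> N" for N
  proof -
    have "local.span S \<subseteq> N"
      using that by (intro span_minimal) (simp_all add: stable_def)
    with S(3) show ?thesis by (rule subset_trans)
  qed
  ultimately show "\<exists>S. finite S \<and> S \<subseteq> M \<and> (\<forall>N. stable {} N \<and> S \<subseteq> N \<longrightarrow> M \<subseteq> N)"
    using S(1) by (intro exI[of _ S]) simp
qed

text \<open>The sums \<open>e_0 + T e_1 + ... + T^(k-1) e_(k-1)\<close> with all \<open>e_i\<close>
  in \<open>E\<close>: the index is the number of coefficients, one more than the degree.\<close>

primrec layer :: "('b \<Rightarrow> 'b) \<Rightarrow> 'b set \<Rightarrow> nat \<Rightarrow> 'b set" where
  "layer T E 0 = {0}"
| "layer T E (Suc k) = {(T ^^ k) e + v | e v. e \<in> E \<and> v \<in> layer T E k}"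

lemma subspace_layer:
  assumes T: "endo T" and E: "local.subspace E"
  shows "local.subspace (layer T E k)"
proof (induction k)
  case 0
  then show ?case by (simp add: subspace_single_0)
next
  case (Suc k)
  note F = endo_funpow[OF T, of k]
  show ?case
  proof (rule subspaceI)
    show "0 \<in> layer T E (Suc k)"
      using subspace_0[OF E] subspace_0[OF Suc] endo_zero[OF F] by force
  next
    fix x y assume "x \<in> layer T E (Suc k)" "y \<in> layer T E (Suc k)"
    then obtain e v e' v' where "x = (T ^^ k) e + v" "y = (T ^^ k) e' + v'"
        and m: "e \<in> E" "v \<in> layer T E k" "e' \<in> E" "v' \<in> layer T E k" by auto
    then have "x + y = (T ^^ k) (e + e') + (v + v')" by (simp add: endo_add[OF F])
    then show "x + y \<in> layer T E (Suc k)"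
      using subspace_add[OF E m(1,3)] subspace_add[OF Suc m(2,4)] by auto
  next
    fix c x assume "x \<in> layer T E (Suc k)"
    then obtain e v where "x = (T ^^ k) e + v" and m: "e \<in> E" "v \<in> layer T E k" by auto
    then have "scale c x = (T ^^ k) (scale c e) + scale c v"
      by (simp add: endo_scale[OF F] scale_right_distrib)
    then show "scale c x \<in> layer T E (Suc k)"
      using subspace_scale[OF E m(1)] subspace_scale[OF Suc m(2)] by auto
  qed
qed

lemma layer_Suc_mono:
  assumes "endo T" "local.subspace E"
  shows "layer T E k \<subseteq> layer T E (Suc k)"
proof
  fix v assume "v \<in> layer T E k"
  then have "(T ^^ k) 0 + v \<in> layer T E (Suc k)"
    using subspace_0[OF assms(2)] unfolding layer.simps by blast
  then show "v \<in> layer T E (Suc k)"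
    using endo_zero[OF endo_funpow[OF assms(1)]] by simp
qed

lemma layer_mono:
  assumes "endo T" "local.subspace E" "k \<le> l"
  shows "layer T E k \<subseteq> layer T E l"
  using lift_Suc_mono_le[of "layer T E", OF layer_Suc_mono[OF assms(1,2)] assms(3)] .

lemma layer_shift:
  assumes T: "endo T" and E: "local.subspace E" and v: "v \<in> layer T E k"
  shows "T v \<in> layer T E (Suc k)"
  using v
proof (induction k arbitrary: v)
  case 0
  then show ?case using endo_zero[OF T] subspace_0[OF E] by auto
next
  case (Suc k)
  then obtain e w where "v = (T ^^ k) e + w" "e \<in> E" "w \<in> layer T E k" by auto
  then show ?case using Suc.IH[of w] by (auto simp: endo_add[OF T])
qed

lemma layer_shifts:
  assumes "endo T" "local.subspace E" "v \<in> layer T E k"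
  shows "(T ^^ l) v \<in> layer T E (k + l)"
  using assms(3) by (induction l) (use layer_shift[OF assms(1,2)] in auto)

text \<open>The analogue of the polynomials in \<open>T\<close> with coefficients in
  \<open>E\<close>; an element may have several such expressions.\<close>

definition ext :: "('b \<Rightarrow> 'b) \<Rightarrow> 'b set \<Rightarrow> 'b set" where
  "ext T E = (\<Union>k. layer T E k)"

text \<open>\<open>W\<close> is a stable ambient space on which the operators commute; in the
  application it is the span of the normal words.\<close>

lemma ext_properties:
  assumes T: "endo T" and E: "stable Ts E" and W: "E \<subseteq> W" "stable (insert T Ts) W"
    and Ts: "\<And>T'. T' \<in> Ts \<Longrightarrow> endo T'"
    and comm: "\<And>T' x. T' \<in> Ts \<Longrightarrow> x \<in> W \<Longrightarrow> T' (T x) = T (T' x)"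
  shows "stable Ts (layer T E k)" "stable (insert T Ts) (ext T E)" "E \<subseteq> ext T E" "ext T E \<subseteq> W"
proof -
  have sE: "local.subspace E" and sW: "local.subspace W" using E W by (auto simp: stable_def)
  have W_pow: "(T ^^ k) x \<in> W" if "x \<in> W" for x k
    using that W(2) by (induction k) (auto simp: stable_def)
  have comm_pow: "T' ((T ^^ k) x) = (T ^^ k) (T' x)" if "T' \<in> Ts" "x \<in> W" for T' x k
    using that by (induction k) (auto simp: comm W_pow)
  show st: "stable Ts (layer T E k)" for k
    unfolding stable_def
  proof (intro conjI ballI)
    fix T' assume T': "T' \<in> Ts"
    show "T' ` layer T E k \<subseteq> layer T E k"
    proof (induction k)
      case 0
      then show ?case using endo_zero[OF Ts[OF T']] by simp
    next
      case (Suc k)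
      have "T' ((T ^^ k) e + v) \<in> layer T E (Suc k)" if "e \<in> E" "v \<in> layer T E k" for e v
      proof -
        have "T' ((T ^^ k) e + v) = (T ^^ k) (T' e) + T' v"
          using that W(1) comm_pow[OF T'] by (auto simp: endo_add[OF Ts[OF T']])
        moreover have "T' e \<in> E" using E T' that by (auto simp: stable_def)
        ultimately show ?thesis using Suc that by auto
      qed
      then show ?case by auto
    qed
  qed (rule subspace_layer[OF T sE])
  have chain: "\<exists>k. x \<in> layer T E k \<and> y \<in> layer T E k"
    if "x \<in> ext T E" "y \<in> ext T E" for x y
  proof -
    from that obtain k l where "x \<in> layer T E k" "y \<in> layer T E l" by (auto simp: ext_def)
    then show ?thesis
      using layer_mono[OF T sE, of k "max k l"] layer_mono[OF T sE, of l "max k l"]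
      by (auto intro!: exI[of _ "max k l"])
  qed
  have "local.subspace (ext T E)"
  proof (rule subspaceI)
    show "0 \<in> ext T E" unfolding ext_def by (rule UN_I[of 0]) auto
  next
    fix x y assume "x \<in> ext T E" "y \<in> ext T E"
    then obtain k where "x \<in> layer T E k" "y \<in> layer T E k" using chain by blast
    then have "x + y \<in> layer T E k" using subspace_add[OF subspace_layer[OF T sE]] by blast
    then show "x + y \<in> ext T E" unfolding ext_def by blast
  next
    fix c x assume "x \<in> ext T E"
    then show "scale c x \<in> ext T E"
      unfolding ext_def using subspace_scale[OF subspace_layer[OF T sE]] by blast
  qed
  then show "stable (insert T Ts) (ext T E)"
    using st layer_shift[OF T sE] unfolding stable_def ext_def by blast
  show "E \<subseteq> ext T E"
  proof
    fix e assume "e \<in> E"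
    then have "e \<in> layer T E (Suc 0)" by auto
    then show "e \<in> ext T E" unfolding ext_def by blast
  qed
  have "layer T E k \<subseteq> W" for k
  proof (induction k)
    case 0
    then show ?case using subspace_0[OF sW] by simp
  next
    case (Suc k)
    have "(T ^^ k) e + v \<in> W" if "e \<in> E" "v \<in> layer T E k" for e v
      using that Suc W(1) by (intro subspace_add[OF sW] W_pow) auto
    then show ?case by auto
  qed
  then show "ext T E \<subseteq> W" by (auto simp: ext_def)
qed

text \<open>Hilbert's argument: the leading coefficients of the elements of degree at most \<open>k\<close> form a
  stable subspace \<open>L k\<close> of \<open>E\<close>, and this ascending chain becomes stationary.\<close>

lemma noetherian_ext:
  assumes T: "endo T" and E: "stable Ts E" "noetherian Ts E"
    and W: "E \<subseteq> W" "stable (insert T Ts) W"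
    and Ts: "\<And>T'. T' \<in> Ts \<Longrightarrow> endo T'"
    and comm: "\<And>T' x. T' \<in> Ts \<Longrightarrow> x \<in> W \<Longrightarrow> T' (T x) = T (T' x)"
  shows "noetherian (insert T Ts) (ext T E)"
  unfolding noetherian_def
proof (intro allI impI, elim conjE)
  fix M assume M: "stable (insert T Ts) M" "M \<subseteq> ext T E"
  note props = ext_properties[OF T E(1) W Ts comm]
  have sE: "local.subspace E" and sM: "local.subspace M" using E M by (auto simp: stable_def)
  note sl = subspace_layer[OF T sE]
  have W_pow: "(T ^^ k) x \<in> W" if "x \<in> W" for x k
    using that W(2) by (induction k) (auto simp: stable_def)
  have comm_pow: "T' ((T ^^ k) x) = (T ^^ k) (T' x)" if "T' \<in> Ts" "x \<in> W" for T' x k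
    using that by (induction k) (auto simp: comm W_pow)
  \<comment> \<open>The parameter \<open>X\<close> is \<open>M\<close> for the chain itself and
    later \<open>N \<inter> M\<close>, whose leading coefficients are compared with those of
    \<open>M\<close>.\<close>
  define L where "L X k = {e \<in> E. \<exists>v\<in>layer T E k. (T ^^ k) e + v \<in> X}" for X k
  have L_stable: "stable Ts (L X k)" if X: "stable Ts X" for X k
  proof -
    note F = endo_funpow[OF T, of k]
    have sX: "local.subspace X" using X by (simp add: stable_def)
    have "local.subspace (L X k)"
    proof (rule subspaceI)
      show "0 \<in> L X k"
        using subspace_0[OF sE] subspace_0[OF sl] subspace_0[OF sX] endo_zero[OF F]
        by (auto simp: L_def intro!: bexI[of _ 0])
    next
      fix x y assume "x \<in> L X k" "y \<in> L X k"
      then obtain v w where m: "x \<in> E" "y \<in> E" "v \<in> layer T E k" "w \<in> layer T E k"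
          "(T ^^ k) x + v \<in> X" "(T ^^ k) y + w \<in> X" by (auto simp: L_def)
      have e: "(T ^^ k) (x + y) + (v + w) = ((T ^^ k) x + v) + ((T ^^ k) y + w)"
        by (simp add: endo_add[OF F])
      have "(T ^^ k) (x + y) + (v + w) \<in> X"
        unfolding e by (rule subspace_add[OF sX m(5,6)])
      then show "x + y \<in> L X k"
        unfolding L_def using subspace_add[OF sl m(3,4)] subspace_add[OF sE m(1,2)] by blast
    next
      fix c x assume "x \<in> L X k"
      then obtain v where m: "x \<in> E" "v \<in> layer T E k" "(T ^^ k) x + v \<in> X" by (auto simp: L_def)
      have "(T ^^ k) (scale c x) + scale c v = scale c ((T ^^ k) x + v)"
        by (simp add: endo_scale[OF F] scale_right_distrib)
      then have "(T ^^ k) (scale c x) + scale c v \<in> X"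
        using subspace_scale[OF sX m(3)] by simp
      then show "scale c x \<in> L X k"
        unfolding L_def using subspace_scale[OF sl m(2)] subspace_scale[OF sE m(1)] by blast
    qed
    moreover have "T' x \<in> L X k" if T': "T' \<in> Ts" and x: "x \<in> L X k" for T' x
    proof -
      obtain v where m: "x \<in> E" "v \<in> layer T E k" "(T ^^ k) x + v \<in> X"
        using x by (auto simp: L_def)
      have "(T ^^ k) (T' x) + T' v = T' ((T ^^ k) x + v)"
        using m(1) W(1) comm_pow[OF T', of x k] by (auto simp: endo_add[OF Ts[OF T']])
      moreover have "T' ((T ^^ k) x + v) \<in> X" "T' x \<in> E" "T' v \<in> layer T E k"
        using stable_app[OF X T' m(3)] stable_app[OF E(1) T' m(1)] stable_app[OF props(1) T' m(2)]
        by simp_all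
      ultimately show ?thesis by (auto simp: L_def intro!: bexI[of _ "T' v"])
    qed
    ultimately show ?thesis by (auto simp: stable_def)
  qed
  have M_T: "(T ^^ l) x \<in> M" if "x \<in> M" for x l
    using that M(1) by (induction l) (auto simp: stable_def)
  have M_Ts: "stable Ts M" using M(1) by (auto simp: stable_def)
  have L_Suc: "L M k \<subseteq> L M (Suc k)" for k
  proof
    fix e assume "e \<in> L M k"
    then obtain v where m: "e \<in> E" "v \<in> layer T E k" "(T ^^ k) e + v \<in> M" by (auto simp: L_def)
    have "(T ^^ Suc k) e + T v = T ((T ^^ k) e + v)" by (simp add: endo_add[OF T])
    then have "(T ^^ Suc k) e + T v \<in> M" using M_T[OF m(3), of 1] by simp
    then show "e \<in> L M (Suc k)"
      unfolding L_def using m(1) layer_shift[OF T sE m(2)] by blast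
  qed
  have L_mono: "k \<le> l \<Longrightarrow> L M k \<subseteq> L M l" for k l
    using lift_Suc_mono_le[of "L M", OF L_Suc] by blast
  let ?U = "\<Union>k. L M k"
  have "subspace ?U"
  proof (rule subspaceI)
    have "0 \<in> L M 0" using L_stable[OF M_Ts] unfolding stable_def by (intro subspace_0) simp
    then show "0 \<in> ?U" by blast
  next
    fix x y assume "x \<in> ?U" "y \<in> ?U"
    then obtain k l where "x \<in> L M k" "y \<in> L M l" by blast
    then have "x \<in> L M (max k l)" "y \<in> L M (max k l)"
      using L_mono[of k "max k l"] L_mono[of l "max k l"] by auto
    then have "x + y \<in> L M (max k l)"
      using L_stable[OF M_Ts] unfolding stable_def by (intro subspace_add) simp_all
    then show "x + y \<in> ?U" by blast
  next
    fix c x assume "x \<in> ?U"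
    then obtain k where "x \<in> L M k" by blast
    then have "scale c x \<in> L M k"
      using L_stable[OF M_Ts] unfolding stable_def by (intro subspace_scale) simp_all
    then show "scale c x \<in> ?U" by blast
  qed
  then have U: "stable Ts ?U" "?U \<subseteq> E"
    using stable_app[OF L_stable[OF M_Ts]] unfolding stable_def by (blast, auto simp: L_def)
  then obtain S where S: "finite S" "S \<subseteq> ?U" "\<And>N. stable Ts N \<Longrightarrow> S \<subseteq> N \<Longrightarrow> ?U \<subseteq> N"
    using E(2) unfolding noetherian_def by metis
  have "\<exists>m. S \<subseteq> L M m"
    using S(1,2)
  proof (induction S)
    case (insert s S)
    then obtain m k where "S \<subseteq> L M m" "s \<in> L M k" by auto
    then show ?case
      using L_mono[of m "max m k"] L_mono[of k "max m k"] by (auto intro!: exI[of _ "max m k"])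
  qed auto
  then obtain m where m: "S \<subseteq> L M m" by blast
  then have stat: "L M k \<subseteq> L M m" for k
    using S(3)[OF L_stable[OF M_Ts]] by blast
  have "\<exists>S. finite S \<and> S \<subseteq> L M k \<and> (\<forall>N. stable Ts N \<and> S \<subseteq> N \<longrightarrow> L M k \<subseteq> N)" for k
    using E(2) L_stable[OF M_Ts, of k] unfolding noetherian_def by (auto simp: L_def)
  then obtain G where G: "\<And>k. finite (G k)" "\<And>k. G k \<subseteq> L M k"
      "\<And>k N. stable Ts N \<Longrightarrow> G k \<subseteq> N \<Longrightarrow> L M k \<subseteq> N"
    by metis
  have "\<forall>k. \<forall>e\<in>G k. \<exists>v\<in>layer T E k. (T ^^ k) e + v \<in> M"
    using G(2) unfolding L_def by blast
  then obtain h where h: "\<And>k e. e \<in> G k \<Longrightarrow> h k e \<in> layer T E k"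
      "\<And>k e. e \<in> G k \<Longrightarrow> (T ^^ k) e + h k e \<in> M"
    by metis
  \<comment> \<open>In each degree up to the stationary index, generators of the leading
    coefficients are lifted to \<open>M\<close>.\<close>
  define R where "R = (\<Union>k\<le>m. (\<lambda>e. (T ^^ k) e + h k e) ` G k)"
  have "finite R" "R \<subseteq> M" using G(1) h(2) by (auto simp: R_def)
  moreover have "M \<subseteq> N" if N: "stable (insert T Ts) N" and RN: "R \<subseteq> N" for N
  proof -
    \<comment> \<open>Taking the lifts in \<open>N \<inter> M\<close> keeps the remainder of the
      division below in \<open>M\<close>, where the induction on the degree needs it.\<close>
    have NM: "stable (insert T Ts) (N \<inter> M)"
      using subspace_inter[of N M] stable_app[OF N] stable_app[OF M(1)] N M(1)
      unfolding stable_def by blast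
    then have NM_Ts: "stable Ts (N \<inter> M)" by (auto simp: stable_def)
    have sN: "local.subspace N" using N by (simp add: stable_def)
    have NM_T: "(T ^^ l) x \<in> N \<inter> M" if "x \<in> N \<inter> M" for x l
      using that NM by (induction l) (auto simp: stable_def)
    have low: "L M k \<subseteq> L (N \<inter> M) k" if k: "k \<le> m" for k
    proof (rule G(3)[OF L_stable[OF NM_Ts]])
      show "G k \<subseteq> L (N \<inter> M) k"
      proof
        fix e assume e: "e \<in> G k"
        have "(T ^^ k) e + h k e \<in> R" unfolding R_def using e k by blast
        moreover have "e \<in> E" using G(2) e by (auto simp: L_def)
        ultimately show "e \<in> L (N \<inter> M) k"
          using h[OF e] RN unfolding L_def by blast
      qed
    qed
    have "x \<in> N" if "x \<in> M" "x \<in> layer T E k" for x k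
      using that
    proof (induction k arbitrary: x)
      case 0
      then show ?case using N subspace_0 by (auto simp: stable_def)
    next
      case (Suc k)
      then obtain e v where x: "x = (T ^^ k) e + v" and e: "e \<in> E" and v: "v \<in> layer T E k" by auto
      \<comment> \<open>Above degree \<open>m\<close> there are no new leading coefficients: a lift
        in degree \<open>m\<close> is shifted by a power of \<open>T\<close>. Subtracting it from
        \<open>x\<close> lowers the degree.\<close>
      let ?k = "min k m"
      have "e \<in> L M k" using Suc.prems x e v by (auto simp: L_def)
      then have "e \<in> L M ?k" using stat by (auto simp: min_def)
      then have "e \<in> L (N \<inter> M) ?k" using low[of ?k] by auto
      then obtain w where w: "w \<in> layer T E ?k" "(T ^^ ?k) e + w \<in> N \<inter> M" by (auto simp: L_def)
      let ?l = "k - ?k"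
      have kl: "?l + ?k = k" by simp
      have "(T ^^ ?l) ((T ^^ ?k) e) = (T ^^ k) e"
        using funpow_add[of ?l ?k T] kl by (metis comp_apply)
      then have "(T ^^ ?l) ((T ^^ ?k) e + w) = (T ^^ k) e + (T ^^ ?l) w"
        by (simp add: endo_add[OF endo_funpow[OF T]])
      then have y: "(T ^^ k) e + (T ^^ ?l) w \<in> N \<inter> M" using NM_T[OF w(2), of ?l] by simp
      have "(T ^^ ?l) w \<in> layer T E k"
        using layer_shifts[OF T sE w(1), of ?l] kl by (simp add: add.commute)
      then have vl: "v - (T ^^ ?l) w \<in> layer T E k" using subspace_diff[OF sl v] by blast
      have d: "v - (T ^^ ?l) w = x - ((T ^^ k) e + (T ^^ ?l) w)" by (simp add: x)
      have "v - (T ^^ ?l) w \<in> M"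
        unfolding d using y by (intro subspace_diff[OF sM Suc.prems(1)]) simp
      then have "v - (T ^^ ?l) w \<in> N" by (rule Suc.IH[OF _ vl])
      then have "(v - (T ^^ ?l) w) + ((T ^^ k) e + (T ^^ ?l) w) \<in> N"
        using y by (intro subspace_add[OF sN, of "v - (T ^^ ?l) w"]) simp_all
      then show ?case by (simp add: x algebra_simps)
    qed
    then show ?thesis using M(2) by (auto simp: ext_def)
  qed
  ultimately show "\<exists>S. finite S \<and> S \<subseteq> M \<and> (\<forall>N. stable (insert T Ts) N \<and> S \<subseteq> N \<longrightarrow> M \<subseteq> N)"
    by blast
qed

text \<open>The operators are adjoined one at a time, starting from the span of \<open>B\<close>.
  The space built at each stage stays inside \<open>W\<close>; the last one is stable under all
  operators and contains \<open>B\<close>, hence equals \<open>W\<close>.\<close>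

theorem noetherian_operators:
  assumes "finite Ts" and B: "finite B" "B \<subseteq> W" and W: "stable Ts W"
    and Ts: "\<And>T. T \<in> Ts \<Longrightarrow> endo T"
    and comm: "\<And>T T' x. T \<in> Ts \<Longrightarrow> T' \<in> Ts \<Longrightarrow> x \<in> W \<Longrightarrow> T (T' x) = T' (T x)"
    and gen: "\<And>V. stable Ts V \<Longrightarrow> B \<subseteq> V \<Longrightarrow> W \<subseteq> V"
  shows "noetherian Ts W"
proof -
  have "\<exists>V. stable T' V \<and> noetherian T' V \<and> B \<subseteq> V \<and> V \<subseteq> W" if "T' \<subseteq> Ts" for T'
    using finite_subset[OF that assms(1)] that
  proof (induction T')
    case empty
    have "stable {} (local.span B)" "local.span B \<subseteq> W"
      using W span_minimal[OF B(2)] by (auto simp: stable_def)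
    then show ?case using noetherian_span[OF B(1)] span_superset[of B]
      by (intro exI[of _ "local.span B"]) simp
  next
    case (insert T T')
    then obtain V where V: "stable T' V" "noetherian T' V" "B \<subseteq> V" "V \<subseteq> W" by auto
    have W': "stable (insert T T') W" using W insert.prems by (auto simp: stable_def)
    have T: "endo T" and T': "\<And>S. S \<in> T' \<Longrightarrow> endo S"
        and c: "\<And>S x. S \<in> T' \<Longrightarrow> x \<in> W \<Longrightarrow> S (T x) = T (S x)"
      using Ts comm insert.prems by auto
    show ?case
      using ext_properties[OF T V(1) V(4) W' T' c] noetherian_ext[OF T V(1,2,4) W' T' c] V(3)
      by blast
  qed
  from this[OF subset_refl] obtain V where V: "stable Ts V" "noetherian Ts V" "B \<subseteq> V" "V \<subseteq> W"
    by blast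
  then show ?thesis using gen[OF V(1,3)] by (simp add: subset_antisym)
qed

end

section \<open>Leading terms of supercentral elements\<close>

lemma insort_append_last:
  fixes w :: "nat list"
  assumes "sorted w" "\<And>j. j \<in> set w \<Longrightarrow> j \<le> e"
  shows "insort e w = w @ [e]"
proof -
  have "sort (w @ [e]) = insort e w"
    by (rule properties_for_sort) (use assms(1) in \<open>auto simp: sorted_insort\<close>)
  moreover have "sort (w @ [e]) = w @ [e]"
    by (rule sorted_sort_id) (use assms in \<open>auto simp: sorted_append\<close>)
  ultimately show ?thesis by simp
qed

lemma mset_foldr_insort: "mset (foldr insort w v) = mset w + mset v"
  by (induction w) auto

section \<open>The weight filtration and products with an even leading term\<close>

context based_superalgebra
begin

text \<open>The error terms. The inequality is strict, so that adding elements of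
  \<open>low m\<close> does not change coefficients at words of weight \<open>m\<close> or
  more.\<close>

definition low :: "nat \<Rightarrow> (nat list \<Rightarrow>\<^sub>0 'k) set" where
  "low m = {p \<in> NP. \<forall>w\<in>keys p. weight w < m}"

lemma low_zero [simp]: "0 \<in> low m"
  by (simp add: low_def)

lemma low_add: "p \<in> low m \<Longrightarrow> q \<in> low m \<Longrightarrow> p + q \<in> low m"
  using keys_add[of p q] by (auto simp: low_def NP_add)

lemma low_scl: "p \<in> low m \<Longrightarrow> scl c p \<in> low m"
  using keys_scl_subset[of c p] by (auto simp: low_def NP_scl)

lemma low_uminus: "p \<in> low m \<Longrightarrow> - p \<in> low m"
  using low_scl[of p m "- 1"] by simp

lemma low_diff: "p \<in> low m \<Longrightarrow> q \<in> low m \<Longrightarrow> p - q \<in> low m"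
  using low_add[of p m "- q"] low_uminus[of q m] by simp

lemma low_sum: "(\<And>a. a \<in> A \<Longrightarrow> f a \<in> low m) \<Longrightarrow> sum f A \<in> low m"
  by (induction A rule: infinite_finite_induct) (auto simp: low_add)

lemma low_lookup: "p \<in> low m \<Longrightarrow> m \<le> weight w \<Longrightarrow> lookup p w = 0"
  by (force simp: low_def in_keys_iff)

lemma low_act:
  assumes "i < n" "normal w" "wt i + weight w < m"
  shows "act i w \<in> low m"
  using keys_act[OF assms(1,2)] assms(3) NP_act[OF assms(1,2)]
  unfolding low_def reach_def by fastforce

lemma low_lin:
  assumes "p \<in> NP" "\<And>w. w \<in> keys p \<Longrightarrow> normal w \<Longrightarrow> f w \<in> low m"
  shows "lin f p \<in> low m"
  unfolding lin_def by (intro low_sum low_scl) (use assms in \<open>auto simp: NP_def\<close>)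

lemma low_op: "i < n \<Longrightarrow> p \<in> low m \<Longrightarrow> op (b i) p \<in> low (m + wt i)"
  unfolding op_b by (rule low_lin) (auto simp: low_def[of m] intro!: low_act)

lemma low_rho:
  assumes "normal w" "\<And>k. k < n \<Longrightarrow> coord x k \<noteq> 0 \<Longrightarrow> wt k + weight w < m"
  shows "rho x w \<in> low m"
  unfolding rho_def
proof (rule low_sum)
  fix k assume k: "k \<in> {..<n}"
  show "scl (coord x k) (act k w) \<in> low m"
    using assms k low_scl[OF low_act[of k w m]] by (cases "coord x k = 0") auto
qed

lemma normal_sorted: "normal w \<Longrightarrow> sorted w"
  by (induction w) (auto simp: normal_Cons before_def)

lemma normal_insort:
  assumes "normal w" "e < n" "\<not> par e"
  shows "normal (insort e w)"
  using assms(1)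
proof (induction w)
  case (Cons j w)
  then show ?case
    using assms(2,3) by (auto simp: normal_Cons set_insort_key before_def dest: order_le_less_trans)
qed (use assms in \<open>auto simp: normal_Cons\<close>)

lemma weight_insort: "weight (insort e w) = wt e + weight w"
  by (induction w) auto

text \<open>Up to lower weight an even letter commutes with all letters, so it can be inserted at
  its sorted place. The correction terms replace two letters by one: for an odd \<open>j\<close> the
  weight falls from at least 5 to 2, for an even \<open>j\<close> from at least 6 to at most
  4.\<close>

lemma act_even:
  assumes "e < n" "\<not> par e" "normal w"
  shows "act e w - single (insort e w) 1 \<in> low (wt e + weight w)"
  using assms(3)
proof (induction w)
  case (Cons j t)
  have t: "normal t" and j: "j < n" using Cons.prems by (auto simp: normal_Cons)
  show ?case
  proof (cases "e \<le> j")
    case True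
    then have "normal (e # j # t)"
      using Cons.prems assms by (auto simp: normal_Cons_Cons before_def)
    then show ?thesis using True by (simp add: act_normal)
  next
    case False
    then have je: "j < e" by simp
    have r: "act e (j # t) = op (b j) (act e t) + rho (bracket g (b e) (b j)) t"
      using rel_direct[OF assms(1) j je Cons.prems] Cons.prems assms
      by (simp add: rel_def act_normal rho_b)
    have nji: "normal (j # insort e t)"
      using normal_insort[OF t assms(1,2)] Cons.prems je
      by (auto simp: normal_Cons set_insort_key before_def)
    have "op (b j) (act e t) - single (j # insort e t) 1
        = op (b j) (act e t - single (insort e t) 1)"
      using act_normal[OF nji] j by (simp add: op_diff rho_b)
    also have "\<dots> \<in> low (wt e + weight (j # t))"
      using low_op[OF j Cons.IH[OF t]] by (simp add: ac_simps)
    finally have A: "op (b j) (act e t) - single (j # insort e t) 1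
        \<in> low (wt e + weight (j # t))" .
    have "rho (bracket g (b e) (b j)) t \<in> low (wt e + weight (j # t))"
    proof (rule low_rho[OF t])
      fix k assume "k < n" "coord (bracket g (b e) (b j)) k \<noteq> 0"
      then have "par k = par j" using coord_bracket[OF assms(1) j] assms(2) by simp
      then show "wt k + weight t < wt e + weight (j # t)"
        using assms(2) by (auto simp: wt_def)
    qed
    then show ?thesis
      using low_add[OF A] je by (simp add: r algebra_simps)
  qed
qed simp

lemma eval_mon_Cons: "eval (mon (i # w)) p = op (b i) (eval (mon w) p)"
  by (simp add: mon_Cons eval_mult)

lemma eval_mon_Nil [simp]: "eval (mon []) p = p"
  by (simp add: mon_Nil)

lemma low_eval_mon:
  "\<lbrakk>\<And>i. i \<in> set w \<Longrightarrow> i < n; p \<in> low m\<rbrakk> \<Longrightarrow> eval (mon w) p \<in> low (m + weight w)"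
proof (induction w)
  case (Cons i w)
  then have "op (b i) (eval (mon w) p) \<in> low (m + weight w + wt i)"
    by (intro low_op) auto
  then show ?case by (simp add: eval_mon_Cons ac_simps)
qed simp

lemma eval_mon_even:
  assumes "\<And>i. i \<in> set w \<Longrightarrow> i < n \<and> \<not> par i" "normal v"
  shows "normal (foldr insort w v) \<and> weight (foldr insort w v) = weight w + weight v \<and>
    eval (mon w) (single v 1) - single (foldr insort w v) 1
      \<in> low (weight w + weight v)"
  using assms(1)
proof (induction w)
  case (Cons i w)
  let ?u = "foldr insort w v"
  have i: "i < n" "\<not> par i" using Cons.prems by auto
  have IH: "normal ?u" "weight ?u = weight w + weight v"
      "eval (mon w) (single v 1) - single ?u 1 \<in> low (weight w + weight v)"
    using Cons by auto
  have "eval (mon (i # w)) (single v 1) - single (insort i ?u) 1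
      = op (b i) (eval (mon w) (single v 1) - single ?u 1)
        + (act i ?u - single (insort i ?u) 1)"
    using i by (simp add: eval_mon_Cons op_diff rho_b)
  also have "\<dots> \<in> low (weight (i # w) + weight v)"
    using low_op[OF i(1) IH(3)] act_even[OF i IH(1)] IH(2)
    by (intro low_add) (simp_all add: ac_simps)
  finally show ?case
    using normal_insort[OF IH(1) i] IH(2) by (simp add: weight_insort)
qed (use assms in simp)

lemma eval_nf: "f \<in> C \<Longrightarrow> p \<in> NP \<Longrightarrow> eval f p = lin (\<lambda>w. eval (mon w) p) (val f)"
proof -
  assume f: "f \<in> C" and p: "p \<in> NP"
  have "eval f p = eval (nf (val f)) p"
    using f p by (intro eval_cong nf_C NP_val) (simp_all add: val_nf NP_val)
  also have "\<dots> = lin (\<lambda>w. eval (mon w) p) (val f)"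
    by (simp add: nf_def lin_def eval_sum eval_scl)
  finally show ?thesis .
qed

lemma finite_max_ex:
  assumes "finite A" "A \<noteq> {}"
  obtains a where "a \<in> A" "\<And>c. c \<in> A \<Longrightarrow> (f c :: 'c::linorder) \<le> f a"
proof -
  have "Max (f ` A) \<in> f ` A" using assms by (intro Max_in) auto
  then obtain a where "a \<in> A" "Max (f ` A) = f a" by blast
  then show ?thesis using that[of a] Max_ge[of "f ` A"] assms(1) by simp
qed

text \<open>The two leading terms are maximal first in weight and then as multisets of letters, so that
  their product cannot cancel.\<close>

lemma eval_nonzero:
  assumes f: "f \<in> C" and q: "q \<in> NP" "q \<noteq> 0" and nz: "val f \<noteq> 0"
    and top: "\<And>w. \<lbrakk>w \<in> keys (val f);
        \<And>v. v \<in> keys (val f) \<Longrightarrow> weight v \<le> weight w\<rbrakk> \<Longrightarrow> \<forall>i\<in>set w. \<not> par i"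
  shows "eval f q \<noteq> 0"
proof -
  let ?p = "val f"
  have top_ex: "\<exists>w\<in>keys p. (\<forall>v\<in>keys p. weight v \<le> weight w) \<and>
      (\<forall>v\<in>keys p. weight v = weight w \<longrightarrow> mset v \<le> mset w)"
    if "p \<noteq> 0" for p :: "nat list \<Rightarrow>\<^sub>0 'k"
  proof -
    have ne: "keys p \<noteq> {}" using that by (metis keys_eq_empty)
    obtain u where u: "u \<in> keys p" "\<And>v. v \<in> keys p \<Longrightarrow> weight v \<le> weight u"
      using finite_max_ex[OF finite_keys ne, of weight] by metis
    obtain w where "w \<in> {v \<in> keys p. weight v = weight u}"
        "\<And>v. v \<in> {v \<in> keys p. weight v = weight u} \<Longrightarrow> mset v \<le> mset w"
      using finite_max_ex[of "{v \<in> keys p. weight v = weight u}" mset] u(1) by auto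
    then show ?thesis using u by (intro bexI[of _ w]) auto
  qed
  obtain w0 where w0: "w0 \<in> keys ?p" "\<And>v. v \<in> keys ?p \<Longrightarrow> weight v \<le> weight w0"
      "\<And>v. v \<in> keys ?p \<Longrightarrow> weight v = weight w0 \<Longrightarrow> mset v \<le> mset w0"
    using top_ex[OF nz] by blast
  obtain v0 where v0: "v0 \<in> keys q" "\<And>v. v \<in> keys q \<Longrightarrow> weight v \<le> weight v0"
      "\<And>v. v \<in> keys q \<Longrightarrow> weight v = weight v0 \<Longrightarrow> mset v \<le> mset v0"
    using top_ex[OF q(2)] by blast
  let ?t = "foldr insort w0 v0"
  have nw: "normal w" if "w \<in> keys ?p" for w
    using NP_val[of f] that by (auto simp: NP_def)
  have nv: "normal v" if "v \<in> keys q" for v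
    using q(1) that by (auto simp: NP_def)
  have even: "i < n \<and> \<not> par i" if "w \<in> keys ?p" "weight w = weight w0" "i \<in> set w" for w i
    using top[OF that(1)] w0(2) nw[OF that(1)] that by (auto simp: normal_def)
  have wt_t: "weight ?t = weight w0 + weight v0"
    using eval_mon_even[OF even[OF w0(1) refl] nv[OF v0(1)]] by simp
  have key: "lookup (eval (mon w) (single v 1)) ?t
      = (if w = w0 \<and> v = v0 then 1 else 0)"
    if w: "w \<in> keys ?p" and v: "v \<in> keys q" for w v
  proof (cases "weight w = weight w0 \<and> weight v = weight v0")
    case True
    let ?u = "foldr insort w v"
    have "eval (mon w) (single v 1) - single ?u 1 \<in> low (weight w + weight v)"
    proof -
      have "i < n \<and> \<not> par i" if "i \<in> set w" for i
        using even[OF w _ that] True by simp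
      from eval_mon_even[of w v, OF this nv[OF v]] show ?thesis by simp
    qed
    then have "lookup
        (eval (mon w) (single v 1) - single ?u 1) ?t = 0"
      by (rule low_lookup) (use True wt_t in simp)
    then have "lookup (eval (mon w) (single v 1)) ?t
        = lookup (single ?u (1::'k)) ?t"
      by (simp add: lookup_minus)
    \<comment> \<open>Letters are only rearranged, so the two sums of multisets agree. The multiset
      order is strictly compatible with addition and both summands on the right are maximal, so the
      summands agree; a sorted word is determined by its multiset.\<close>
    moreover have "w = w0 \<and> v = v0" if "?u = ?t"
    proof -
      have s: "mset w + mset v = mset w0 + mset v0"
        using that by (metis mset_foldr_insort)
      have le: "mset w \<le> mset w0" "mset v \<le> mset v0"
        using w0(3)[OF w] v0(3)[OF v] True by auto
      have "mset w = mset w0"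
        using add_less_le_mono[of "mset w" "mset w0" "mset v" "mset v0"] le s by force
      moreover from this have "mset v = mset v0" using s by simp
      ultimately show ?thesis
        using normal_sorted nw w w0(1) nv v v0(1) by (metis properties_for_sort sorted_sort_id)
    qed
    ultimately show ?thesis by (auto simp: lookup_single when_def)
  next
    case False
    then have lt: "weight w + weight v < weight ?t"
      using w0(2)[OF w] v0(2)[OF v] wt_t by linarith
    \<comment> \<open>All other pairs have a smaller total weight; \<open>Suc\<close> is there
      because \<open>low\<close> is strict.\<close>
    have "single v 1 \<in> low (Suc (weight v))"
      using nv[OF v] by (simp add: low_def)
    then have "eval (mon w) (single v 1) \<in> low (Suc (weight v) + weight w)"
      by (rule low_eval_mon[rotated]) (use nw[OF w] in \<open>simp add: normal_def\<close>)
    then have "lookup (eval (mon w) (single v 1)) ?t = 0"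
      by (rule low_lookup) (use lt in simp)
    then show ?thesis using False by auto
  qed
  have q_sum: "q = (\<Sum>v\<in>keys q. scl (lookup q v) (single v 1))"
    by (simp only: lin_single_id[unfolded lin_def])
  have "eval f q = (\<Sum>w\<in>keys ?p. \<Sum>v\<in>keys q.
      scl (lookup ?p w * lookup q v) (eval (mon w) (single v 1)))"
    unfolding eval_nf[OF f q(1)] lin_def
    by (rule sum.cong[OF refl], subst (1) q_sum)
       (simp add: eval_sum_right eval_scl_right pm.scale_sum_right)
  then have "lookup (eval f q) ?t = (\<Sum>w\<in>keys ?p. \<Sum>v\<in>keys q.
      lookup ?p w * lookup q v * (if w = w0 \<and> v = v0 then 1 else 0))"
    by (simp add: lookup_sum key cong: sum.cong)
  also have "\<dots> = (\<Sum>w\<in>keys ?p. if w = w0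
      then lookup ?p w0 * lookup q v0 else 0)"
  proof (rule sum.cong[OF refl])
    fix w
    have "(\<Sum>v\<in>keys q.
        lookup ?p w * lookup q v * (if w = w0 \<and> v = v0 then 1 else 0))
      = (\<Sum>v\<in>keys q.
          if v = v0 then (if w = w0 then lookup ?p w0 * lookup q v0 else 0) else 0)"
      by (rule sum.cong) auto
    then show "(\<Sum>v\<in>keys q.
        lookup ?p w * lookup q v * (if w = w0 \<and> v = v0 then 1 else 0))
      = (if w = w0 then lookup ?p w0 * lookup q v0 else 0)"
      using v0(1) by simp
  qed
  also have "\<dots> = lookup ?p w0 * lookup q v0"
    using w0(1) by simp
  finally show ?thesis
    using w0(1) v0(1) by (auto simp: in_keys_iff)
qed

end

text \<open>The linear form of the overview is the last coordinate. If the odd part is zero, the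
  condition holds trivially, also for \<open>n = 0\<close>.\<close>

locale nondegenerate_superalgebra = based_superalgebra g n par b coord
  for g :: "('k::field, 'a::ab_group_add) lsa" and n par b coord +
  assumes nondegenerate: "\<lbrakk>y \<in> part g True;
      \<And>x. x \<in> part g True \<Longrightarrow> coord (bracket g x y) (n - 1) = 0\<rbrakk> \<Longrightarrow> y = 0"
begin

lemma part_sum: "(\<And>a. a \<in> A \<Longrightarrow> f a \<in> part g e) \<Longrightarrow> sum f A \<in> part g e"
  by (induction A rule: infinite_finite_induct) (auto simp: part_add part_zero)

lemma coord_zero [simp]: "coord 0 i = 0"
  using coord_smul[of 0 0 i] sspace_zero by simp

lemma coord_diff: "x \<in> sspace g \<Longrightarrow> y \<in> sspace g \<Longrightarrow> coord (x - y) i = coord x i - coord y i"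
  using coord_add[of x "- y" i] coord_smul[of y "- 1" i] sspace_smul[of y "- 1"] by simp

lemma coord_sum': "(\<And>a. a \<in> A \<Longrightarrow> f a \<in> sspace g) \<Longrightarrow> coord (sum f A) i = (\<Sum>a\<in>A. coord (f a) i)"
  by (induction A rule: infinite_finite_induct) (auto simp: coord_add sspace_sum)

text \<open>Once an odd letter exists, nondegeneracy produces an even element with nonzero last
  coordinate; so there is a last letter, it is even, and the odd letters precede it.\<close>

lemma odd_less_last:
  assumes "i < n" "par i"
  shows "i < n - 1" "\<not> par (n - 1)" "n - 1 < n"
proof -
  have "b i \<noteq> 0" using coord_b[OF assms(1) assms(1)] by auto
  then obtain x where x: "x \<in> part g True" "coord (bracket g x (b i)) (n - 1) \<noteq> 0"
    using nondegenerate[of "b i"] b_part assms by force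
  have "bracket g x (b i) \<in> part g False"
    using bracket_part[OF x(1) b_part[OF assms(1)]] assms(2) by simp
  then show l: "\<not> par (n - 1)" "n - 1 < n"
    using coord_part x(2) assms(1) by auto
  then show "i < n - 1" using odd_first assms by blast
qed

text \<open>The supercommutator of the odd element \<open>x\<close> with the product of the letters,
  expanded by the super Leibniz rule; see \<open>op_deriv\<close>.\<close>

primrec deriv :: "'a \<Rightarrow> nat list \<Rightarrow> (nat list \<Rightarrow>\<^sub>0 'k)" where
  "deriv x [] = 0"
| "deriv x (i # w) = rho (bracket g x (b i)) w + scl (koszul True (par i)) (op (b i) (deriv x w))"

text \<open>What is left of \<open>deriv\<close> in top weight. The odd letters are removed in turn
  with alternating signs, each replaced by its pairing with \<open>x\<close> times the letter
  \<open>n - 1\<close>, which may stand at the end because even letters commute up to lower weight.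
  The recursion stops at the first even letter, after which a normal word has no odd ones.\<close>

primrec contract :: "'a \<Rightarrow> nat list \<Rightarrow> (nat list \<Rightarrow>\<^sub>0 'k)" where
  "contract x [] = 0"
| "contract x (i # w) = (if par i
     then scl (coord (bracket g x (b i)) (n - 1)) (single (w @ [n - 1]) 1)
       - lin (\<lambda>v. single (i # v) 1) (contract x w)
     else 0)"

text \<open>The second summand is the signed product of the word by \<open>x\<close> on the right,
  so \<open>deriv x w\<close> is the supercommutator; \<open>x\<close> is moved past one letter at a
  time.\<close>

lemma op_deriv:
  assumes "x \<in> part g True" "normal w"
  shows "op x (single w 1) = deriv x w
    + scl (koszul True (parity w)) (eval (mon w) (op x (single [] 1)))"
  using assms(2)
proof (induction w)
  case (Cons i w)
  have i: "i < n" and w: "normal w" using Cons.prems by (auto simp: normal_Cons)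
  have s: "single (i # w) 1 = op (b i) (single w 1)"
    using act_normal[OF Cons.prems] i by (simp add: rho_b)
  have "op x (single (i # w) 1) =
      scl (koszul True (par i)) (op (b i) (op x (single w 1)))
      + rho (bracket g x (b i)) w"
    unfolding s by (subst op_commute[OF NP_single[OF w] assms(1) b_part[OF i]]) simp
  also have "op x (single w 1) = deriv x w
    + scl (koszul True (parity w)) (eval (mon w) (op x (single [] 1)))"
    using Cons.IH[OF w] .
  finally show ?case
    by (cases "par i"; cases "parity w") (simp_all add: op_add op_diff eval_mon_Cons)
qed simp

lemma normal_append_last:
  assumes "normal w" "i < n" "par i"
  shows "normal (w @ [n - 1])"
proof -
  have "before j (n - 1)" if "j \<in> set w" for j
    using that assms odd_less_last(2)[OF assms(2,3)] by (cases "j = n - 1") (auto simp: normal_def before_def)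
  then show ?thesis
    using assms odd_less_last(3)[OF assms(2,3)] by (auto simp: normal_def sorted_wrt_append)
qed

lemma keys_contract:
  "normal w \<Longrightarrow> v \<in> keys (contract x w) \<Longrightarrow>
    normal v \<and> weight v = weight w + 2 \<and> set v \<subseteq> insert (n - 1) (set w)"
proof (induction w arbitrary: v)
  case (Cons i w)
  have w: "normal w" and i: "i < n" using Cons.prems by (auto simp: normal_Cons)
  have p: "par i" using Cons.prems(2) by (auto split: if_splits)
  note l = odd_less_last[OF i p]
  have wl: "wt (n - 1) = 4" "wt i = 2" using l p by (auto simp: wt_def)
  have "v = w @ [n - 1] \<or> v \<in> keys (lin (\<lambda>v. single (i # v) 1) (contract x w))"
    using Cons.prems(2) p by (auto simp: in_keys_iff lookup_minus lookup_single when_def split: if_splits)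
  then consider "v = w @ [n - 1]" | u where "u \<in> keys (contract x w)" "v = i # u"
    using keys_lin_subset[of "contract x w" "\<lambda>v. single (i # v) (1::'k)"
        "(#) i ` keys (contract x w)"] by auto
  then show ?case
  proof cases
    case 1
    then show ?thesis using normal_append_last[OF w i p] wl by auto
  next
    case 2
    note IH = Cons.IH[OF w 2(1)]
    have "before i j" if "j \<in> set u" for j
      using IH that Cons.prems(1) l by (auto simp: normal_Cons before_def)
    then show ?thesis using IH 2(2) i by (auto simp: normal_Cons)
  qed
qed simp

lemma normal_Cons_contract:
  assumes "normal (i # w)" "par i" "v \<in> keys (contract x w)"
  shows "normal (i # v)"
proof -
  have w: "normal w" and i: "i < n" using assms(1) by (auto simp: normal_Cons)
  have "before i j" if "j \<in> set v" for j
    using keys_contract[OF w assms(3)] that assms(1) odd_less_last[OF i assms(2)]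
    by (auto simp: normal_Cons before_def)
  then show ?thesis using keys_contract[OF w assms(3)] i by (simp add: normal_Cons)
qed

lemma contract_even: "normal (i # w) \<Longrightarrow> \<not> par i \<Longrightarrow> contract x w = 0"
proof (cases w)
  case (Cons j v)
  assume "normal (i # w)" "\<not> par i"
  then have "\<not> par j"
    using odd_first[of j i] Cons by (auto simp: normal_Cons before_def)
  then show ?thesis using Cons by simp
qed simp

text \<open>Among the brackets with \<open>x\<close>, only the component along the letter
  \<open>n - 1\<close> of a bracket with an odd letter puts weight 4 in place of 2. The other even
  components weigh 3, and a bracket with an even letter is odd, of weight 2 in place of at least
  3.\<close>

lemma deriv_contract:
  assumes x: "x \<in> part g True"
  shows "normal w \<Longrightarrow> deriv x w - contract x w \<in> low (weight w + 2)"
proof (induction w)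
  case (Cons i w)
  have w: "normal w" and i: "i < n" using Cons.prems by (auto simp: normal_Cons)
  have y: "bracket g x (b i) \<in> part g (True \<noteq> par i)"
    by (rule bracket_part[OF x b_part[OF i]])
  have IH: "op (b i) (deriv x w - contract x w) \<in> low (weight (i # w) + 2)"
    using low_op[OF i Cons.IH[OF w]] by (simp add: ac_simps)
  show ?case
  proof (cases "par i")
    case False
    have "rho (bracket g x (b i)) w \<in> low (weight (i # w) + 2)"
    proof (rule low_rho[OF w])
      fix k assume "k < n" "coord (bracket g x (b i)) k \<noteq> 0"
      then have "par k" using coord_part[OF y] False by simp
      then show "wt k + weight w < weight (i # w) + 2"
        using wt_bounds(1)[of i] by (simp add: wt_def)
    qed
    then show ?thesis
      using low_add[OF _ IH] False contract_even[OF Cons.prems False] by simp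
  next
    case True
    note l = odd_less_last[OF i True]
    let ?c = "coord (bracket g x (b i)) (n - 1)"
    have wl: "wt (n - 1) = 4" "wt i = 2" using l True by (auto simp: wt_def)
    have ins: "insort (n - 1) w = w @ [n - 1]"
      using normal_sorted[OF w] w by (intro insort_append_last) (auto simp: normal_def)
    have "rho (bracket g x (b i)) w - scl ?c (act (n - 1) w) =
        (\<Sum>k\<in>{..<n} - {n - 1}. scl (coord (bracket g x (b i)) k) (act k w))"
      unfolding rho_def using l(3) by (subst sum.remove[of _ "n - 1"]) auto
    also have "\<dots> \<in> low (weight (i # w) + 2)"
    proof (rule low_sum)
      fix k assume k: "k \<in> {..<n} - {n - 1}"
      show "scl (coord (bracket g x (b i)) k) (act k w) \<in> low (weight (i # w) + 2)"
      proof (cases "coord (bracket g x (b i)) k = 0")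
        case False
        then have "wt k = 3" using coord_part[OF y] True k by (auto simp: wt_def)
        then show ?thesis using k w wl by (intro low_scl low_act) auto
      qed simp
    qed
    finally have A: "rho (bracket g x (b i)) w - scl ?c (act (n - 1) w) \<in> low (weight (i # w) + 2)" .
    have B: "scl ?c (act (n - 1) w - single (w @ [n - 1]) 1) \<in> low (weight (i # w) + 2)"
    proof -
      have "weight (i # w) + 2 = wt (n - 1) + weight w" using wl by simp
      then show ?thesis
        using act_even[OF l(3,2) w] unfolding ins by (intro low_scl) (simp only:)
    qed
    have D: "op (b i) (contract x w) = lin (\<lambda>v. single (i # v) 1) (contract x w)"
      unfolding op_b[OF i]
      by (rule lin_cong) (use normal_Cons_contract[OF Cons.prems True] in \<open>auto simp: act_normal\<close>)
    have "deriv x (i # w) - contract x (i # w) =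
        (rho (bracket g x (b i)) w - scl ?c (act (n - 1) w))
        + scl ?c (act (n - 1) w - single (w @ [n - 1]) 1)
        - op (b i) (deriv x w - contract x w)"
      using True by (simp add: D op_diff pm.scale_right_diff_distrib)
    also have "\<dots> \<in> low (weight (i # w) + 2)"
      by (intro low_diff low_add A B IH)
    finally show ?thesis .
  qed
qed simp

text \<open>The coefficient of \<open>J b\<^sub>n\<^sub>-\<^sub>1\<close> in \<open>contract x w\<close> is the value of the form at \<open>x\<close> and the
  following signed sum of the odd letters of \<open>w\<close> whose removal leaves \<open>J\<close>.\<close>

primrec removed :: "nat list \<Rightarrow> nat list \<Rightarrow> 'a" where
  "removed [] J = 0"
| "removed (i # w) J = (if par i
     then (if w = J then b i else 0)
       - (case J of [] \<Rightarrow> 0 | j # J' \<Rightarrow> if j = i then removed w J' else 0)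
     else 0)"

lemma removed_part: "normal w \<Longrightarrow> removed w J \<in> part g True"
proof (induction w arbitrary: J)
  case (Cons i w)
  have w: "normal w" and i: "i < n" using Cons.prems by (auto simp: normal_Cons)
  show ?case
  proof (cases "par i")
    case True
    then have "(if w = J then b i else 0) \<in> part g True"
      using b_part[OF i] part_zero by simp
    moreover have "(case J of [] \<Rightarrow> 0 | j # J' \<Rightarrow> if j = i then removed w J' else 0) \<in> part g True"
      using Cons.IH[OF w] part_zero by (simp split: list.split)
    ultimately show ?thesis using True part_diff by simp
  qed (simp add: part_zero)
qed (simp add: part_zero)

lemma lookup_lin_Cons:
  "lookup (lin (\<lambda>v. single (i # v) 1) q) u
     = (case u of [] \<Rightarrow> 0 | j # u' \<Rightarrow> if j = i then lookup q u' else (0::'k))"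
proof (cases u)
  case (Cons j u')
  have "(\<Sum>v\<in>keys q. lookup q v * (1 when i # v = j # u'))
      = (\<Sum>v\<in>keys q. if v = u' then (if j = i then lookup q u' else 0) else 0)"
    by (rule sum.cong) (auto simp: when_def)
  then show ?thesis using Cons
    by (auto simp: lookup_lin lookup_single in_keys_iff)
qed (simp add: lookup_lin lookup_single)

text \<open>Writes the coefficient as a value of the form that is linear in the removed letters;
  this linearity allows nondegeneracy to be applied to a sum over words.\<close>

lemma lookup_contract:
  assumes x: "x \<in> part g True"
  shows "normal w \<Longrightarrow> lookup (contract x w) (J @ [n - 1])
    = coord (bracket g x (removed w J)) (n - 1)"
proof (induction w arbitrary: J)
  case Nil
  then show ?case using bracket_zero_right[OF part_sspace[OF x]] by simp
next
  case (Cons i w)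
  have w: "normal w" and i: "i < n" using Cons.prems by (auto simp: normal_Cons)
  note xs = part_sspace[OF x]
  show ?case
  proof (cases "par i")
    case True
    define a where "a = (if w = J then b i else 0)"
    define r where "r = (case J of [] \<Rightarrow> 0 | j # J' \<Rightarrow> if j = i then removed w J' else 0)"
    have as: "a \<in> sspace g"
      using sspace_zero b_sspace[OF i] by (simp add: a_def)
    have rs: "r \<in> sspace g"
      using part_sspace[OF removed_part[OF w]] sspace_zero by (simp add: r_def split: list.split)
    have R: "removed (i # w) J = a - r" using True by (simp add: a_def r_def)
    have "bracket g x (a - r) = bracket g x a - bracket g x r"
      using bracket_add_right[OF xs as, of "smul g (- 1) r"] bracket_smul_right[OF xs rs, of "- 1"]
        sspace_smul[OF rs, of "- 1"] by simp
    then have "coord (bracket g x (removed (i # w) J)) (n - 1)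
        = coord (bracket g x a) (n - 1) - coord (bracket g x r) (n - 1)"
      unfolding R by (simp add: coord_diff bracket_sspace xs rs as)
    moreover have "coord (bracket g x a) (n - 1) = coord (bracket g x (b i)) (n - 1)
        * lookup (single (w @ [n - 1]) 1) (J @ [n - 1])"
      using bracket_zero_right[OF xs] by (cases "w = J") (auto simp: a_def lookup_single)
    moreover have "coord (bracket g x r) (n - 1) =
        lookup (lin (\<lambda>v. single (i # v) 1) (contract x w)) (J @ [n - 1])"
    proof (cases J)
      case Nil
      then show ?thesis
        using odd_less_last(1)[OF i True] bracket_zero_right[OF xs] by (simp add: r_def lookup_lin_Cons)
    next
      case J: (Cons j J')
      then show ?thesis
        using Cons.IH[OF w, of J'] bracket_zero_right[OF xs]
        by (cases "j = i") (simp_all add: r_def lookup_lin_Cons)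
    qed
    ultimately show ?thesis using True by (simp add: lookup_minus)
  qed (use bracket_zero_right[OF xs] in simp)
qed

lemma removed_coord_mem:
  "\<lbrakk>normal w; i < n; coord (removed w J) i \<noteq> 0\<rbrakk> \<Longrightarrow> i \<in> set w"
proof (induction w arbitrary: J)
  case (Cons j w)
  have w: "normal w" and j: "j < n" using Cons.prems by (auto simp: normal_Cons)
  show ?case
  proof (rule ccontr)
    assume ni: "i \<notin> set (j # w)"
    let ?a = "if w = J then b j else 0"
    let ?r = "case J of [] \<Rightarrow> 0 | k # J' \<Rightarrow> if k = j then removed w J' else 0"
    have z: "coord (removed w J') i = 0" for J'
      using Cons.IH[OF w Cons.prems(2)] ni by auto
    have "coord ?a i = 0" using ni coord_b[OF j Cons.prems(2)] by simp
    moreover have "coord ?r i = 0" using z by (simp split: list.split)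
    moreover have "?a \<in> sspace g" using b_sspace[OF j] sspace_zero by simp
    moreover have "?r \<in> sspace g"
      using part_sspace[OF removed_part[OF w]] sspace_zero by (simp split: list.split)
    ultimately have "coord (?a - ?r) i = 0" by (simp only: coord_diff diff_zero)
    then show False using Cons.prems(3) by (cases "par j") simp_all
  qed
qed simp

text \<open>Any other contribution of \<open>i\<close> would come from deeper in the recursion,
  where \<open>w\<close> and \<open>J\<close> start with the same letter \<open>j\<close>. Normality
  of \<open>i # J\<close> then gives \<open>i < j\<close>, while \<open>i\<close> occurs in
  \<open>w\<close> after \<open>j\<close>.\<close>

lemma removed_coord_head:
  assumes w: "normal w" and i: "par i" "normal (i # J)"
  shows "coord (removed w J) i = (if w = i # J then 1 else 0)"
proof (cases w)
  case (Cons j v)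
  have v: "normal v" and j: "j < n" and i': "i < n" using w i Cons by (auto simp: normal_Cons)
  show ?thesis
  proof (cases "par j")
    case True
    let ?r = "case J of [] \<Rightarrow> 0 | k # J' \<Rightarrow> if k = j then removed v J' else 0"
    have rs: "?r \<in> sspace g"
      using part_sspace[OF removed_part[OF v]] sspace_zero by (simp split: list.split)
    have "coord ?r i = 0"
    proof (rule ccontr)
      assume "coord ?r i \<noteq> 0"
      then obtain J' where J: "J = j # J'" "coord (removed v J') i \<noteq> 0"
        by (auto split: list.splits if_splits)
      then have "i < j" using i by (auto simp: normal_Cons before_def)
      moreover have "i \<in> set v" using removed_coord_mem[OF v i' J(2)] .
      ultimately show False using w Cons by (auto simp: normal_Cons before_def)
    qed
    then show ?thesis
      using Cons True rs b_sspace[OF j] sspace_zero coord_b[OF j i'] by (auto simp: coord_diff)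
  qed (use Cons i in auto)
qed (use i in simp)

text \<open>Suppose a leading word has an odd letter; then its first letter \<open>i\<close> is odd,
  and \<open>J\<close> is the rest. The coefficients of \<open>J @ [n - 1]\<close> in the
  supercommutators with all odd \<open>x\<close> are values of the form at one vector
  \<open>?Y\<close>. They vanish, so \<open>?Y\<close> is zero, although its coordinate at
  \<open>i\<close> is the coefficient of the leading word. The fixed parity \<open>d\<close> makes
  the Koszul sign the same for all words.\<close>

theorem supercentral_leading_even:
  assumes f: "f \<in> C" and par: "\<And>w. w \<in> keys (val f) \<Longrightarrow> parity w = d"
    and comm: "\<And>x. x \<in> part g True \<Longrightarrow> val (gen x * f) = scl (koszul True d) (val (f * gen x))"
    and w: "w \<in> keys (val f)"
      "\<And>v. v \<in> keys (val f) \<Longrightarrow> weight v \<le> weight w"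
  shows "\<forall>i\<in>set w. \<not> par i"
proof (rule ccontr)
  assume "\<not> (\<forall>i\<in>set w. \<not> par i)"
  then obtain k where k: "k \<in> set w" "par k" by blast
  have nw: "normal v" if "v \<in> keys (val f)" for v
    using NP_val[of f] that by (auto simp: NP_def)
  obtain i J where wJ: "w = i # J" using k by (cases w) auto
  have kn: "k < n" and i: "i < n" "normal (i # J)"
    using nw[OF w(1)] k wJ by (auto simp: normal_def)
  have pi: "par i"
  proof (rule ccontr)
    assume ni: "\<not> par i"
    then have "k < i" using odd_first[OF kn i(1)] k by simp
    moreover have "k \<in> set J" using k wJ ni by auto
    ultimately show False using i(2) by (auto simp: normal_Cons before_def)
  qed
  note l = odd_less_last[OF i(1) pi]
  have wl: "weight (J @ [n - 1]) = weight w + 2"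
    using l pi wJ by (simp add: wt_def)
  \<comment> \<open>The signed sum, weighted by the coefficients of \<open>f\<close>, of all odd
    letters whose removal from a word leaves \<open>J\<close>.\<close>
  let ?Y = "\<Sum>v\<in>keys (val f). smul g (lookup (val f) v) (removed v J)"
  have rp: "removed v J \<in> part g True" if "v \<in> keys (val f)" for v
    using removed_part nw that by blast
  have Yp: "?Y \<in> part g True"
    by (rule part_sum) (rule part_smul[OF rp])
  have "coord (bracket g x ?Y) (n - 1) = 0" if x: "x \<in> part g True" for x
  proof -
    note xs = part_sspace[OF x]
    have "val (gen x * f) = lin (\<lambda>v. op x (single v 1)) (val f)"
      by (simp add: val_mult op_def)
    also have "\<dots> = lin (\<lambda>v. deriv x v + scl (koszul True d)
        (eval (mon v) (op x (single [] 1)))) (val f)"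
      by (rule lin_cong) (simp only: op_deriv[OF x nw] par)
    also have "\<dots> = lin (deriv x) (val f)
        + scl (koszul True d) (eval f (op x (single [] 1)))"
      by (subst eval_nf[OF f NP_op]) (simp_all add: lin_fun_add lin_fun_scl)
    also have "eval f (op x (single [] 1)) = val (f * gen x)"
      by (simp add: val_def eval_mult)
    finally have "lin (deriv x) (val f) = 0"
      using comm[OF x] by simp
    then have "0 = (\<Sum>v\<in>keys (val f).
        lookup (val f) v * lookup (deriv x v) (J @ [n - 1]))"
      by (metis lookup_lin lookup_zero)
    also have "\<dots> = (\<Sum>v\<in>keys (val f).
        lookup (val f) v * coord (bracket g x (removed v J)) (n - 1))"
    proof (rule sum.cong[OF refl])
      fix v assume v: "v \<in> keys (val f)"
      \<comment> \<open>\<open>J @ [n - 1]\<close> has the top weight, so the error terms of no word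
        \<open>v\<close> reach it.\<close>
      have "lookup (deriv x v - contract x v) (J @ [n - 1]) = 0"
        by (rule low_lookup[OF deriv_contract[OF x nw[OF v]]]) (use w(2)[OF v] wl in simp)
      then show "lookup (val f) v * lookup (deriv x v) (J @ [n - 1])
          = lookup (val f) v * coord (bracket g x (removed v J)) (n - 1)"
        using lookup_contract[OF x nw[OF v]] by (simp add: lookup_minus)
    qed
    also have "\<dots> = coord (bracket g x ?Y) (n - 1)"
    proof -
      have rs: "removed v J \<in> sspace g" if "v \<in> keys (val f)" for v
        using rp[OF that] part_sspace by blast
      have "bracket g x ?Y = (\<Sum>v\<in>keys (val f).
          bracket g x (smul g (lookup (val f) v) (removed v J)))"
        by (rule bracket_sum_right) (auto intro: sspace_smul rs xs)
      also have "\<dots> = (\<Sum>v\<in>keys (val f).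
          smul g (lookup (val f) v) (bracket g x (removed v J)))"
        by (rule sum.cong[OF refl]) (simp add: bracket_smul_right xs rs)
      finally have "coord (bracket g x ?Y) (n - 1) = (\<Sum>v\<in>keys (val f).
          coord (smul g (lookup (val f) v) (bracket g x (removed v J))) (n - 1))"
        by (simp only:) (rule coord_sum', auto intro!: sspace_smul bracket_sspace xs rs)
      also have "\<dots> = (\<Sum>v\<in>keys (val f).
          lookup (val f) v * coord (bracket g x (removed v J)) (n - 1))"
        by (rule sum.cong[OF refl]) (simp add: coord_smul bracket_sspace xs rs)
      finally show ?thesis by simp
    qed
    finally show ?thesis by simp
  qed
  then have "?Y = 0" using nondegenerate[OF Yp] by blast
  \<comment> \<open>By \<open>removed_coord_head\<close> only the word \<open>w\<close> contributes
    to this coordinate.\<close>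
  then have "0 = coord ?Y i" by simp
  also have "\<dots> = (\<Sum>v\<in>keys (val f).
      coord (smul g (lookup (val f) v) (removed v J)) i)"
    by (rule coord_sum') (auto intro!: sspace_smul part_sspace[OF rp])
  also have "\<dots> = (\<Sum>v\<in>keys (val f).
      if v = w then lookup (val f) w else 0)"
    by (rule sum.cong[OF refl])
       (use removed_coord_head[OF nw pi i(2)] wJ in \<open>auto simp: coord_smul part_sspace[OF rp]\<close>)
  also have "\<dots> = lookup (val f) w" using w(1) by simp
  finally show False using w(1) by (simp add: in_keys_iff)
qed

end

section \<open>The center\<close>

context based_superalgebra
begin

abbreviation cls :: "('a fmon \<Rightarrow>\<^sub>0 'k) \<Rightarrow> ('a fmon \<Rightarrow>\<^sub>0 'k) set" where
  "cls \<equiv> uea_class g"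

sublocale U: ring "uea g"
  unfolding uea_def by (rule ideal.quotient_is_ring[OF ideal_I])

lemma cls_hom: "cls \<in> ring_hom FA (uea g)"
  using ideal.rcos_ring_hom[OF ideal_I] by (simp add: uea_def uea_class_def[abs_def])

lemma cls_closed: "f \<in> C \<Longrightarrow> cls f \<in> carrier (uea g)"
  using ring_hom_closed[OF cls_hom] .

lemma carrier_uea: "carrier (uea g) = cls ` C"
  by (auto simp: uea_def FactRing_def A_RCOSETS_def' uea_class_def)

lemma cls_add: "f \<in> C \<Longrightarrow> h \<in> C \<Longrightarrow> cls f \<oplus>\<^bsub>uea g\<^esub> cls h = cls (f + h)"
  using ring_hom_add[OF cls_hom, of f h] by simp

lemma cls_mult: "f \<in> C \<Longrightarrow> h \<in> C \<Longrightarrow> cls f \<otimes>\<^bsub>uea g\<^esub> cls h = cls (f * h)"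
  using ring_hom_mult[OF cls_hom, of f h] by simp

lemma cls_one: "\<one>\<^bsub>uea g\<^esub> = cls 1"
  using ring_hom_one[OF cls_hom] by simp

lemma cls_zero: "\<zero>\<^bsub>uea g\<^esub> = cls 0"
  using ring_hom_zero[OF cls_hom FA.ring_axioms U.ring_axioms] by simp

lemma cls_uminus: "f \<in> C \<Longrightarrow> \<ominus>\<^bsub>uea g\<^esub> cls f = cls (- f)"
  by (rule U.minus_equality) (simp_all add: cls_add cls_zero C_closed cls_closed)

lemma cls_diff: "f \<in> C \<Longrightarrow> h \<in> C \<Longrightarrow> cls f \<ominus>\<^bsub>uea g\<^esub> cls h = cls (f - h)"
  by (simp add: a_minus_def cls_uminus cls_add C_closed)

lemma cls_power: "f \<in> C \<Longrightarrow> cls f [^]\<^bsub>uea g\<^esub> (k::nat) = cls (f ^ k)"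
  by (induction k) (simp_all add: cls_one cls_mult C_power power_commutes)

lemma cls_finsum: "(\<And>a. a \<in> A \<Longrightarrow> f a \<in> C) \<Longrightarrow> (\<Oplus>\<^bsub>uea g\<^esub>a\<in>A. cls (f a)) = cls (\<Sum>a\<in>A. f a)"
proof (induction A rule: infinite_finite_induct)
  case (insert a A)
  then have "(\<lambda>a. cls (f a)) \<in> A \<rightarrow> carrier (uea g)" "cls (f a) \<in> carrier (uea g)"
    by (auto intro: cls_closed)
  then show ?case using insert by (simp add: U.finsum_insert cls_add C_sum)
qed (simp_all add: U.finsum_infinite cls_zero)

lemma cls_eq_iff: "f \<in> C \<Longrightarrow> h \<in> C \<Longrightarrow> cls f = cls h \<longleftrightarrow> val f = val h"
proof -
  assume f: "f \<in> C" and h: "h \<in> C"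
  have c: "cls k = {i + k | i. i \<in> I}" for k
    by (auto simp: uea_class_def a_r_coset_def')
  have "cls f = cls h \<longleftrightarrow> eqv f h"
  proof
    assume "cls f = cls h"
    moreover have "f \<in> cls f" using I_zero by (force simp: c)
    ultimately show "eqv f h" by (auto simp: c eqv_def)
  next
    assume e: "eqv f h"
    have "i + f = (i + (f - h)) + h" "i + h = (i - (f - h)) + f" for i by simp_all
    then show "cls f = cls h"
      using e I_add I_diff unfolding c eqv_def by blast
  qed
  then show ?thesis using eqv_iff[OF f h] by simp
qed

lemma cls_nf: "f \<in> C \<Longrightarrow> cls (nf (val f)) = cls f"
  by (simp add: cls_eq_iff nf_C NP_val val_nf)

section \<open>Parity components\<close>

definition homog :: "bool \<Rightarrow> (nat list \<Rightarrow>\<^sub>0 'k) set" where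
  "homog e = {p \<in> NP. \<forall>w\<in>keys p. parity w = e}"

definition proj :: "bool \<Rightarrow> (nat list \<Rightarrow>\<^sub>0 'k) \<Rightarrow> (nat list \<Rightarrow>\<^sub>0 'k)" where
  "proj e p = lin (\<lambda>w. if parity w = e then single w 1 else 0) p"

lemma homog_zero [simp]: "0 \<in> homog e"
  by (simp add: homog_def)

lemma homog_add: "p \<in> homog e \<Longrightarrow> q \<in> homog e \<Longrightarrow> p + q \<in> homog e"
  using keys_add[of p q] by (auto simp: homog_def NP_add)

lemma homog_scl: "p \<in> homog e \<Longrightarrow> scl c p \<in> homog e"
  using keys_scl_subset[of c p] by (auto simp: homog_def NP_scl)

lemma homog_diff: "p \<in> homog e \<Longrightarrow> q \<in> homog e \<Longrightarrow> p - q \<in> homog e"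
  using homog_add[of p e "scl (- 1) q"] homog_scl[of q e "- 1"] by simp

lemma homog_sum: "(\<And>a. a \<in> A \<Longrightarrow> f a \<in> homog e) \<Longrightarrow> sum f A \<in> homog e"
  by (induction A rule: infinite_finite_induct) (auto simp: homog_add)

lemma homog_op:
  assumes "x \<in> part g d" "p \<in> homog e"
  shows "op x p \<in> homog (d \<noteq> e)"
  unfolding op_def lin_def
proof (rule homog_sum, rule homog_scl)
  fix w assume "w \<in> keys p"
  then have w: "normal w" "parity w = e" using assms(2) by (auto simp: homog_def NP_def)
  show "rho x w \<in> homog (d \<noteq> e)"
    unfolding rho_def
  proof (rule homog_sum)
    fix i assume i: "i \<in> {..<n}"
    show "scl (coord x i) (act i w) \<in> homog (d \<noteq> e)"
    proof (cases "coord x i = 0")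
      case False
      then have "par i = d" using coord_part assms(1) i by blast
      moreover have "act i w \<in> NP" "keys (act i w) \<subseteq> reach i w"
        using i w keys_act NP_act by auto
      ultimately have "act i w \<in> homog (d \<noteq> e)"
        using w unfolding homog_def reach_def by fastforce
      then show ?thesis by (rule homog_scl)
    qed simp
  qed
qed

lemma homog_single_Nil: "single [] 1 \<in> homog False"
  by (simp add: homog_def)

lemma lookup_proj: "lookup (proj e p) w = (if parity w = e then lookup p w else 0)"
proof -
  have "lookup (proj e p) w = (\<Sum>v\<in>keys p.
      if v = w then (if parity w = e then lookup p w else 0) else 0)"
    unfolding proj_def lookup_lin by (rule sum.cong) (auto simp: lookup_single when_def)
  then show ?thesis by (auto simp: in_keys_iff)
qed

lemma proj_homog: "p \<in> NP \<Longrightarrow> proj e p \<in> homog e"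
  by (auto simp: homog_def NP_def in_keys_iff lookup_proj split: if_splits)

lemma proj_sum: "p = proj e p + proj (\<not> e) p"
  by (rule poly_mapping_eqI) (auto simp: lookup_add lookup_proj)

lemma proj_same: "p \<in> homog e \<Longrightarrow> proj e p = p"
  by (rule poly_mapping_eqI) (auto simp: lookup_proj homog_def in_keys_iff)

lemma proj_other: "p \<in> homog e \<Longrightarrow> d \<noteq> e \<Longrightarrow> proj d p = 0"
  by (rule poly_mapping_eqI) (auto simp: lookup_proj homog_def in_keys_iff)

lemma proj_add: "proj e (p + q) = proj e p + proj e q"
  by (simp add: proj_def lin_add)

lemma homog_NP: "p \<in> homog e \<Longrightarrow> p \<in> NP"
  by (simp add: homog_def)

lemma homog_disjoint: "p \<in> homog e \<Longrightarrow> q \<in> homog (\<not> e) \<Longrightarrow> p + q = 0 \<Longrightarrow> p = 0 \<and> q = 0"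
  using proj_add[of e p q] proj_same[of p e] proj_other[of q "\<not> e" e]
  by (simp add: proj_def)

lemma val_homog_word:
  "list_all2 (\<lambda>x d. x \<in> part g d) xs ds \<Longrightarrow>
    foldr op xs (single [] 1) \<in> homog (odd (count_list ds True))"
proof (induction xs ds rule: list_all2_induct)
  case (Cons x xs d ds)
  have "odd (count_list (d # ds) True) = (d \<noteq> odd (count_list ds True))" by (cases d) auto
  then show ?case using homog_op[OF Cons.hyps(1) Cons.IH] by simp
qed (simp add: homog_single_Nil)

text \<open>The action respects parity, so a combination of words of parity \<open>e\<close> has a
  homogeneous normal form. Conversely \<open>nf\<close> turns a homogeneous normal form into a
  combination of words in homogeneous letters of the right total parity.\<close>

lemma uea_part_iff: "f \<in> C \<Longrightarrow> cls f \<in> uea_part g e \<longleftrightarrow> val f \<in> homog e"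
proof
  assume f: "f \<in> C" and "cls f \<in> uea_part g e"
  then obtain h where h: "cls f = cls h"
      "\<And>w. w \<in> keys h \<Longrightarrow> \<exists>ds. list_all2 (\<lambda>x d. x \<in> part g d) (letters w) ds
        \<and> odd (count_list ds True) = e"
    unfolding uea_part_def by auto
  have "h \<in> C"
    unfolding carrier_free_algebra
  proof (intro CollectI ballI subsetI)
    fix w x assume "w \<in> keys h" "x \<in> set (letters w)"
    then show "x \<in> sspace g"
      using h(2)[of w] part_sspace by (fastforce simp: list_all2_conv_all_nth in_set_conv_nth)
  qed
  moreover have "val h \<in> homog e"
    unfolding val_def eval_def lin_def
    by (intro homog_sum homog_scl) (use h(2) val_homog_word in blast)
  ultimately show "val f \<in> homog e" using h(1) f by (simp add: cls_eq_iff)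
next
  assume f: "f \<in> C" and v: "val f \<in> homog e"
  have "keys (nf (val f)) \<subseteq> (\<lambda>w. FMon (map b w)) ` keys (val f)"
    unfolding nf_def by (rule keys_lin_subset) (auto simp: mon_def)
  moreover have "list_all2 (\<lambda>x d. x \<in> part g d) (map b w) (map par w)
      \<and> odd (count_list (map par w) True) = e" if "w \<in> keys (val f)" for w
  proof -
    have w: "normal w" "parity w = e" using v that by (auto simp: homog_def NP_def)
    have "odd (count_list (map par w) True) = parity w" by (induction w) auto
    moreover have "list_all2 (\<lambda>x d. x \<in> part g d) (map b w) (map par w)"
      using w(1) by (induction w) (auto simp: normal_Cons b_part)
    ultimately show ?thesis using w(2) by simp
  qed
  ultimately have "cls (nf (val f)) \<in> uea_part g e"
    unfolding uea_part_def by (intro imageI CollectI ballI) fastforce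
  then show "cls f \<in> uea_part g e" using cls_nf[OF f] by simp
qed

lemma uea_part_carrier:
  assumes "u \<in> uea_part g e"
  obtains f where "f \<in> C" "u = cls f" "val f \<in> homog e"
proof -
  obtain h where h: "u = cls h" "\<And>w. w \<in> keys h \<Longrightarrow>
      \<exists>ds. list_all2 (\<lambda>x d. x \<in> part g d) (letters w) ds"
    using assms unfolding uea_part_def by blast
  have "h \<in> C"
    unfolding carrier_free_algebra
  proof (intro CollectI ballI subsetI)
    fix w x assume "w \<in> keys h" "x \<in> set (letters w)"
    then show "x \<in> sspace g"
      using h(2)[of w] part_sspace by (fastforce simp: list_all2_conv_all_nth in_set_conv_nth)
  qed
  then show ?thesis using that[of h] h(1) assms uea_part_iff by blast
qed

definition comp :: "bool \<Rightarrow> ('a fmon \<Rightarrow>\<^sub>0 'k) \<Rightarrow> ('a fmon \<Rightarrow>\<^sub>0 'k)" where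
  "comp e f = nf (proj e (val f))"

lemma comp_C: "comp e f \<in> C"
  unfolding comp_def by (rule nf_C[OF homog_NP[OF proj_homog[OF NP_val]]])

lemma val_comp: "val (comp e f) = proj e (val f)"
  unfolding comp_def by (rule val_nf[OF homog_NP[OF proj_homog[OF NP_val]]])

text \<open>Uniqueness in the definite description is read off from normal forms: each normal word
  has one parity, so the two parts have a direct sum there.\<close>

lemma uea_component_cls:
  assumes f: "f \<in> C"
  shows "uea_component g e (cls f) = cls (comp e f)"
  unfolding uea_component_def
proof (rule the_equality)
  have h: "cls (comp d f) \<in> uea_part g d" for d
    using uea_part_iff[OF comp_C] by (simp add: val_comp proj_homog NP_val)
  have "cls f = cls (comp e f) \<oplus>\<^bsub>uea g\<^esub> cls (comp (\<not> e) f)"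
    using proj_sum[of "val f" e] f
    by (simp add: cls_add comp_C cls_eq_iff C_closed val_add val_comp)
  then show "cls (comp e f) \<in> uea_part g e \<and> (\<exists>w\<in>uea_part g (\<not> e). cls f = cls (comp e f) \<oplus>\<^bsub>uea g\<^esub> w)"
    using h by blast
next
  fix v assume "v \<in> uea_part g e \<and> (\<exists>w\<in>uea_part g (\<not> e). cls f = v \<oplus>\<^bsub>uea g\<^esub> w)"
  then obtain w where vw: "v \<in> uea_part g e" "w \<in> uea_part g (\<not> e)" "cls f = v \<oplus>\<^bsub>uea g\<^esub> w" by blast
  obtain h where h: "h \<in> C" "v = cls h" "val h \<in> homog e" using uea_part_carrier[OF vw(1)] .
  obtain k where k: "k \<in> C" "w = cls k" "val k \<in> homog (\<not> e)" using uea_part_carrier[OF vw(2)] .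
  have "val f = val h + val k"
    using vw(3) f h k by (simp add: cls_add cls_eq_iff C_closed val_add)
  then have "proj e (val f) = val h"
    using h(3) k(3) proj_other[of "val k" "\<not> e" e] by (simp add: proj_add proj_same)
  then show "v = cls (comp e f)"
    using h by (simp add: cls_eq_iff comp_C val_comp)
qed

lemma part_direct': "x \<in> part g e \<Longrightarrow> x \<in> part g (\<not> e) \<Longrightarrow> x = 0"
  using part_direct by (cases e) auto

lemma lsa_component_sum:
  assumes "y \<in> part g e" "z \<in> part g (\<not> e)"
  shows "lsa_component g e (y + z) = y"
  unfolding lsa_component_def
proof (rule the_equality)
  show "y \<in> part g e \<and> (\<exists>z'\<in>part g (\<not> e). y + z = y + z')" using assms by blast
next
  fix y' assume "y' \<in> part g e \<and> (\<exists>z'\<in>part g (\<not> e). y + z = y' + z')"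
  then obtain z' where z': "y' \<in> part g e" "z' \<in> part g (\<not> e)" "y + z = y' + z'" by blast
  have "y' - y = z - z'" using z'(3) by (simp add: algebra_simps)
  moreover have "y' - y \<in> part g e" "z - z' \<in> part g (\<not> e)" using assms z' part_diff by auto
  ultimately have "y' - y = 0" using part_direct' by metis
  then show "y' = y" by simp
qed

lemma lsa_component_part: "x \<in> part g d \<Longrightarrow> lsa_component g e x = (if d = e then x else 0)"
  using lsa_component_sum[of x e 0] lsa_component_sum[of 0 e x] part_zero by (cases "d = e") auto

lemma ad_homogeneous_cls:
  assumes "y \<in> sspace g" "h \<in> C"
  shows "ad_homogeneous g e d y (cls h) = cls (gen y * h - scl (koszul e d) (h * gen y))"
  using assms
  by (simp add: ad_homogeneous_def uea_gen_def uea_scalar_def cls_mult cls_diff C_closed const_mult)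

lemma lsa_component_sspace: "x \<in> sspace g \<Longrightarrow> lsa_component g e x \<in> part g e"
proof -
  assume "x \<in> sspace g"
  then obtain y z where x: "x = y + z" "y \<in> part g False" "z \<in> part g True" by (auto simp: sspace_def)
  then show ?thesis
    using lsa_component_sum[of y False z] lsa_component_sum[of z True y]
    by (cases e) (auto simp: add.commute)
qed

lemma ad_cls:
  assumes f: "f \<in> C" and x: "x \<in> sspace g"
  shows "ad g x (cls f) = cls (\<Sum>e\<in>UNIV. \<Sum>d\<in>UNIV. gen (lsa_component g e x) * comp d f
      - scl (koszul e d) (comp d f * gen (lsa_component g e x)))"
proof -
  have s: "lsa_component g e x \<in> sspace g" for e
    using lsa_component_sspace[OF x] part_sspace by blast
  have c: "gen (lsa_component g e x) * comp d f
      - scl (koszul e d) (comp d f * gen (lsa_component g e x)) \<in> C" for e d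
    by (intro C_closed comp_C s)
  show ?thesis
    unfolding ad_def uea_component_cls[OF f] ad_homogeneous_cls[OF s comp_C]
    by (simp add: cls_finsum c C_sum)
qed

lemma val_zero [simp]: "val 0 = 0"
  by (simp add: val_def)

lemma val_sum: "val (sum f A) = (\<Sum>a\<in>A. val (f a))"
  by (simp add: val_def eval_sum)

lemma val_gen_zero [simp]: "val (gen 0 * f) = 0" "val (f * gen 0) = 0"
proof -
  have "val (gen 0) = 0" by (simp add: val_def)
  then show "val (gen 0 * f) = 0" "val (f * gen 0) = 0" by (simp_all add: val_mult)
qed

lemma homog_comp: "val (comp d f) \<in> homog d"
  by (simp add: val_comp proj_homog NP_val)

lemma eval_homog:
  assumes "h \<in> C" "val h \<in> homog d" "p \<in> homog e"
  shows "eval h p \<in> homog (d \<noteq> e)"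
proof -
  have "eval (mon w) p \<in> homog (parity w \<noteq> e)" if "normal w" for w
    using that
  proof (induction w)
    case (Cons i w)
    then have "op (b i) (eval (mon w) p) \<in> homog (par i \<noteq> (parity w \<noteq> e))"
      by (intro homog_op b_part) (auto simp: normal_Cons)
    then show ?case by (cases "par i"; cases "parity w"; cases e) (simp_all add: eval_mon_Cons)
  qed (use assms in simp)
  then show ?thesis
    unfolding eval_nf[OF assms(1) homog_NP[OF assms(3)]] lin_def
    by (intro homog_sum homog_scl) (use assms(2) in \<open>auto simp: homog_def NP_def\<close>)
qed

lemma val_gen: "x \<in> part g d \<Longrightarrow> val (gen x) \<in> homog d"
  unfolding val_def eval_gen using homog_op[OF _ homog_single_Nil] by auto

text \<open>The contributions of the even and the odd component of \<open>f\<close> to the adjoint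
  action have opposite parities, so both vanish.\<close>

lemma center_supercommute:
  assumes f: "f \<in> C" and z: "cls f \<in> center g" and x: "x \<in> part g e"
  shows "val (gen x * comp d f) = scl (koszul e d) (val (comp d f * gen x))"
proof -
  let ?t = "\<lambda>d. gen x * comp d f - scl (koszul e d) (comp d f * gen x)"
  note xs = part_sspace[OF x]
  have s: "lsa_component g e' x \<in> sspace g" for e'
    using lsa_component_sspace[OF xs] part_sspace by blast
  have t: "val (?t d) \<in> homog (e \<noteq> d)" for d
  proof -
    have "val (gen x * comp d f) \<in> homog (e \<noteq> d)"
      unfolding val_mult eval_gen by (rule homog_op[OF x homog_comp])
    moreover have "val (comp d f * gen x) \<in> homog (e \<noteq> d)"
      unfolding val_mult using eval_homog[OF comp_C homog_comp val_gen[OF x]] by (simp add: eq_commute)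
    ultimately show ?thesis
      by (simp only: val_diff val_scl homog_diff homog_scl)
  qed
  have "cls 0 = ad g x (cls f)"
    using z xs by (simp add: center_def cls_zero)
  also have "\<dots> = cls (\<Sum>e'\<in>UNIV. \<Sum>d\<in>UNIV. gen (lsa_component g e' x) * comp d f
      - scl (koszul e' d) (comp d f * gen (lsa_component g e' x)))"
    by (rule ad_cls[OF f xs])
  finally have "0 = val (\<Sum>e'\<in>UNIV. \<Sum>d\<in>UNIV. gen (lsa_component g e' x) * comp d f
      - scl (koszul e' d) (comp d f * gen (lsa_component g e' x)))"
    using s by (subst (asm) cls_eq_iff) (auto intro!: C_closed C_sum comp_C)
  also have "\<dots> = val (?t False) + val (?t True)"
    by (cases e) (simp_all add: UNIV_bool lsa_component_part[OF x] val_add val_diff val_scl)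
  finally have "val (?t d) + val (?t (\<not> d)) = 0" by (cases d) (simp_all add: add.commute)
  moreover have "val (?t (\<not> d)) \<in> homog (\<not> (e \<noteq> d))" using t[of "\<not> d"] by (cases e; cases d) auto
  ultimately have "val (?t d) = 0" using homog_disjoint[OF t[of d]] by blast
  then show ?thesis by (simp add: val_diff val_scl)
qed

text \<open>Representatives of the even elements that commute with \<open>g\<close> in the ordinary
  sense; for even elements this is the same as supercommuting. That they give the whole center is
  \<open>center_eq\<close>.\<close>

definition cen :: "('a fmon \<Rightarrow>\<^sub>0 'k) set" where
  "cen = {f \<in> C. val f \<in> homog False \<and> (\<forall>x\<in>sspace g. val (gen x * f) = val (f * gen x))}"

lemma cen_center: "f \<in> cen \<Longrightarrow> cls f \<in> center g"
proof -
  assume "f \<in> cen"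
  then have f: "f \<in> C" and v: "val f \<in> homog False"
      and c: "\<And>x. x \<in> sspace g \<Longrightarrow> val (gen x * f) = val (f * gen x)" by (auto simp: cen_def)
  have "ad g x (cls f) = cls 0" if x: "x \<in> sspace g" for x
  proof -
    have s: "lsa_component g e x \<in> sspace g" for e
      using lsa_component_sspace[OF x] part_sspace by blast
    have v0: "val (comp False f) = val f" and v1: "val (comp True f) = 0"
      using proj_same[OF v] proj_other[OF v, of True] by (simp_all add: val_comp)
    have "val (gen y * comp d f - scl (koszul e d) (comp d f * gen y)) = 0" if y: "y \<in> sspace g" for y e d
    proof (cases d)
      case True
      have "eval (comp True f) (val (gen y)) = eval 0 (val (gen y))"
        by (rule eval_cong[OF comp_C C_closed(7) _ NP_val]) (simp add: v1)
      then show ?thesis using True by (simp add: val_diff val_scl val_mult v1)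
    next
      case False
      have "eval (comp False f) (val (gen y)) = eval f (val (gen y))"
        by (rule eval_cong[OF comp_C f v0 NP_val])
      then show ?thesis
        using False c[OF y] by (simp add: val_diff val_scl val_mult v0)
    qed
    then have "val (\<Sum>e\<in>UNIV. \<Sum>d\<in>UNIV. gen (lsa_component g e x) * comp d f
        - scl (koszul e d) (comp d f * gen (lsa_component g e x))) = 0"
      using s by (simp add: val_sum)
    then show ?thesis
      unfolding ad_cls[OF f x] using s
      by (subst cls_eq_iff) (auto intro!: C_closed C_sum comp_C)
  qed
  then show ?thesis using f by (simp add: center_def cls_closed cls_zero)
qed

text \<open>\<open>f\<close> passes through the letters of \<open>h\<close> one at a time; each step
  is a congruence modulo the ideal, which normal forms do not see.\<close>

lemma cen_commute:
  assumes f: "f \<in> cen" and h: "h \<in> C"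
  shows "val (f * h) = val (h * f)"
proof -
  have fC: "f \<in> C" using f by (simp add: cen_def)
  have W: "eval f (foldr op xs (single [] 1)) = foldr op xs (val f)"
    if "set xs \<subseteq> sspace g" for xs
    using that
  proof (induction xs)
    case (Cons x xs)
    let ?p = "foldr op xs (single [] 1)"
    have "eqv (gen x * f) (f * gen x)"
      using Cons.prems f fC by (subst eqv_iff) (auto simp: cen_def C_closed)
    then have "eval (gen x * f) ?p = eval (f * gen x) ?p"
      using eval_ideal[of "gen x * f - f * gen x" ?p] NP_foldr_op[of "single [] 1" xs]
      by (simp add: eqv_def eval_diff)
    then show ?case using Cons by (simp add: eval_mult)
  qed (simp add: val_def)
  have "val (f * h) = lin (\<lambda>w. eval f (foldr op (letters w) (single [] 1))) h"
    by (simp add: val_def eval_mult eval_def[of h] eval_lin)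
  also have "\<dots> = lin (\<lambda>w. foldr op (letters w) (val f)) h"
    by (rule lin_cong) (use h W in \<open>auto simp: carrier_free_algebra\<close>)
  also have "\<dots> = val (h * f)"
    by (simp add: val_mult eval_def)
  finally show ?thesis .
qed

end

section \<open>Central elements are even and regular\<close>

context nondegenerate_superalgebra
begin

text \<open>If the odd component of a central element were nonzero, its leading word would consist
  of even letters by \<open>supercentral_leading_even\<close> and thus have even parity.\<close>

lemma center_eq: "center g = cls ` cen"
proof (intro equalityI subsetI)
  fix u assume u: "u \<in> center g"
  then obtain f where f: "f \<in> C" "u = cls f"
    by (auto simp: center_def carrier_uea)
  note comm = center_supercommute[OF f(1) u[unfolded f(2)]]
  have "val (comp True f) = 0"
  proof (rule ccontr)
    assume nz: "val (comp True f) \<noteq> 0"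
    then have "keys (val (comp True f)) \<noteq> {}" by (metis keys_eq_empty)
    then obtain w where w: "w \<in> keys (val (comp True f))"
        "\<And>v. v \<in> keys (val (comp True f)) \<Longrightarrow> weight v \<le> weight w"
      using finite_max_ex[OF finite_keys, of _ weight] by metis
    have p: "parity v = True" if "v \<in> keys (val (comp True f))" for v
      using homog_comp[of True f] that by (auto simp: homog_def)
    have "\<forall>i\<in>set w. \<not> par i"
      by (rule supercentral_leading_even[OF comp_C p comm w])
    then have "\<not> parity w" by (induction w) auto
    then show False using p[OF w(1)] by simp
  qed
  then have p1: "proj True (val f) = 0" by (simp add: val_comp)
  then have p0: "proj False (val f) = val f" using proj_sum[of "val f" True] by simp
  have hf: "val f \<in> homog False" using proj_homog[OF NP_val, of False f] p0 by simp
  have vc: "val (comp False f) = val f" by (simp add: val_comp p0)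
  have c: "val (gen x * f) = val (f * gen x)" if x: "x \<in> part g e" for x e
  proof -
    have "eval (comp False f) (val (gen x)) = eval f (val (gen x))"
      by (rule eval_cong[OF comp_C f(1) vc NP_val])
    then show ?thesis using comm[OF x, of False] by (simp add: val_mult vc)
  qed
  have "val (gen x * f) = val (f * gen x)" if xs: "x \<in> sspace g" for x
  proof -
    obtain y z where x: "x = y + z" "y \<in> part g False" "z \<in> part g True"
      using xs by (auto simp: sspace_def)
    have ys: "y \<in> sspace g" and zs: "z \<in> sspace g" using x part_sspace by auto
    have "val (gen (y + z)) = val (gen y) + val (gen z)"
      by (simp add: val_def rho_add[OF ys zs])
    then show ?thesis
      using c[OF x(2)] c[OF x(3)]
      by (simp add: val_mult op_add_left[OF ys zs] x(1) eval_add_right)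
  qed
  then show "u \<in> cls ` cen" using f hf by (auto simp: cen_def)
qed (use cen_center in blast)

lemma center_even: "center g \<subseteq> uea_part g False"
  unfolding center_eq using uea_part_iff by (auto simp: cen_def)

text \<open>Central elements commute with everything, so products on either side vanish together;
  the leading words consist of even letters, and \<open>eval_nonzero\<close> applies.\<close>

lemma center_not_zero_divisor:
  assumes "z \<in> center g" "z \<noteq> \<zero>\<^bsub>uea g\<^esub>"
  shows "\<not> zero_divisor (uea g) z"
proof
  obtain f where f: "f \<in> cen" "z = cls f" using assms(1) center_eq by auto
  then have fC: "f \<in> C" and fh: "val f \<in> homog False"
      and fc: "\<And>x. x \<in> sspace g \<Longrightarrow> val (gen x * f) = val (f * gen x)" by (auto simp: cen_def)
  have nz: "val f \<noteq> 0"
    using assms(2) f fC cls_eq_iff[of f 0] by (auto simp: cls_zero C_closed val_def)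
  assume "zero_divisor (uea g) z"
  then obtain h where h: "h \<in> C" "cls h \<noteq> cls 0"
      "cls f \<otimes>\<^bsub>uea g\<^esub> cls h = cls 0 \<or> cls h \<otimes>\<^bsub>uea g\<^esub> cls f = cls 0"
    unfolding zero_divisor_def carrier_uea cls_zero f(2) by auto
  then have "val (f * h) = 0"
    using fC cen_commute[OF f(1) h(1)] by (auto simp: cls_mult cls_eq_iff C_closed val_def)
  moreover have "val h \<noteq> 0"
    using h(1,2) cls_eq_iff[of h 0] by (auto simp: C_closed val_def)
  moreover have "eval f (val h) \<noteq> 0"
  proof (rule eval_nonzero[OF fC NP_val \<open>val h \<noteq> 0\<close> nz])
    fix w assume w: "w \<in> keys (val f)"
      "\<And>v. v \<in> keys (val f) \<Longrightarrow> weight v \<le> weight w"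
    show "\<forall>i\<in>set w. \<not> par i"
    proof (rule supercentral_leading_even[OF fC _ _ w])
      show "parity v = False" if "v \<in> keys (val f)" for v
        using fh that by (auto simp: homog_def)
      show "val (gen x * f) = scl (koszul True False) (val (f * gen x))" if "x \<in> part g True" for x
        using fc part_sspace[OF that] by simp
    qed
  qed
  ultimately show False by (simp add: val_mult)
qed

end

section \<open>Finiteness over the p-center\<close>

interpretation pm: operator_space "scl :: 'k::field \<Rightarrow> ('w \<Rightarrow>\<^sub>0 'k) \<Rightarrow> ('w \<Rightarrow>\<^sub>0 'k)"
  by unfold_locales

lemma pascal_sum:
  fixes f :: "nat \<Rightarrow> ('w \<Rightarrow>\<^sub>0 'k::field)"
  shows "(\<Sum>j\<le>k. scl (of_nat (k choose j)) (f j)) + (\<Sum>j\<le>k. scl (of_nat (k choose j)) (f (Suc j)))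
    = (\<Sum>j\<le>Suc k. scl (of_nat (Suc k choose j)) (f j))"
proof -
  have "(\<Sum>j\<le>k. scl (of_nat (k choose j)) (f j)) = (\<Sum>j\<le>Suc k. scl (of_nat (k choose j)) (f j))"
    by (simp add: binomial_eq_0)
  also have "\<dots> = f 0 + (\<Sum>j\<le>k. scl (of_nat (k choose Suc j)) (f (Suc j)))"
    by (subst sum.atMost_Suc_shift) simp
  finally have "(\<Sum>j\<le>k. scl (of_nat (k choose j)) (f j))
      = f 0 + (\<Sum>j\<le>k. scl (of_nat (k choose Suc j)) (f (Suc j)))" .
  moreover have "(\<Sum>j\<le>Suc k. scl (of_nat (Suc k choose j)) (f j))
      = f 0 + (\<Sum>j\<le>k. scl (of_nat (Suc k choose Suc j)) (f (Suc j)))"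
    by (subst sum.atMost_Suc_shift) simp
  ultimately show ?thesis
    by (simp add: pm.scale_left_distrib sum.distrib algebra_simps)
qed

lemma sorted_split:
  fixes w :: "nat list"
  shows "sorted w \<Longrightarrow>
    w = filter (\<lambda>j. j < i) w @ replicate (count_list w i) i @ filter (\<lambda>j. i < j) w"
proof (induction w)
  case (Cons j w)
  consider "j < i" | "j = i" | "i < j" by linarith
  then show ?case
  proof cases
    case 2
    then have "filter (\<lambda>j. j < i) w = []" using Cons.prems by (auto simp: filter_empty_conv)
    then show ?thesis using Cons 2 by simp
  next
    case 3
    then have "filter (\<lambda>j. j < i) w = []" "i \<notin> set w" "filter (\<lambda>j. i < j) w = w"
      using Cons.prems by (fastforce simp: filter_empty_conv filter_id_conv)+
    then show ?thesis using 3 by simp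
  qed (use Cons in auto)
qed simp

text \<open>Provides the factor \<open>b_i^p\<close> in a word in which \<open>i\<close> occurs at
  least \<open>p\<close> times.\<close>

lemma sorted_block:
  fixes w :: "nat list"
  assumes "sorted w" "k \<le> count_list w i"
  obtains u v where "w = u @ replicate k i @ v"
proof -
  have "replicate (count_list w i) i = replicate k i @ replicate (count_list w i - k) i"
    using assms(2) by (simp add: replicate_add[symmetric])
  then show ?thesis
    using that[of "filter (\<lambda>j. j < i) w" "replicate (count_list w i - k) i @ filter (\<lambda>j. i < j) w"]
      sorted_split[OF assms(1), of i] by simp
qed

section \<open>Linear combinations over a subring\<close>

context ring
begin

text \<open>Indexing by a family serves both finite generation, with \<open>s\<close> the identity,
  and the powers of a single element, which need not be distinct.\<close>

definition lincomb :: "'a set \<Rightarrow> 'i set \<Rightarrow> ('i \<Rightarrow> 'a) \<Rightarrow> 'a set" where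
  "lincomb A K s = {(\<Oplus>i\<in>K. c i \<otimes> s i) | c. c \<in> K \<rightarrow> A}"

lemma lincombI: "c \<in> K \<rightarrow> A \<Longrightarrow> (\<Oplus>i\<in>K. c i \<otimes> s i) \<in> lincomb A K s"
  unfolding lincomb_def by blast

lemma lincomb_closed:
  assumes A: "subring A R" and K: "finite K" "s \<in> K \<rightarrow> carrier R"
  shows "lincomb A K s \<subseteq> carrier R"
    and "x \<in> lincomb A K s \<Longrightarrow> y \<in> lincomb A K s \<Longrightarrow> x \<oplus> y \<in> lincomb A K s"
    and "a \<in> A \<Longrightarrow> x \<in> lincomb A K s \<Longrightarrow> a \<otimes> x \<in> lincomb A K s"
    and "i \<in> K \<Longrightarrow> s i \<in> lincomb A K s"
    and "\<zero> \<in> lincomb A K s"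
proof -
  note AR = subringE(1)[OF A]
  have sc: "i \<in> K \<Longrightarrow> s i \<in> carrier R" for i using K(2) by auto
  have cs: "(\<lambda>i. c i \<otimes> s i) \<in> K \<rightarrow> carrier R" if "c \<in> K \<rightarrow> A" for c
    using that AR sc by (auto intro!: m_closed)
  show "lincomb A K s \<subseteq> carrier R"
    unfolding lincomb_def using finsum_closed[OF cs] by auto
  show "x \<oplus> y \<in> lincomb A K s" if xy: "x \<in> lincomb A K s" "y \<in> lincomb A K s"
  proof -
    obtain c d where c: "c \<in> K \<rightarrow> A" "x = (\<Oplus>i\<in>K. c i \<otimes> s i)"
        and d: "d \<in> K \<rightarrow> A" "y = (\<Oplus>i\<in>K. d i \<otimes> s i)"
      using xy by (auto simp: lincomb_def)
    have "x \<oplus> y = (\<Oplus>i\<in>K. c i \<otimes> s i \<oplus> d i \<otimes> s i)"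
      using finsum_addf[OF cs[OF c(1)] cs[OF d(1)]] c d by simp
    also have "\<dots> = (\<Oplus>i\<in>K. (c i \<oplus> d i) \<otimes> s i)"
    proof (rule finsum_cong')
      show "(\<lambda>i. (c i \<oplus> d i) \<otimes> s i) \<in> K \<rightarrow> carrier R"
        using c(1) d(1) AR sc by (auto intro!: m_closed a_closed)
      show "c i \<otimes> s i \<oplus> d i \<otimes> s i = (c i \<oplus> d i) \<otimes> s i" if "i \<in> K" for i
      proof -
        have "c i \<in> carrier R" "d i \<in> carrier R" using c(1) d(1) AR that by auto
        then show ?thesis using sc[OF that] by (simp add: l_distr)
      qed
    qed simp
    finally have "x \<oplus> y = (\<Oplus>i\<in>K. (c i \<oplus> d i) \<otimes> s i)" .
    moreover have "(\<lambda>i. c i \<oplus> d i) \<in> K \<rightarrow> A"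
      using c(1) d(1) subringE(7)[OF A] by auto
    ultimately show ?thesis by (simp only: lincombI)
  qed
  show "a \<otimes> x \<in> lincomb A K s" if a: "a \<in> A" and x: "x \<in> lincomb A K s"
  proof -
    obtain c where c: "c \<in> K \<rightarrow> A" "x = (\<Oplus>i\<in>K. c i \<otimes> s i)"
      using x by (auto simp: lincomb_def)
    have aR: "a \<in> carrier R" using a AR by auto
    have "a \<otimes> x = (\<Oplus>i\<in>K. a \<otimes> (c i \<otimes> s i))"
      unfolding c(2) by (rule finsum_rdistr[OF K(1) aR cs[OF c(1)]])
    also have "\<dots> = (\<Oplus>i\<in>K. (a \<otimes> c i) \<otimes> s i)"
    proof (rule finsum_cong')
      show "(\<lambda>i. (a \<otimes> c i) \<otimes> s i) \<in> K \<rightarrow> carrier R"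
        using c(1) AR sc aR by (auto intro!: m_closed)
      show "a \<otimes> (c i \<otimes> s i) = (a \<otimes> c i) \<otimes> s i" if "i \<in> K" for i
      proof -
        have "c i \<in> carrier R" using c(1) AR that by auto
        then show ?thesis using sc[OF that] aR by (simp add: m_assoc)
      qed
    qed simp
    finally have "a \<otimes> x = (\<Oplus>i\<in>K. (a \<otimes> c i) \<otimes> s i)" .
    moreover have "(\<lambda>i. a \<otimes> c i) \<in> K \<rightarrow> A"
      using c(1) a subringE(6)[OF A] by auto
    ultimately show ?thesis by (simp only: lincombI)
  qed
  show "s i \<in> lincomb A K s" if i: "i \<in> K"
  proof -
    have "(\<Oplus>j\<in>K. (if i = j then \<one> else \<zero>) \<otimes> s j) = (\<Oplus>j\<in>K. if i = j then s j else \<zero>)"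
      by (rule finsum_cong') (use sc in auto)
    also have "\<dots> = s i"
      using i K by (intro finsum_singleton) auto
    finally have "s i = (\<Oplus>j\<in>K. (if i = j then \<one> else \<zero>) \<otimes> s j)" by simp
    moreover have "(\<lambda>j. if i = j then \<one> else \<zero>) \<in> K \<rightarrow> A"
      using subringE(2,3)[OF A] by auto
    ultimately show ?thesis by (simp only: lincombI)
  qed
  have "(\<Oplus>j\<in>K. \<zero> \<otimes> s j) = (\<Oplus>j\<in>K. \<zero>)"
    by (rule finsum_cong') (use sc in auto)
  then have "\<zero> = (\<Oplus>j\<in>K. \<zero> \<otimes> s j)" by (simp add: finsum_zero)
  moreover have "(\<lambda>j. \<zero>) \<in> K \<rightarrow> A" using subringE(2)[OF A] by auto
  ultimately show "\<zero> \<in> lincomb A K s" using lincombI[of "\<lambda>j. \<zero>" K A s] by simp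
qed

lemma lincomb_Suc:
  assumes A: "subring A R" and s: "\<And>i. s i \<in> carrier R"
  shows "lincomb A {..<k} s \<subseteq> lincomb A {..<Suc k} (s :: nat \<Rightarrow> 'a)"
proof
  fix x assume "x \<in> lincomb A {..<k} s"
  then obtain c where c: "c \<in> {..<k} \<rightarrow> A" "x = (\<Oplus>i\<in>{..<k}. c i \<otimes> s i)"
    by (auto simp: lincomb_def)
  let ?d = "c(k := \<zero>)"
  have d: "?d \<in> {..<Suc k} \<rightarrow> A"
    using c(1) subringE(2)[OF A] by (auto simp: less_Suc_eq)
  have cR: "c i \<in> carrier R" if "i < k" for i using c(1) subringE(1)[OF A] that by auto
  have "(\<Oplus>i\<in>{..<Suc k}. ?d i \<otimes> s i) = ?d k \<otimes> s k \<oplus> (\<Oplus>i\<in>{..<k}. ?d i \<otimes> s i)"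
    unfolding lessThan_Suc by (rule finsum_insert) (use s cR in auto)
  also have "(\<Oplus>i\<in>{..<k}. ?d i \<otimes> s i) = x"
    unfolding c(2) by (rule finsum_cong') (use s cR in auto)
  also have "?d k \<otimes> s k \<oplus> x = x"
    using s cR c(2) by (auto intro!: l_zero finsum_closed)
  finally show "x \<in> lincomb A {..<Suc k} s"
    unfolding lincomb_def using d by blast
qed

lemma finitely_generated_module_lincomb:
  "finite S \<Longrightarrow> S \<subseteq> M \<Longrightarrow> M = lincomb A S (\<lambda>s. s) \<Longrightarrow> finitely_generated_module R A M"
  unfolding finitely_generated_module_def lincomb_def by blast

end

section \<open>The p-center\<close>

locale restricted_nondegenerate_superalgebra =
  nondegenerate_superalgebra g n par b coord + restricted_lie_superalgebra g
  for g :: "('k::field, 'a::ab_group_add) lsa" and n par b coord +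
  assumes char_pos: "CHAR('k) > 0"
begin

lemma prime_char: "prime CHAR('k)"
  using prime_CHAR_semidom char_pos by blast

lemma eqv_gen_even:
  assumes x: "x \<in> part g False" and y: "y \<in> sspace g"
  shows "eqv (gen x * gen y) (gen y * gen x + gen (bracket g x y))"
proof -
  obtain y0 y1 where y': "y = y0 + y1" "y0 \<in> part g False" "y1 \<in> part g True"
    using y by (auto simp: sspace_def)
  note ys = y'(2,3)[THEN part_sspace] and xs = part_sspace[OF x]
  have "eqv (gen x * gen y) (gen x * (gen y0 + gen y1))"
    unfolding y'(1) by (intro eqv_mult_left eqv_gen_add ys C_closed xs)
  also have "\<dots> = gen x * gen y0 + gen x * gen y1" by (simp add: distrib_left)
  also have "eqv \<dots> ((gen y0 * gen x + gen (bracket g x y0)) + (gen y1 * gen x + gen (bracket g x y1)))"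
    using eqv_gen_swap[OF x y'(2)] eqv_gen_swap[OF x y'(3)] by (intro eqv_add) simp_all
  also have "\<dots> = (gen y0 + gen y1) * gen x + (gen (bracket g x y0) + gen (bracket g x y1))"
    by (simp add: distrib_right)
  also have "eqv \<dots> (gen y * gen x + gen (bracket g x y))"
    unfolding y'(1) bracket_add_right[OF xs ys]
    by (intro eqv_add eqv_mult_right eqv_sym[OF eqv_gen_add] ys C_closed xs bracket_sspace)
  finally show ?thesis .
qed

lemma bracket_pow_sspace: "x \<in> sspace g \<Longrightarrow> y \<in> sspace g \<Longrightarrow> (bracket g x ^^ k) y \<in> sspace g"
  by (induction k) (auto intro: bracket_sspace)

text \<open>Left multiplication by \<open>x\<close> is the sum of right multiplication by
  \<open>x\<close> and \<open>ad x\<close>, which commute; this is the binomial theorem for that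
  sum.\<close>

lemma eqv_gen_power:
  assumes x: "x \<in> part g False" and y: "y \<in> sspace g"
  shows "eqv (gen x ^ k * gen y)
    (\<Sum>j\<le>k. scl (of_nat (k choose j)) (gen ((bracket g x ^^ j) y) * gen x ^ (k - j)))"
proof (induction k)
  case (Suc k)
  note xs = part_sspace[OF x]
  define f :: "nat \<Rightarrow> 'a fmon \<Rightarrow>\<^sub>0 'k" where "f j = gen ((bracket g x ^^ j) y) * gen x ^ (Suc k - j)" for j
  have "gen x ^ Suc k * gen y = gen x * (gen x ^ k * gen y)" by (simp add: mult.assoc)
  also have "eqv \<dots> (gen x *
      (\<Sum>j\<le>k. scl (of_nat (k choose j)) (gen ((bracket g x ^^ j) y) * gen x ^ (k - j))))"
    by (rule eqv_mult_left[OF Suc]) (intro C_closed xs)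
  also have "\<dots> = (\<Sum>j\<le>k. scl (of_nat (k choose j))
      (gen x * gen ((bracket g x ^^ j) y) * gen x ^ (k - j)))"
    by (simp add: sum_distrib_left const_commute mult.assoc)
  also have "eqv \<dots> (\<Sum>j\<le>k. scl (of_nat (k choose j)) (f j + f (Suc j)))"
  proof (intro eqv_sum eqv_scl)
    fix j assume j: "j \<in> {..k}"
    have "eqv (gen x * gen ((bracket g x ^^ j) y) * gen x ^ (k - j))
        ((gen ((bracket g x ^^ j) y) * gen x + gen (bracket g x ((bracket g x ^^ j) y))) * gen x ^ (k - j))"
      by (intro eqv_mult_right eqv_gen_even x bracket_pow_sspace xs y C_power C_closed)
    also have "\<dots> = f j + f (Suc j)"
      using j by (simp add: f_def distrib_right mult.assoc Suc_diff_le)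
    finally show "eqv (gen x * gen ((bracket g x ^^ j) y) * gen x ^ (k - j)) (f j + f (Suc j))" .
  qed
  also have "\<dots> = (\<Sum>j\<le>Suc k. scl (of_nat (Suc k choose j)) (f j))"
    by (simp only: pascal_sum[symmetric] pm.scale_right_distrib sum.distrib)
  finally show ?case by (simp only: f_def)
qed simp

definition pgen :: "'a \<Rightarrow> ('a fmon \<Rightarrow>\<^sub>0 'k)" where
  "pgen x = gen x ^ CHAR('k) - gen (pmap g x)"

lemma pgen_C: "x \<in> part g False \<Longrightarrow> pgen x \<in> C"
  unfolding pgen_def by (intro C_closed C_power part_sspace) (auto intro: pmap_part part_sspace)

text \<open>In the expansion of \<open>x^p y\<close> the binomial coefficients with
  \<open>0 < j < p\<close> vanish. The term \<open>j = p\<close> is the bracket with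
  \<open>pmap g x\<close> by \<open>pmap_ad\<close>, and this is also the error in commuting
  \<open>pmap g x\<close> with \<open>y\<close>.\<close>

lemma pgen_commute:
  assumes x: "x \<in> part g False" and y: "y \<in> sspace g"
  shows "eqv (pgen x * gen y) (gen y * pgen x)"
proof -
  let ?p = "CHAR('k)"
  note xs = part_sspace[OF x]
  define t :: "nat \<Rightarrow> 'a fmon \<Rightarrow>\<^sub>0 'k"
    where "t j = scl (of_nat (?p choose j)) (gen ((bracket g x ^^ j) y) * gen x ^ (?p - j))" for j
  have t0: "t j = 0" if "j \<noteq> 0" "j < ?p" for j
  proof -
    have "?p dvd (?p choose j)"
      by (intro dvd_choose_prime prime_char) (use that in auto)
    then have "(of_nat (?p choose j) :: 'k) = 0" by (simp only: of_nat_eq_0_iff_char_dvd)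
    then show ?thesis by (simp add: t_def)
  qed
  have "eqv (gen x ^ ?p * gen y) (\<Sum>j\<le>?p. t j)"
    unfolding t_def by (rule eqv_gen_power[OF x y])
  also have "(\<Sum>j\<le>?p. t j) = (\<Sum>j\<in>{0, ?p}. t j)"
    by (rule sum.mono_neutral_right) (use t0 in auto)
  also have "\<dots> = gen y * gen x ^ ?p + gen (bracket g (pmap g x) y)"
    using char_pos pmap_ad[OF x y] by (simp add: t_def)
  finally have 1: "eqv (gen x ^ ?p * gen y) (gen y * gen x ^ ?p + gen (bracket g (pmap g x) y))" .
  have 2: "eqv (gen (pmap g x) * gen y) (gen y * gen (pmap g x) + gen (bracket g (pmap g x) y))"
    by (rule eqv_gen_even[OF pmap_part[OF x] y])
  have "eqv (gen x ^ ?p * gen y + scl (- 1) (gen (pmap g x) * gen y))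
      (gen y * gen x ^ ?p + gen (bracket g (pmap g x) y)
        + scl (- 1) (gen y * gen (pmap g x) + gen (bracket g (pmap g x) y)))"
    by (intro eqv_add eqv_scl 1 2)
  then show ?thesis by (simp add: pgen_def algebra_simps)
qed

lemma pgen_cen:
  assumes x: "x \<in> part g False"
  shows "pgen x \<in> cen"
proof -
  have "val (gen x ^ k) \<in> homog False" for k
  proof (induction k)
    case (Suc k)
    then show ?case using homog_op[OF x] by (simp add: val_mult)
  qed (simp add: val_def homog_single_Nil)
  then have "val (pgen x) \<in> homog False"
    unfolding pgen_def val_diff using val_gen[OF pmap_part[OF x]] by (intro homog_diff)
  moreover have "val (gen y * pgen x) = val (pgen x * gen y)" if "y \<in> sspace g" for y
    using pgen_commute[OF x that] pgen_C[OF x] that by (subst (asm) eqv_iff) (auto intro: C_closed)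
  ultimately show ?thesis using pgen_C[OF x] by (simp add: cen_def)
qed

lemma cen_C: "f \<in> cen \<Longrightarrow> f \<in> C"
  by (simp add: cen_def)

lemma cen_eqv: "f \<in> cen \<Longrightarrow> h \<in> C \<Longrightarrow> eqv (f * h) (h * f)"
  using cen_commute by (subst eqv_iff) (auto intro: C_closed cen_C)

lemma cen_add: "f \<in> cen \<Longrightarrow> h \<in> cen \<Longrightarrow> f + h \<in> cen"
  by (simp add: cen_def C_closed val_add homog_add distrib_left distrib_right)

lemma cen_scl: "f \<in> cen \<Longrightarrow> scl c f \<in> cen"
  by (simp add: cen_def C_closed val_scl homog_scl const_commute scl_mult_left)

lemma cen_one: "1 \<in> cen"
  by (simp add: cen_def C_closed val_def homog_single_Nil)

lemma cen_uminus: "f \<in> cen \<Longrightarrow> - f \<in> cen"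
  using cen_scl[of f "- 1"] by simp

lemma cen_const: "const c \<in> cen"
  using cen_scl[OF cen_one, of c] const_mult[of c "1 :: 'a fmon \<Rightarrow>\<^sub>0 'k"] by simp

lemma cen_mult:
  assumes f: "f \<in> cen" and h: "h \<in> cen"
  shows "f * h \<in> cen"
proof -
  note fC = cen_C[OF f] and hC = cen_C[OF h]
  have "val (f * h) \<in> homog False"
    unfolding val_mult using eval_homog[OF fC, of False "val h" False] f h by (simp add: cen_def)
  moreover have "val (gen x * (f * h)) = val (f * h * gen x)" if x: "x \<in> sspace g" for x
  proof -
    have xC: "gen x \<in> C" using x by (rule C_closed)
    have "eqv (gen x * f * h) (f * gen x * h)"
      by (intro eqv_mult_right eqv_sym[OF cen_eqv] f xC hC)
    also have "\<dots> = f * (gen x * h)" by (simp add: mult.assoc)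
    also have "eqv \<dots> (f * (h * gen x))"
      by (intro eqv_mult_left eqv_sym[OF cen_eqv] h xC fC)
    finally show ?thesis
      using fC hC xC by (subst (asm) eqv_iff) (auto intro: C_closed simp: mult.assoc)
  qed
  ultimately show ?thesis using fC hC by (simp add: cen_def C_closed)
qed

lemma center_add: "u \<in> center g \<Longrightarrow> v \<in> center g \<Longrightarrow> u \<oplus>\<^bsub>uea g\<^esub> v \<in> center g"
  unfolding center_eq using cen_add by (auto simp: cls_add cen_C)

lemma center_mult: "u \<in> center g \<Longrightarrow> v \<in> center g \<Longrightarrow> u \<otimes>\<^bsub>uea g\<^esub> v \<in> center g"
  unfolding center_eq using cen_mult by (auto simp: cls_mult cen_C)

lemma center_uminus: "u \<in> center g \<Longrightarrow> \<ominus>\<^bsub>uea g\<^esub> u \<in> center g"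
  unfolding center_eq using cen_uminus by (auto simp: cls_uminus cen_C)

lemma center_commute: "u \<in> center g \<Longrightarrow> v \<in> center g \<Longrightarrow> u \<otimes>\<^bsub>uea g\<^esub> v = v \<otimes>\<^bsub>uea g\<^esub> u"
proof -
  assume "u \<in> center g" "v \<in> center g"
  then obtain f h where "f \<in> cen" "u = cls f" "h \<in> cen" "v = cls h"
    unfolding center_eq by blast
  then show ?thesis
    using cls_eq_iff[of "f * h" "h * f"] by (simp add: cls_mult cen_C C_closed cen_commute)
qed

lemma center_carrier: "center g \<subseteq> carrier (uea g)"
  by (auto simp: center_def)

lemma subalgebra_center:
  assumes "S \<subseteq> center g"
  shows "uea_subalgebra g S \<subseteq> center g"
proof
  fix u assume "u \<in> uea_subalgebra g S"
  then show "u \<in> center g"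
    unfolding uea_subalgebra_def
  proof (induction rule: generate_ring.induct)
    case one
    then show ?case unfolding center_eq cls_one using cen_one by blast
  next
    case (incl h)
    then show ?case
      using assms cen_const by (auto simp: center_eq uea_scalar_def)
  qed (auto intro: center_add center_mult center_uminus)
qed

lemma p_center_generators:
  "(uea_gen g x [^]\<^bsub>uea g\<^esub> CHAR('k)) \<ominus>\<^bsub>uea g\<^esub> uea_gen g (pmap g x) = cls (pgen x)"
  if "x \<in> part g False"
  using that part_sspace[OF that] part_sspace[OF pmap_part[OF that]]
  by (simp add: uea_gen_def pgen_def cls_power cls_diff C_closed C_power)

lemma p_center_eq: "p_center g = uea_subalgebra g {cls (pgen x) | x. x \<in> part g False}"
  unfolding p_center_def setcompr_eq_image
  by (rule arg_cong[where f = "uea_subalgebra g"], rule image_cong) (simp_all add: p_center_generators)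

lemma p_center_center: "p_center g \<subseteq> center g"
  unfolding p_center_eq by (rule subalgebra_center) (auto simp: center_eq pgen_cen)

lemma scalars_carrier: "range (uea_scalar g) \<subseteq> carrier (uea g)"
  by (auto simp: uea_scalar_def intro: cls_closed C_closed)

lemma subalgebra_subring: "S \<subseteq> carrier (uea g) \<Longrightarrow> subring (uea_subalgebra g S) (uea g)"
  unfolding uea_subalgebra_def
  by (rule U.generate_ring_is_subring) (use scalars_carrier in auto)

lemma subalgebra_scalar: "cls (const c) \<in> uea_subalgebra g S"
  unfolding uea_subalgebra_def by (rule generate_ring.incl) (auto simp: uea_scalar_def)

lemma subalgebra_incl: "u \<in> S \<Longrightarrow> u \<in> uea_subalgebra g S"
  unfolding uea_subalgebra_def by (rule generate_ring.incl) auto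

lemma p_center_subring: "subring (p_center g) (uea g)"
  unfolding p_center_eq by (rule subalgebra_subring) (auto intro: cls_closed pgen_C)

lemma p_center_scalar: "cls (const c) \<in> p_center g"
  unfolding p_center_eq by (rule subalgebra_scalar)

lemma p_center_pgen: "x \<in> part g False \<Longrightarrow> cls (pgen x) \<in> p_center g"
  unfolding p_center_eq by (rule subalgebra_incl) auto

text \<open>The variables in Hilbert's argument: one operator on normal forms for each even basis
  element, multiplication by its \<open>pgen\<close>.\<close>

definition pops :: "((nat list \<Rightarrow>\<^sub>0 'k) \<Rightarrow> (nat list \<Rightarrow>\<^sub>0 'k)) set" where
  "pops = (\<lambda>i. eval (pgen (b i))) ` {i. i < n \<and> \<not> par i}"

lemma pops_cases:
  assumes "T \<in> pops"
  obtains i where "i < n" "\<not> par i" "b i \<in> part g False" "T = eval (pgen (b i))"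
  using assms b_part by (fastforce simp: pops_def)

lemma endo_eval: "pm.endo (eval f)"
  by (simp add: pm.endo_def eval_add_right eval_scl_right)

lemma subspace_NP: "pm.subspace NP"
  by (rule pm.subspaceI) (auto intro: NP_add NP_scl)

lemma stable_NP: "pm.stable pops NP"
  using subspace_NP NP_eval by (auto simp: pm.stable_def pops_def)

section \<open>Spanning by words with few repetitions\<close>

lemma length_op:
  assumes "p \<in> NP" "\<And>w. w \<in> keys p \<Longrightarrow> length w \<le> k"
  shows "\<forall>w\<in>keys (op x p). length w \<le> Suc k"
proof -
  have "keys (op x p) \<subseteq> {w. length w \<le> Suc k}"
    unfolding op_def
  proof (rule keys_lin_subset)
    fix w assume w: "w \<in> keys p"
    then have nw: "normal w" using assms(1) by (simp add: NP_def)
    show "keys (rho x w) \<subseteq> {w. length w \<le> Suc k}"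
      unfolding rho_def
    proof (rule keys_sum_subset)
      fix i assume i: "i \<in> {..<n}"
      have "keys (act i w) \<subseteq> {w. length w \<le> Suc k}"
        using keys_act[of i w] i nw assms(2)[OF w] by (auto simp: reach_def)
      then show "keys (scl (coord x i) (act i w)) \<subseteq> {w. length w \<le> Suc k}"
        by (rule subset_trans[OF keys_scl_subset])
    qed
  qed
  then show ?thesis by auto
qed

lemma length_foldr_op:
  "\<forall>w\<in>keys (foldr op xs (single [] 1)). length w \<le> length xs"
proof (induction xs)
  case (Cons x xs)
  then show ?case using length_op[of "foldr op xs (single [] 1)" "length xs" x]
    by (simp add: NP_foldr_op)
qed simp

lemma eval_mon: "eval (mon w) p = foldr op (map b w) p"
  by (simp add: mon_def eval_single)

lemma foldr_op_replicate: "eval (gen x ^ k) p = foldr op (replicate k x) p"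
  by (induction k) (simp_all add: eval_mult)

definition short_words :: "(nat list \<Rightarrow>\<^sub>0 'k) set" where
  "short_words = (\<lambda>w. single w 1) ` {w. normal w \<and> (\<forall>i. count_list w i < CHAR('k))}"

lemma finite_short_words: "finite short_words"
proof -
  have "{w. normal w \<and> (\<forall>i. count_list w i < CHAR('k))}
      \<subseteq> {w. set w \<subseteq> {..<n} \<and> length w \<le> n * CHAR('k)}"
  proof safe
    fix w assume w: "normal w" "\<forall>i. count_list w i < CHAR('k)"
    then have s: "set w \<subseteq> {..<n}" by (auto simp: normal_def)
    then show "\<And>x. x \<in> set w \<Longrightarrow> x < n" by auto
    have "length w = sum (count_list w) {..<n}"
      using sum_count_set[OF s] by simp
    also have "\<dots> \<le> of_nat (card {..<n}) * CHAR('k)"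
      by (rule sum_bounded_above) (use w(2) in \<open>auto intro: less_imp_le\<close>)
    finally show "length w \<le> n * CHAR('k)" by simp
  qed
  then show ?thesis
    unfolding short_words_def
    using finite_lists_length_le[of "{..<n}" "n * CHAR('k)"] finite_subset by blast
qed

lemma odd_count_le:
  assumes "normal w" "par i"
  shows "count_list w i \<le> 1"
  using assms(1)
proof (induction w)
  case (Cons j w)
  show ?case
  proof (cases "j = i")
    case True
    then have "i \<notin> set w" using Cons.prems assms(2) by (auto simp: normal_Cons before_def)
    then show ?thesis using True by simp
  qed (use Cons in \<open>auto simp: normal_Cons\<close>)
qed simp

text \<open>A normal word in which \<open>i\<close> occurs at least \<open>p\<close> times contains
  \<open>b_i^p\<close>, and \<open>i\<close> is even because odd letters do not repeat. Writing
  \<open>b_i^p\<close> as \<open>pgen (b i)\<close> plus the image under the \<open>p\<close>-map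
  leaves shorter products.\<close>

lemma spanned_by_short_words:
  assumes V: "pm.stable pops V" "short_words \<subseteq> V"
  shows "NP \<subseteq> V"
proof -
  have sV: "pm.subspace V" using V(1) by (simp add: pm.stable_def)
  have comb: "p \<in> V" if "\<And>w. w \<in> keys p \<Longrightarrow> single w 1 \<in> V" for p
  proof -
    have "(\<Sum>w\<in>keys p. scl (lookup p w) (single w 1)) \<in> V"
      using that by (intro pm.subspace_sum[OF sV] pm.subspace_scale[OF sV]) auto
    then show ?thesis by (simp only: lin_single_id[unfolded lin_def])
  qed
  have "single w 1 \<in> V" if "normal w" for w
    using that
  proof (induction w rule: measure_induct_rule[of length])
    case (less w)
    show ?case
    proof (cases "\<forall>i. count_list w i < CHAR('k)")
      case True
      then show ?thesis using V(2) less.prems by (auto simp: short_words_def)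
    next
      case False
      then obtain i where i: "CHAR('k) \<le> count_list w i" by (auto simp: not_less)
      have two_le: "2 \<le> CHAR('k)" using prime_char prime_ge_2_nat by blast
      then have np: "\<not> par i" using odd_count_le[OF less.prems, of i] i by auto
      have "i \<in> set w" using i two_le count_list_0_iff[of w i] by auto
      then have iN: "i < n" using less.prems by (auto simp: normal_def)
      have bp: "b i \<in> part g False" using b_part[OF iN] np by simp
      obtain u v where w: "w = u @ replicate (CHAR('k)) i @ v"
        using sorted_block[OF normal_sorted[OF less.prems] i] .
      have letters: "set u \<subseteq> {..<n}" using less.prems w by (auto simp: normal_def)
      have uC: "mon u \<in> C" by (rule mon_C) (use letters in auto)
      let ?e = "single [] (1::'k)"
      let ?v = "foldr op (map b v) ?e"
      have vN: "?v \<in> NP" by (rule NP_foldr_op) simp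
      have "single w 1 = foldr op (map b w) ?e"
        using val_mon[OF less.prems] by (simp add: val_def eval_mon)
      also have "\<dots> = eval (mon u) (eval (gen (b i) ^ CHAR('k)) ?v)"
        by (simp add: w eval_mon foldr_op_replicate)
      also have "gen (b i) ^ CHAR('k) = pgen (b i) + gen (pmap g (b i))"
        by (simp add: pgen_def)
      also have "eval (mon u) (eval (pgen (b i) + gen (pmap g (b i))) ?v)
          = eval (mon u * pgen (b i)) ?v + eval (mon u) (op (pmap g (b i)) ?v)"
        by (simp add: eval_add eval_add_right eval_mult)
      \<comment> \<open>The central factor moves to the front, where it is one of the operators in
        \<open>pops\<close>.\<close>
      also have "eval (mon u * pgen (b i)) ?v = eval (pgen (b i) * mon u) ?v"
        using cen_eqv[OF pgen_cen[OF bp] uC] eval_ideal[OF _ vN]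
        by (fastforce simp: eqv_def eval_diff)
      also have "eval (pgen (b i) * mon u) ?v = eval (pgen (b i)) (foldr op (map b (u @ v)) ?e)"
        by (simp add: eval_mult eval_mon)
      also have "eval (mon u) (op (pmap g (b i)) ?v)
          = foldr op (map b u @ [pmap g (b i)] @ map b v) ?e"
        by (simp add: eval_mon)
      finally have eq: "single w 1 = eval (pgen (b i)) (foldr op (map b (u @ v)) ?e)
          + foldr op (map b u @ [pmap g (b i)] @ map b v) ?e" .
      \<comment> \<open>Replacing \<open>p\<close> letters by at most one shortens the product, and
        normal forms are never longer than the products they come from.\<close>
      have low: "foldr op xs ?e \<in> V" if "length xs < length w" for xs
      proof (rule comb)
        fix w' assume w': "w' \<in> keys (foldr op xs ?e)"
        have "foldr op xs ?e \<in> NP" by (rule NP_foldr_op) simp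
        then have "normal w'" using w' by (simp add: NP_def)
        moreover have "length w' < length w"
          using length_foldr_op[of xs] w' that by auto
        ultimately show "single w' 1 \<in> V" by (intro less.IH)
      qed
      have "eval (pgen (b i)) \<in> pops" using iN np by (auto simp: pops_def)
      moreover have "foldr op (map b (u @ v)) ?e \<in> V"
        by (rule low) (use two_le w in simp)
      ultimately have "eval (pgen (b i)) (foldr op (map b (u @ v)) ?e) \<in> V"
        by (rule pm.stable_app[OF V(1)])
      moreover have "foldr op (map b u @ [pmap g (b i)] @ map b v) ?e \<in> V"
        by (rule low) (use two_le w in simp)
      ultimately show ?thesis unfolding eq by (rule pm.subspace_add[OF sV])
    qed
  qed
  then show ?thesis using comb by (auto simp: NP_def)
qed

lemma noetherian_NP: "pm.noetherian pops NP"
proof (rule pm.noetherian_operators[OF _ finite_short_words _ stable_NP])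
  show "finite pops" by (simp add: pops_def)
  show "short_words \<subseteq> NP" by (auto simp: short_words_def)
  show "pm.endo T" if "T \<in> pops" for T
    using that endo_eval by (auto simp: pops_def)
  show "T (T' p) = T' (T p)" if T: "T \<in> pops" "T' \<in> pops" and p: "p \<in> NP" for T T' p
  proof -
    obtain i where i: "b i \<in> part g False" "T = eval (pgen (b i))" using pops_cases[OF T(1)] by metis
    obtain j where j: "b j \<in> part g False" "T' = eval (pgen (b j))" using pops_cases[OF T(2)] by metis
    have "pgen (b i) * pgen (b j) - pgen (b j) * pgen (b i) \<in> I"
      using cen_eqv[OF pgen_cen[OF i(1)] pgen_C[OF j(1)]] by (simp add: eqv_def)
    from eval_ideal[OF this p] show ?thesis
      by (simp add: i j eval_diff eval_mult)
  qed
qed (rule spanned_by_short_words)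

lemma noetherian_obtain:
  assumes "pm.stable pops M" "M \<subseteq> NP"
  obtains S where "finite S" "S \<subseteq> M" "\<And>N. pm.stable pops N \<Longrightarrow> S \<subseteq> N \<Longrightarrow> M \<subseteq> N"
  using noetherian_NP assms unfolding pm.noetherian_def by meson

text \<open>On normal forms, multiplication by these elements is scalar multiplication or an
  operator in \<open>pops\<close>; closure under them is what the noetherian property of
  \<open>NP\<close> can express.\<close>

definition pbase :: "('a fmon \<Rightarrow>\<^sub>0 'k) set set" where
  "pbase = range (\<lambda>c. cls (const c)) \<union> (\<lambda>i. cls (pgen (b i))) ` {i. i < n \<and> \<not> par i}"

lemma pbase_p_center: "pbase \<subseteq> p_center g"
  using b_part p_center_scalar by (fastforce simp: pbase_def intro: p_center_pgen)

definition p_closed :: "('a fmon \<Rightarrow>\<^sub>0 'k) set set \<Rightarrow> bool" where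
  "p_closed X \<longleftrightarrow> \<zero>\<^bsub>uea g\<^esub> \<in> X \<and> (\<forall>u\<in>X. \<forall>v\<in>X. u \<oplus>\<^bsub>uea g\<^esub> v \<in> X) \<and>
     (\<forall>a\<in>pbase. \<forall>u\<in>X. a \<otimes>\<^bsub>uea g\<^esub> u \<in> X)"

text \<open>Transports a set of cosets to normal forms, on which the operators act.\<close>

definition pull :: "('a fmon \<Rightarrow>\<^sub>0 'k) set set \<Rightarrow> (nat list \<Rightarrow>\<^sub>0 'k) set" where
  "pull X = {p \<in> NP. cls (nf p) \<in> X}"

lemma val_pull: "f \<in> C \<Longrightarrow> val f \<in> pull X \<longleftrightarrow> cls f \<in> X"
  by (simp add: pull_def NP_val cls_nf)

lemma stable_pull:
  assumes "p_closed X"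
  shows "pm.stable pops (pull X)"
  unfolding pm.stable_def
proof (intro conjI ballI subsetI)
  have X: "\<zero>\<^bsub>uea g\<^esub> \<in> X" "\<And>u v. u \<in> X \<Longrightarrow> v \<in> X \<Longrightarrow> u \<oplus>\<^bsub>uea g\<^esub> v \<in> X"
    "\<And>a u. a \<in> pbase \<Longrightarrow> u \<in> X \<Longrightarrow> a \<otimes>\<^bsub>uea g\<^esub> u \<in> X"
    using assms by (auto simp: p_closed_def)
  show "pm.subspace (pull X)"
  proof (rule pm.subspaceI)
    show "0 \<in> pull X" using X(1) by (simp add: pull_def cls_zero nf_def)
    show "p + q \<in> pull X" if "p \<in> pull X" "q \<in> pull X" for p q
      using that X(2)[of "cls (nf p)" "cls (nf q)"]
      by (simp add: pull_def NP_add cls_add nf_C) (simp add: nf_def lin_add)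
    show "scl c p \<in> pull X" if "p \<in> pull X" for c p
      using that X(3)[of "cls (const c)" "cls (nf p)"]
      by (simp add: pull_def pbase_def NP_scl cls_mult nf_C C_closed const_mult) (simp add: nf_def lin_scl)
  qed
  fix T q assume T: "T \<in> pops" and "q \<in> T ` pull X"
  then obtain p where q: "q = T p" and p: "p \<in> NP" "cls (nf p) \<in> X" by (auto simp: pull_def)
  obtain i where i': "i < n" "\<not> par i" and i: "b i \<in> part g False" "T = eval (pgen (b i))"
    using pops_cases[OF T] by metis
  have pb: "cls (pgen (b i)) \<in> pbase" using i' by (simp add: pbase_def)
  have "cls (pgen (b i) * nf p) \<in> X"
    using X(3)[OF pb p(2)] p(1) by (simp add: cls_mult pgen_C[OF i(1)] nf_C)
  moreover have "val (pgen (b i) * nf p) = q"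
    using p(1) i by (simp add: val_mult val_nf q)
  ultimately show "q \<in> pull X"
    using val_pull[of "pgen (b i) * nf p" X] pgen_C[OF i(1)] nf_C[OF p(1)] by (simp add: C_closed)
qed

section \<open>Finiteness of the center\<close>

lemma center_zero: "\<zero>\<^bsub>uea g\<^esub> \<in> center g"
  using cen_scl[OF cen_one, of 0] by (auto simp: center_eq cls_zero)

text \<open>The noetherian property of \<open>NP\<close> for the normal forms of central elements,
  read back in \<open>U(g)\<close>. Taking for \<open>X\<close> the linear combinations of
  \<open>S\<close>, or a subalgebra containing \<open>S\<close>, gives the two finite generation
  statements.\<close>

lemma center_generators:
  obtains S where "finite S" "S \<subseteq> center g"
    "\<And>X. p_closed X \<Longrightarrow> S \<subseteq> X \<Longrightarrow> center g \<subseteq> X"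
proof -
  have "pm.stable pops (pull (center g))"
    by (rule stable_pull) (use center_zero center_add center_mult p_center_center pbase_p_center in
        \<open>auto simp: p_closed_def\<close>)
  moreover have "pull (center g) \<subseteq> NP" by (auto simp: pull_def)
  ultimately obtain B where B: "finite B" "B \<subseteq> pull (center g)"
      "\<And>N. pm.stable pops N \<Longrightarrow> B \<subseteq> N \<Longrightarrow> pull (center g) \<subseteq> N"
    using noetherian_obtain by metis
  show ?thesis
  proof (rule that)
    show "finite ((\<lambda>p. cls (nf p)) ` B)" using B(1) by simp
    show "(\<lambda>p. cls (nf p)) ` B \<subseteq> center g" using B(2) by (auto simp: pull_def)
    fix X assume X: "p_closed X" "(\<lambda>p. cls (nf p)) ` B \<subseteq> X"
    have "B \<subseteq> pull X" using B(2) X(2) by (auto simp: pull_def)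
    then have sub: "pull (center g) \<subseteq> pull X" using B(3) stable_pull[OF X(1)] by blast
    show "center g \<subseteq> X"
    proof
      fix u assume u: "u \<in> center g"
      then obtain f where "f \<in> C" "u = cls f" using center_carrier carrier_uea by auto
      then show "u \<in> X" using u sub val_pull[of f] by auto
    qed
  qed
qed

theorem center_finitely_generated_module: "finitely_generated_module (uea g) (p_center g) (center g)"
proof -
  obtain S where S: "finite S" "S \<subseteq> center g"
    "\<And>X. p_closed X \<Longrightarrow> S \<subseteq> X \<Longrightarrow> center g \<subseteq> X"
    using center_generators by metis
  have Sc: "(\<lambda>s. s) \<in> S \<rightarrow> carrier (uea g)" using S(2) center_carrier by auto
  note L = U.lincomb_closed[OF p_center_subring S(1) Sc]
  have "center g \<subseteq> U.lincomb (p_center g) S (\<lambda>s. s)"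
    by (rule S(3)) (use L pbase_p_center in \<open>auto simp: p_closed_def\<close>)
  moreover have "U.lincomb (p_center g) S (\<lambda>s. s) \<subseteq> center g"
  proof
    fix x assume "x \<in> U.lincomb (p_center g) S (\<lambda>s. s)"
    then obtain c where c: "c \<in> S \<rightarrow> p_center g" "x = (\<Oplus>\<^bsub>uea g\<^esub>s\<in>S. c s \<otimes>\<^bsub>uea g\<^esub> s)"
      by (auto simp: U.lincomb_def)
    have "(\<Oplus>\<^bsub>uea g\<^esub>s\<in>S'. c s \<otimes>\<^bsub>uea g\<^esub> s) \<in> center g" if "S' \<subseteq> S" for S'
      using finite_subset[OF that S(1)] that
    proof (induction S')
      case (insert s S')
      have t: "c s \<otimes>\<^bsub>uea g\<^esub> s \<in> center g" if "s \<in> S" for s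
        using that c(1) S(2) p_center_center center_mult by blast
      then have "(\<Oplus>\<^bsub>uea g\<^esub>s\<in>insert s S'. c s \<otimes>\<^bsub>uea g\<^esub> s)
          = c s \<otimes>\<^bsub>uea g\<^esub> s \<oplus>\<^bsub>uea g\<^esub> (\<Oplus>\<^bsub>uea g\<^esub>s\<in>S'. c s \<otimes>\<^bsub>uea g\<^esub> s)"
        using insert center_carrier by (intro U.finsum_insert) blast+
      then show ?case using insert t center_add by simp
    qed (simp add: center_zero)
    then show "x \<in> center g" using c(2) by blast
  qed
  ultimately show ?thesis
    using U.finitely_generated_module_lincomb[OF S(1,2)] by blast
qed

text \<open>A subalgebra that contains module generators and the finitely many
  \<open>pgen (b i)\<close> is \<open>p_closed\<close>, hence contains the center.\<close>

theorem center_finitely_generated_algebra: "finitely_generated_commutative_algebra g (center g)"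
proof -
  obtain S where S: "finite S" "S \<subseteq> center g"
    "\<And>X. p_closed X \<Longrightarrow> S \<subseteq> X \<Longrightarrow> center g \<subseteq> X"
    using center_generators by metis
  let ?P = "(\<lambda>i. cls (pgen (b i))) ` {i. i < n \<and> \<not> par i}"
  have Pc: "?P \<subseteq> center g"
    using pbase_p_center p_center_center by (auto simp: pbase_def)
  let ?A = "uea_subalgebra g (S \<union> ?P)"
  have A: "subring ?A (uea g)"
    by (rule subalgebra_subring) (use S(2) Pc center_carrier in blast)
  have "pbase \<subseteq> ?A"
    using subalgebra_scalar subalgebra_incl by (auto simp: pbase_def)
  then have "center g \<subseteq> ?A"
    using subringE(2,6,7)[OF A] subalgebra_incl by (intro S(3)) (auto simp: p_closed_def)
  moreover have "?A \<subseteq> center g"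
    by (rule subalgebra_center) (use S(2) Pc in blast)
  moreover have "finite (S \<union> ?P)" using S(1) by simp
  ultimately show ?thesis
    unfolding finitely_generated_commutative_algebra_def using center_commute by blast
qed

text \<open>The spans \<open>?L k\<close> of the first \<open>k\<close> powers of \<open>z\<close>
  over the p-center increase, and a finite set generating their union lies in one of them. So the
  chain is stationary from some \<open>m\<close> on, and the power \<open>m\<close> of
  \<open>z\<close> is a combination of lower ones.\<close>

theorem center_integral:
  assumes "z \<in> center g"
  shows "integral_over (uea g) (p_center g) z"
proof -
  have zc: "z \<in> carrier (uea g)" using assms center_carrier by auto
  let ?s = "\<lambda>i::nat. z [^]\<^bsub>uea g\<^esub> i"
  let ?L = "\<lambda>k. U.lincomb (p_center g) {..<k} ?s"
  have sc: "?s i \<in> carrier (uea g)" for i using zc by simp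
  have L: "?L k \<subseteq> carrier (uea g)"
      "\<And>x y. x \<in> ?L k \<Longrightarrow> y \<in> ?L k \<Longrightarrow> x \<oplus>\<^bsub>uea g\<^esub> y \<in> ?L k"
      "\<And>a x. a \<in> p_center g \<Longrightarrow> x \<in> ?L k \<Longrightarrow> a \<otimes>\<^bsub>uea g\<^esub> x \<in> ?L k"
      "\<And>i. i < k \<Longrightarrow> ?s i \<in> ?L k" "\<zero>\<^bsub>uea g\<^esub> \<in> ?L k" for k
    using U.lincomb_closed[OF p_center_subring, of "{..<k}" ?s] sc by auto
  have mono: "k \<le> l \<Longrightarrow> ?L k \<subseteq> ?L l" for k l
    using lift_Suc_mono_le[of ?L, OF U.lincomb_Suc[OF p_center_subring sc]] by blast
  let ?X = "\<Union>k. ?L k"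
  have "pm.stable pops (pull ?X)"
  proof (rule stable_pull, unfold p_closed_def, intro conjI ballI)
    show "\<zero>\<^bsub>uea g\<^esub> \<in> ?X" using L(5) by blast
    show "u \<oplus>\<^bsub>uea g\<^esub> v \<in> ?X" if uv: "u \<in> ?X" "v \<in> ?X" for u v
    proof -
      obtain k l where "u \<in> ?L k" "v \<in> ?L l" using uv by blast
      then have "u \<in> ?L (max k l)" "v \<in> ?L (max k l)"
        using mono[of k "max k l"] mono[of l "max k l"] by auto
      then show ?thesis using L(2) by blast
    qed
    show "a \<otimes>\<^bsub>uea g\<^esub> u \<in> ?X" if "a \<in> pbase" "u \<in> ?X" for a u
      using L(3) that pbase_p_center by blast
  qed
  moreover have "pull ?X \<subseteq> NP" by (auto simp: pull_def)
  ultimately obtain B where B: "finite B" "B \<subseteq> pull ?X"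
      "\<And>N. pm.stable pops N \<Longrightarrow> B \<subseteq> N \<Longrightarrow> pull ?X \<subseteq> N"
    using noetherian_obtain by metis
  have "\<exists>m. B \<subseteq> pull (?L m)"
    using B(1,2)
  proof (induction B)
    case (insert p B)
    then obtain m k where mk: "B \<subseteq> pull (?L m)" "p \<in> pull (?L k)" by (auto simp: pull_def)
    have "pull (?L m) \<subseteq> pull (?L (max m k))" "pull (?L k) \<subseteq> pull (?L (max m k))"
      using mono[of m "max m k"] mono[of k "max m k"] unfolding pull_def by auto
    then have "insert p B \<subseteq> pull (?L (max m k))" using mk by blast
    then show ?case by blast
  qed auto
  then obtain m where "B \<subseteq> pull (?L m)" by blast
  then have sub: "pull ?X \<subseteq> pull (?L m)"
    using B(3) stable_pull[of "?L m"] L(2,3,5) pbase_p_center by (simp add: p_closed_def subset_iff)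
  obtain f where f: "f \<in> C" "?s m = cls f" using sc[of m] carrier_uea by auto
  have "?s m \<in> ?X" using L(4)[of m "Suc m"] by blast
  then have "?s m \<in> ?L m" using sub val_pull[OF f(1)] f(2) by auto
  then obtain c where c: "c \<in> {..<m} \<rightarrow> p_center g"
      "?s m = (\<Oplus>\<^bsub>uea g\<^esub>i\<in>{..<m}. c i \<otimes>\<^bsub>uea g\<^esub> ?s i)"
    by (auto simp: U.lincomb_def)
  let ?d = "\<lambda>i. \<ominus>\<^bsub>uea g\<^esub> c i"
  have cc: "c i \<in> carrier (uea g)" if "i < m" for i
    using c(1) that p_center_center center_carrier by blast
  have d: "?d \<in> {..<m} \<rightarrow> p_center g"
    using c(1) subringE(5)[OF p_center_subring] by auto
  have "(\<Oplus>\<^bsub>uea g\<^esub>i\<in>{..<m}. c i \<otimes>\<^bsub>uea g\<^esub> ?s i) \<oplus>\<^bsub>uea g\<^esub>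
      (\<Oplus>\<^bsub>uea g\<^esub>i\<in>{..<m}. ?d i \<otimes>\<^bsub>uea g\<^esub> ?s i)
    = (\<Oplus>\<^bsub>uea g\<^esub>i\<in>{..<m}. c i \<otimes>\<^bsub>uea g\<^esub> ?s i \<oplus>\<^bsub>uea g\<^esub> ?d i \<otimes>\<^bsub>uea g\<^esub> ?s i)"
    by (rule U.finsum_addf[symmetric]) (use cc sc in auto)
  also have "\<dots> = (\<Oplus>\<^bsub>uea g\<^esub>i\<in>{..<m}. \<zero>\<^bsub>uea g\<^esub>)"
    by (rule U.finsum_cong') (use cc sc in \<open>auto simp: U.l_minus U.r_neg\<close>)
  also have "\<dots> = \<zero>\<^bsub>uea g\<^esub>" by (rule U.finsum_zero)
  finally have "?s m \<oplus>\<^bsub>uea g\<^esub> (\<Oplus>\<^bsub>uea g\<^esub>i\<in>{..<m}. ?d i \<otimes>\<^bsub>uea g\<^esub> ?s i) = \<zero>\<^bsub>uea g\<^esub>"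
    using c(2) by simp
  then show ?thesis unfolding integral_over_def using d by blast
qed

end

section \<open>Adapted bases\<close>

definition functional :: "('k::field, 'a::ab_group_add) lsa \<Rightarrow> ('a \<Rightarrow> 'k) \<Rightarrow> bool" where
  "functional g f \<longleftrightarrow> (\<forall>x\<in>sspace g. \<forall>y\<in>sspace g. f (x + y) = f x + f y) \<and>
     (\<forall>c. \<forall>x\<in>sspace g. f (smul g c x) = c * f x)"

text \<open>A stand-in for finite dimension that the entries of the matrices supply uniformly for
  all families; \<open>finite_basis\<close> extracts bases from it.\<close>

definition separating :: "('k::field, 'a::ab_group_add) lsa \<Rightarrow> ('a \<Rightarrow> 'k) set \<Rightarrow> bool" where
  "separating g L \<longleftrightarrow> finite L \<and> (\<forall>f\<in>L. functional g f) \<and>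
     (\<forall>x\<in>sspace g. (\<forall>f\<in>L. f x = 0) \<longrightarrow> x = 0)"

definition nondegenerate_on_odd :: "('k::field, 'a::ab_group_add) lsa \<Rightarrow> ('a \<Rightarrow> 'k) \<Rightarrow> bool" where
  "nondegenerate_on_odd g f \<longleftrightarrow> functional g f \<and>
     (\<forall>y\<in>part g True. (\<forall>x\<in>part g True. f (bracket g x y) = 0) \<longrightarrow> y = 0)"

text \<open>Functionals are pulled back along the isomorphism. The axioms are at hand for
  \<open>g\<close> and not for the explicit model \<open>h\<close>, which is why the three notions
  above are defined for bare records.\<close>

lemma isomorphic_transfer:
  assumes "lie_superalgebra g" and iso: "lsa_isomorphic g h"
    and L: "separating h L" and c: "nondegenerate_on_odd h c"
  shows "\<exists>L' c'. separating g L' \<and> nondegenerate_on_odd g c'"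
proof -
  interpret lie_superalgebra g by fact
  from iso obtain f where F: "bij_betw f (sspace g) (sspace h) \<and> (\<forall>e. f ` part g e = part h e) \<and>
     (\<forall>x\<in>sspace g. \<forall>y\<in>sspace g. f (x + y) = f x + f y) \<and>
     (\<forall>c. \<forall>x\<in>sspace g. f (smul g c x) = smul h c (f x)) \<and>
     (\<forall>x\<in>sspace g. \<forall>y\<in>sspace g. f (bracket g x y) = bracket h (f x) (f y)) \<and>
     (\<forall>x\<in>part g False. f (pmap g x) = pmap h (f x))"
    unfolding lsa_isomorphic_def by (elim exE)
  then have f: "bij_betw f (sspace g) (sspace h)" "\<And>e. f ` part g e = part h e"
      "\<And>x y. x \<in> sspace g \<Longrightarrow> y \<in> sspace g \<Longrightarrow> f (x + y) = f x + f y"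
      "\<And>c x. x \<in> sspace g \<Longrightarrow> f (smul g c x) = smul h c (f x)"
      "\<And>x y. x \<in> sspace g \<Longrightarrow> y \<in> sspace g \<Longrightarrow> f (bracket g x y) = bracket h (f x) (f y)"
    by simp_all
  have fs: "x \<in> sspace g \<Longrightarrow> f x \<in> sspace h" for x
    using f(1) by (auto simp: bij_betw_def)
  have "f 0 = 0" using f(3)[of 0 0] sspace_zero by simp
  then have f0: "x = 0" if "f x = 0" "x \<in> sspace g" for x
    using f(1) that sspace_zero unfolding bij_betw_def inj_on_def by metis
  have func: "functional g (\<lambda>x. d (f x))" if "functional h d" for d
    using that fs f(3,4) by (simp add: functional_def)
  have "separating g ((\<lambda>d x. d (f x)) ` L)"
    using L func fs f0 unfolding separating_def by auto
  moreover have "nondegenerate_on_odd g (\<lambda>x. c (f x))"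
    unfolding nondegenerate_on_odd_def
  proof (intro conjI ballI impI)
    show "functional g (\<lambda>x. c (f x))" using c func by (simp add: nondegenerate_on_odd_def)
    fix y assume y: "y \<in> part g True" and z: "\<forall>x\<in>part g True. c (f (bracket g x y)) = 0"
    have "c (bracket h x' (f y)) = 0" if x': "x' \<in> part h True" for x'
    proof -
      obtain x where "x \<in> part g True" "x' = f x" using x' f(2)[of True] by auto
      then show ?thesis using z f(5)[of x y] part_sspace y by auto
    qed
    moreover have "f y \<in> part h True" using f(2)[of True] y by auto
    ultimately have "f y = 0" using c by (simp add: nondegenerate_on_odd_def)
    then show "y = 0" using f0 part_sspace y by blast
  qed
  ultimately show ?thesis by blast
qed

section \<open>Bases from separating functionals\<close>

context lie_superalgebra
begin

lemma functional_diff: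
  assumes "functional g f" "x \<in> sspace g" "y \<in> sspace g"
  shows "f (x - smul g c y) = f x - c * f y"
proof -
  have "f (x + smul g (- c) y) = f x + - c * f y"
    using assms sspace_smul unfolding functional_def by metis
  then show ?thesis by simp
qed

lemma functional_zero: "functional g f \<Longrightarrow> f 0 = 0"
  using functional_diff[of f 0 0 1] sspace_zero by simp

lemma subspace_kernel:
  assumes "gv.subspace V" "V \<subseteq> sspace g" "functional g f"
  shows "gv.subspace {x \<in> V. f x = 0}"
proof (rule gv.subspaceI)
  show "0 \<in> {x \<in> V. f x = 0}"
    using gv.subspace_0[OF assms(1)] functional_zero[OF assms(3)] by simp
  show "x + y \<in> {x \<in> V. f x = 0}" if "x \<in> {x \<in> V. f x = 0}" "y \<in> {x \<in> V. f x = 0}" for x y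
    using that assms gv.subspace_add[OF assms(1)] by (auto simp: functional_def subset_iff)
  show "smul g c x \<in> {x \<in> V. f x = 0}" if "x \<in> {x \<in> V. f x = 0}" for c x
    using that assms gv.subspace_scale[OF assms(1)] by (auto simp: functional_def subset_iff)
qed

text \<open>Each functional costs at most one dimension: it vanishes on \<open>V\<close>, or one
  vector outside its kernel completes a spanning set of the kernel.\<close>

lemma finite_span:
  assumes "finite L" "\<And>f. f \<in> L \<Longrightarrow> functional g f" "gv.subspace V" "V \<subseteq> sspace g"
    "\<And>x. x \<in> V \<Longrightarrow> (\<And>f. f \<in> L \<Longrightarrow> f x = 0) \<Longrightarrow> x = 0"
  shows "\<exists>S. finite S \<and> V \<subseteq> gv.span S"
  using assms
proof (induction L arbitrary: V)
  case empty
  then have "V \<subseteq> gv.span {}" by auto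
  then show ?case by blast
next
  case (insert f L)
  let ?K = "{x \<in> V. f x = 0}"
  have ff: "functional g f" using insert.prems(1) by simp
  have "\<exists>S. finite S \<and> ?K \<subseteq> gv.span S"
  proof (rule insert.IH)
    show "gv.subspace ?K" by (rule subspace_kernel[OF insert.prems(2,3) ff])
    show "x = 0" if "x \<in> ?K" "\<And>f. f \<in> L \<Longrightarrow> f x = 0" for x
      using insert.prems(4)[of x] that by auto
  qed (use insert.prems in auto)
  then obtain S where S: "finite S" "?K \<subseteq> gv.span S" by blast
  show ?case
  proof (cases "\<exists>v\<in>V. f v \<noteq> 0")
    case True
    then obtain v where v: "v \<in> V" "f v \<noteq> 0" by blast
    have "x \<in> gv.span (insert v S)" if x: "x \<in> V" for x
    proof -
      let ?y = "x - smul g (f x / f v) v"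
      have "f ?y = 0"
        using functional_diff[OF ff, of x v] insert.prems(3) x v by (auto simp: subset_iff)
      then have "?y \<in> ?K"
        using gv.subspace_diff[OF insert.prems(2) x gv.subspace_scale[OF insert.prems(2) v(1)]] by simp
      then have "?y \<in> gv.span (insert v S)" using S(2) gv.span_mono[of S "insert v S"] by blast
      moreover have "smul g (f x / f v) v \<in> gv.span (insert v S)"
        by (intro gv.span_scale gv.span_base) simp
      ultimately have "?y + smul g (f x / f v) v \<in> gv.span (insert v S)" by (rule gv.span_add)
      then show ?thesis by simp
    qed
    then show ?thesis using S(1) by (intro exI[of _ "insert v S"]) auto
  next
    case False
    then have "?K = V" by auto
    then show ?thesis using S by auto
  qed
qed

lemma finite_basis:
  assumes "separating g L" "gv.subspace V" "V \<subseteq> sspace g"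
  obtains B where "finite B" "B \<subseteq> V" "gv.independent B" "gv.span B = V"
proof -
  have "\<exists>S. finite S \<and> V \<subseteq> gv.span S"
    by (rule finite_span[of L]) (use assms in \<open>auto simp: separating_def\<close>)
  then obtain S where S: "finite S" "V \<subseteq> gv.span S" by blast
  obtain B where B: "B \<subseteq> V" "gv.independent B" "V \<subseteq> gv.span B"
    by (rule gv.maximal_independent_subset[of V])
  have "finite B"
    using gv.independent_span_bound[OF S(1) B(2)] subset_trans[OF B(1) S(2)] by simp
  moreover have "gv.span B = V"
    using B(3) gv.span_minimal[OF B(1) assms(2)] by (rule subset_antisym[rotated])
  ultimately show ?thesis using that B by blast
qed

lemma subspace_part: "gv.subspace (part g e)"
  by (rule gv.subspaceI) (auto intro: part_zero part_add part_smul)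

lemma independent_Un:
  assumes A: "finite A" "gv.independent A" and B: "finite B" "gv.independent B"
    and d: "gv.span A \<inter> gv.span B = {0}"
  shows "gv.independent (A \<union> B)" "A \<inter> B = {}"
proof -
  have "0 \<notin> A" using A(2) gv.dependent_zero by blast
  moreover have "v = 0" if "v \<in> A" "v \<in> B" for v
    using gv.span_base[OF that(1)] gv.span_base[OF that(2)] d by blast
  ultimately show disj: "A \<inter> B = {}" by blast
  show "gv.independent (A \<union> B)"
    unfolding gv.dependent_finite[OF finite_UnI[OF A(1) B(1)]]
  proof
    assume "\<exists>u. (\<exists>v\<in>A \<union> B. u v \<noteq> 0) \<and> (\<Sum>v\<in>A \<union> B. smul g (u v) v) = 0"
    then obtain u where u: "\<exists>v\<in>A \<union> B. u v \<noteq> 0" "(\<Sum>v\<in>A \<union> B. smul g (u v) v) = 0" by blast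
    let ?a = "\<Sum>v\<in>A. smul g (u v) v" and ?b = "\<Sum>v\<in>B. smul g (u v) v"
    have ab: "?a + ?b = 0" using u(2) sum.union_disjoint[OF A(1) B(1) disj] by metis
    have sa: "?a \<in> gv.span A" and sb: "?b \<in> gv.span B"
      by (rule gv.span_sum, rule gv.span_scale, rule gv.span_base, assumption)+
    have "?a = - ?b" using ab by (simp add: eq_neg_iff_add_eq_0)
    then have "?a \<in> gv.span B" using gv.span_neg[OF sb] by simp
    then have "?a = 0" using sa d by blast
    moreover from this have "?b = 0" using ab by simp
    ultimately have "\<forall>v\<in>A. u v = 0" "\<forall>v\<in>B. u v = 0"
      using A B gv.dependent_finite by blast+
    then show False using u(1) by blast
  qed
qed

text \<open>A basis of the odd part, then one of the kernel of \<open>f\<close> on the even part,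
  then a vector on which \<open>f\<close> is 1: in this order the last coordinate of an even element
  is the value of \<open>f\<close>.\<close>

lemma adapted_basis:
  assumes two: "(2::'k) \<noteq> 0" and L: "separating g L" and c: "nondegenerate_on_odd g f"
  shows "\<exists>n par b coord. nondegenerate_superalgebra g n par b coord"
proof -
  have ps: "part g e \<subseteq> sspace g" for e using part_sspace by blast
  have ff: "functional g f" using c by (simp add: nondegenerate_on_odd_def)
  let ?K = "{x \<in> part g False. f x = 0}"
  have sK: "gv.subspace ?K" by (rule subspace_kernel[OF subspace_part ps ff])
  obtain B1 where B1: "finite B1" "B1 \<subseteq> part g True" "gv.independent B1" "gv.span B1 = part g True"
    using finite_basis[OF L subspace_part ps] .
  obtain B0 where B0: "finite B0" "B0 \<subseteq> ?K" "gv.independent B0" "gv.span B0 = ?K"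
    using finite_basis[OF L sK] ps by blast
  \<comment> \<open>\<open>X\<close> is empty if \<open>f\<close> vanishes on the even part;
    nondegeneracy then forces the odd part to be zero.\<close>
  have "\<exists>X. gv.independent (B0 \<union> X) \<and> B0 \<inter> X = {} \<and> gv.span (B0 \<union> X) = part g False \<and>
      (X = {} \<and> (\<forall>x\<in>part g False. f x = 0) \<or> (\<exists>x1. X = {x1} \<and> f x1 = 1))"
  proof (cases "\<forall>x\<in>part g False. f x = 0")
    case True
    then have "?K = part g False" by auto
    then show ?thesis using B0 True by (intro exI[of _ "{}"]) simp
  next
    case False
    then obtain v where v: "v \<in> part g False" "f v \<noteq> 0" by blast
    define x1 where "x1 = smul g (1 / f v) v"
    have x1: "x1 \<in> part g False" "f x1 = 1"
      using v ff ps part_smul by (auto simp: x1_def functional_def subset_iff)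
    have nK: "x1 \<notin> gv.span B0" using x1 B0(4) by simp
    have "gv.span (insert x1 B0) = part g False"
    proof
      have "insert x1 B0 \<subseteq> part g False" using x1 B0(2) by auto
      then show "gv.span (insert x1 B0) \<subseteq> part g False" by (rule gv.span_minimal[OF _ subspace_part])
      show "part g False \<subseteq> gv.span (insert x1 B0)"
      proof
        fix x assume x: "x \<in> part g False"
        have "f (x - smul g (f x) x1) = 0"
          using functional_diff[OF ff, of x x1 "f x"] x x1 ps by auto
        then have "x - smul g (f x) x1 \<in> gv.span B0"
          using B0(4) x x1 part_diff part_smul by simp
        then have "x - smul g (f x) x1 \<in> gv.span (insert x1 B0)"
          using gv.span_mono[of B0 "insert x1 B0"] by blast
        moreover have "smul g (f x) x1 \<in> gv.span (insert x1 B0)"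
          by (intro gv.span_scale gv.span_base) simp
        ultimately have "(x - smul g (f x) x1) + smul g (f x) x1 \<in> gv.span (insert x1 B0)"
          by (rule gv.span_add)
        then show "x \<in> gv.span (insert x1 B0)" by simp
      qed
    qed
    moreover have "gv.independent (insert x1 B0)"
      using gv.independent_insertI[OF nK B0(3)] .
    moreover have "x1 \<notin> B0" using nK gv.span_base by blast
    ultimately show ?thesis using x1(2) by (intro exI[of _ "{x1}"]) simp
  qed
  then obtain X where X: "gv.independent (B0 \<union> X)" "B0 \<inter> X = {}" "gv.span (B0 \<union> X) = part g False"
      "X = {} \<and> (\<forall>x\<in>part g False. f x = 0) \<or> (\<exists>x1. X = {x1} \<and> f x1 = 1)" by blast
  have finX: "finite X" using X(4) by auto
  let ?B = "B1 \<union> (B0 \<union> X)"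
  have d: "gv.span B1 \<inter> gv.span (B0 \<union> X) = {0}"
    unfolding B1(4) X(3) using part_direct by blast
  have fin: "finite (B0 \<union> X)" using B0(1) finX by simp
  note iB = independent_Un(1)[OF B1(1,3) fin X(1) d]
  note dB = independent_Un(2)[OF B1(1,3) fin X(1) d]
  obtain l1 where l1: "set l1 = B1" "distinct l1" using finite_distinct_list[OF B1(1)] by blast
  obtain l0 where l0: "set l0 = B0" "distinct l0" using finite_distinct_list[OF B0(1)] by blast
  obtain lX where lX: "set lX = X" "distinct lX" using finite_distinct_list[OF finX] by blast
  define l where "l = l1 @ l0 @ lX"
  have l: "set l = ?B" "distinct l" using l1 l0 lX dB X(2) by (auto simp: l_def)
  have sp: "sspace g \<subseteq> gv.span ?B"
  proof
    fix x assume "x \<in> sspace g"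
    then obtain y z where x: "x = y + z" "y \<in> part g False" "z \<in> part g True" by (auto simp: sspace_def)
    then have "y \<in> gv.span ?B" "z \<in> gv.span ?B"
      using X(3) B1(4) gv.span_mono[of B1 ?B] gv.span_mono[of "B0 \<union> X" ?B] by auto
    then show "x \<in> gv.span ?B" unfolding x(1) by (rule gv.span_add)
  qed
  define n where "n = length l"
  define par where "par i = (i < length l1)" for i
  define coord where "coord x i = gv.representation ?B x (l ! i)" for x i
  have lB: "l ! i \<in> ?B" if "i < n" for i using that nth_mem[of i l] l(1) by (simp add: n_def)
  have part_l: "l ! i \<in> (if par i then B1 else B0 \<union> X)" if "i < n" for i
    using that nth_mem[of i l1] nth_mem[of "i - length l1" "l0 @ lX"] l1(1) l0(1) lX(1)
    by (auto simp: l_def par_def n_def nth_append split: if_splits)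
  have rep_part: "gv.representation ?B x v \<noteq> 0 \<Longrightarrow> v \<in> (if e then B1 else B0 \<union> X)"
    if "x \<in> part g e" for x v e
  proof -
    let ?E = "if e then B1 else B0 \<union> X"
    have "x \<in> gv.span ?E" "?E \<subseteq> ?B" using that B1(4) X(3) by auto
    then have "gv.representation ?B x = gv.representation ?E x"
      using gv.representation_extend[OF iB] by blast
    then show "gv.representation ?B x v \<noteq> 0 \<Longrightarrow> v \<in> ?E"
      using gv.representation_ne_zero by metis
  qed
  have based: "based_superalgebra g n par (\<lambda>i. l ! i) coord"
  proof (unfold_locales)
    show "(2::'k) \<noteq> 0" by (rule two)
    show "l ! i \<in> part g (par i)" if "i < n" for i
    proof -
      have "B0 \<union> X \<subseteq> part g False" using X(3) gv.span_superset[of "B0 \<union> X"] by simp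
      then show ?thesis using part_l[OF that] B1(2) by (cases "par i") auto
    qed
    show "coord (x + y) i = coord x i + coord y i" if "x \<in> sspace g" "y \<in> sspace g" for x y i
      unfolding coord_def
      using gv.representation_add[OF iB subsetD[OF sp that(2)] subsetD[OF sp that(1)]]
      by (simp add: add.commute)
    show "coord (smul g c x) i = c * coord x i" if "x \<in> sspace g" for x c i
      unfolding coord_def using gv.representation_scale[OF iB subsetD[OF sp that]] by simp
    show "coord (l ! i) j = (if i = j then 1 else 0)" if "i < n" "j < n" for i j
      unfolding coord_def using gv.representation_basis[OF iB lB[OF that(1)]] l(2) that
      by (simp add: nth_eq_iff_index_eq n_def)
    show "x = (\<Sum>i<n. smul g (coord x i) (l ! i))" if "x \<in> sspace g" for x
    proof -
      have "x = (\<Sum>v\<in>?B. smul g (gv.representation ?B x v) v)"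
        using gv.sum_representation_eq[OF iB _ _ subset_refl, of x] that sp B1(1) fin by auto
      also have "\<dots> = (\<Sum>v\<leftarrow>l. smul g (gv.representation ?B x v) v)"
        using sum.distinct_set_conv_list[OF l(2)] l(1) by metis
      also have "\<dots> = (\<Sum>i<n. smul g (coord x i) (l ! i))"
        by (simp add: sum_list_sum_nth coord_def n_def atLeast0LessThan)
      finally show ?thesis .
    qed
    show "par i = e" if "x \<in> part g e" "i < n" "coord x i \<noteq> 0" for x e i
      using rep_part[OF that(1), of "l ! i"] that(3) part_l[OF that(2)] dB
      by (cases e; cases "par i") (auto simp: coord_def)
    show "i < j" if "par i" "\<not> par j" for i j
      using that by (simp add: par_def)
  qed
  have "nondegenerate_superalgebra g n par (\<lambda>i. l ! i) coord"
  proof (intro nondegenerate_superalgebra.intro based nondegenerate_superalgebra_axioms.intro)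
    fix y assume y: "y \<in> part g True" and z: "\<And>x. x \<in> part g True \<Longrightarrow> coord (bracket g x y) (n - 1) = 0"
    have "f (bracket g x y) = 0" if x: "x \<in> part g True" for x
    proof -
      have b: "bracket g x y \<in> part g False" using bracket_part[OF x y] by simp
      from X(4) show ?thesis
      proof
        assume "\<exists>x1. X = {x1} \<and> f x1 = 1"
        then obtain x1 where x1: "X = {x1}" "f x1 = 1" by blast
        then have lx: "lX = [x1]" using lX by (cases lX) (auto simp: subset_singleton_iff)
        then have last: "l ! (n - 1) = x1" by (simp add: l_def n_def nth_append)
        have xb: "x1 \<in> ?B" using x1 by simp
        let ?z = "bracket g x y" and ?r = "gv.representation ?B (bracket g x y)"
        have "?r x1 = 0" using z[OF x] last by (simp add: coord_def)
        moreover have "?z \<in> gv.span (B0 \<union> X)" using b X(3) by simp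
        then have rz: "?r = gv.representation (B0 \<union> X) ?z"
          by (intro gv.representation_extend[OF iB]) auto
        ultimately have r0: "gv.representation (B0 \<union> X) ?z x1 = 0" by simp
        \<comment> \<open>Since the coordinate at \<open>x1\<close> is zero, the bracket lies in the
          span of \<open>B0\<close>, on which \<open>f\<close> vanishes.\<close>
        have "?z = (\<Sum>v\<in>B0 \<union> X. smul g (gv.representation (B0 \<union> X) ?z v) v)"
          using gv.sum_representation_eq[OF X(1) _ fin subset_refl, of ?z] b X(3) by simp
        also have "\<dots> = (\<Sum>v\<in>B0. smul g (gv.representation (B0 \<union> X) ?z v) v)"
          using B0(1) X(2) x1 r0 by (subst sum.union_disjoint) auto
        also have "\<dots> \<in> gv.span B0"
          by (rule gv.span_sum, rule gv.span_scale, rule gv.span_base)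
        finally show "f ?z = 0" using B0(4) by simp
      qed (use b in blast)
    qed
    then show "y = 0" using c y by (simp add: nondegenerate_on_odd_def)
  qed
  then show ?thesis by blast
qed

end

section \<open>The basic classical families\<close>

definition elementary :: "nat \<Rightarrow> nat \<Rightarrow> 'k::field nmat" where
  "elementary k l = (\<lambda>i j. if i = k \<and> j = l then 1 else 0)"

lemma mmul_elementary_left: "l < N \<Longrightarrow> mmul N (elementary k l) y i j = (if i = k then y l j else 0)"
proof -
  assume l: "l < N"
  have "mmul N (elementary k l) y i j = (\<Sum>q<N. if q = l then (if i = k then y l j else 0) else 0)"
    unfolding mmul_def elementary_def by (rule sum.cong) auto
  then show ?thesis using l by simp
qed

lemma mmul_elementary_right: "k < N \<Longrightarrow> mmul N y (elementary k l) i j = (if j = l then y i k else 0)"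
proof -
  assume k: "k < N"
  have "mmul N y (elementary k l) i j = (\<Sum>q<N. if q = k then (if j = l then y i k else 0) else 0)"
    unfolding mmul_def elementary_def by (rule sum.cong) auto
  then show ?thesis using k by simp
qed

lemma mmul_add_left: "mmul N (A + B) y i j = mmul N A y i j + mmul N B y i j"
  by (simp add: mmul_def distrib_right sum.distrib)

lemma mmul_add_right: "mmul N y (A + B) i j = mmul N y A i j + mmul N y B i j"
  by (simp add: mmul_def distrib_left sum.distrib)

lemma mmul_mscale_left: "mmul N (mscale c A) y i j = c * mmul N A y i j"
  by (simp add: mmul_def mscale_def sum_distrib_left mult.assoc)

lemma mmul_mscale_right: "mmul N y (mscale c A) i j = c * mmul N y A i j"
  by (simp add: mmul_def mscale_def sum_distrib_left mult.left_commute)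

lemma supercomm_odd:
  assumes "A \<in> part (gl m n) True" "B \<in> part (gl m n) True"
  shows "supercomm m n A B i j = mmul (m + n) A B i j + mmul (m + n) B A i j"
proof -
  have b: "block m True D = D" "block m False D = 0" if "D \<in> part (gl m n) True" for D :: "'k::field nmat"
    using that by (auto simp: gl_def block_def fun_eq_iff)
  show ?thesis
    using b[OF assms(1)] b[OF assms(2)]
    by (simp add: supercomm_def UNIV_bool koszul_def mscale_def mmul_def zero_fun_def)
qed

lemma functional_entry:
  "functional (gl m n) (\<lambda>A. A i j)" "functional (sl m n) (\<lambda>A. A i j)" "functional (osp m n) (\<lambda>A. A i j)"
  by (auto simp: functional_def gl_def sl_def osp_def mscale_def)

lemma separating_matrices:
  assumes "\<And>e. part g e \<subseteq> mats N N" "\<And>i j. functional g (\<lambda>A. A i j)"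
  shows "separating g ((\<lambda>(i, j) A. A i j) ` ({..<N} \<times> {..<N}))"
  unfolding separating_def
proof (intro conjI ballI impI)
  fix A assume A: "A \<in> sspace g" and z: "\<forall>f\<in>(\<lambda>(i, j) A. A i j) ` ({..<N} \<times> {..<N}). f A = 0"
  obtain B D where "A = B + D" "B \<in> part g False" "D \<in> part g True"
    using A unfolding sspace_def by blast
  then have BD: "A = B + D" "B \<in> mats N N" "D \<in> mats N N"
    using assms(1) by auto
  show "A = 0"
  proof (intro ext)
    fix i j
    have "A i j = 0" if "i < N" "j < N" using z that by auto
    moreover have "A i j = 0" if "\<not> (i < N \<and> j < N)"
    proof -
      have "B i j = 0" "D i j = 0" using BD(2,3) that unfolding mats_def by blast+
      then show ?thesis by (simp add: BD(1))
    qed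
    ultimately show "A i j = 0 i j" by (cases "i < N \<and> j < N") auto
  qed
qed (use assms(2) in auto)

text \<open>The supertrace vanishes on all supercommutators, so the trace of the first diagonal
  block alone is taken; it pairs the two off-diagonal blocks with each other by the trace
  form.\<close>

lemma nondegenerate_gl_sl:
  fixes g :: "('k::field, 'k nmat) lsa"
  assumes g: "g = gl m n \<or> g = sl m n"
  shows "nondegenerate_on_odd g (\<lambda>A. \<Sum>i<m. A i i)"
  unfolding nondegenerate_on_odd_def
proof (intro conjI ballI impI)
  have s: "smul g = mscale" using g by (auto simp: gl_def sl_def)
  show "functional g (\<lambda>A. \<Sum>i<m. A i i)"
    by (simp add: functional_def s mscale_def sum.distrib sum_distrib_left)
  have b: "bracket g = supercomm m n" using g by (auto simp: gl_def sl_def)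
  have pg: "part g True \<subseteq> part (gl m n) True" using g by (auto simp: sl_def)
  fix y assume y: "y \<in> part g True" and z: "\<forall>x\<in>part g True. (\<Sum>i<m. bracket g x y i i) = 0"
  have yg: "y \<in> part (gl m n) True" using y pg by auto
  have yz: "y l k = 0" if kl: "k < m + n" "l < m + n" "(k < m) \<noteq> (l < m)" for k l
  proof -
    \<comment> \<open>Exactly one of \<open>k\<close> and \<open>l\<close> is less than
      \<open>m\<close>, so exactly one of the products \<open>?E y\<close> and \<open>y ?E\<close>
      contributes \<open>y l k\<close> to the trace of the first block.\<close>
    let ?E = "elementary k l :: 'k nmat"
    have Eg: "?E \<in> part (gl m n) True"
      using kl by (auto simp: gl_def mats_def elementary_def)
    have d: "?E i i = 0" for i using kl by (auto simp: elementary_def)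
    have E: "?E \<in> part g True"
      using g Eg d by (auto simp: sl_def supertrace_def)
    have "(\<Sum>i<m. supercomm m n ?E y i i)
        = (\<Sum>i<m. if i = k then y l k else 0) + (\<Sum>i<m. if i = l then y l k else 0)"
      unfolding sum.distrib[symmetric]
      by (rule sum.cong[OF refl])
         (use kl in \<open>auto simp: supercomm_odd[OF Eg yg] mmul_elementary_left mmul_elementary_right\<close>)
    also have "\<dots> = y l k" using kl by auto
    finally show ?thesis using z E b by auto
  qed
  show "y = 0"
  proof (intro ext)
    fix i j
    show "y i j = 0 i j"
    proof (cases "i < m + n \<and> j < m + n \<and> (j < m) \<noteq> (i < m)")
      case True
      then show ?thesis using yz[of j i] by simp
    next
      case False
      then show ?thesis using yg by (auto simp: gl_def mats_def)
    qed
  qed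
qed

section \<open>The series \<open>osp\<close>\<close>

lemma osp_form_right:
  fixes M :: "'k::field nmat"
  assumes "even n" "j < m + n"
  shows "(\<Sum>k<m + n. M k i * osp_form m n k j) =
    (if j < m then M j i else if j < m + n div 2 then - M (j + n div 2) i else M (j - n div 2) i)"
proof -
  have n: "n = n div 2 + n div 2" using assms(1) by presburger
  let ?q = "if j < m then j else if j < m + n div 2 then j + n div 2 else j - n div 2"
  have "(\<Sum>k<m + n. M k i * osp_form m n k j) = (\<Sum>k<m + n. if k = ?q then
      (if j < m then M j i else if j < m + n div 2 then - M (j + n div 2) i else M (j - n div 2) i) else 0)"
    by (rule sum.cong[OF refl]) (use n assms(2) in \<open>auto simp: osp_form_def\<close>)
  also have "?q < m + n" using n assms(2) by auto
  then have "(\<Sum>k<m + n. if k = ?q then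
      (if j < m then M j i else if j < m + n div 2 then - M (j + n div 2) i else M (j - n div 2) i) else 0)
    = (if j < m then M j i else if j < m + n div 2 then - M (j + n div 2) i else M (j - n div 2) i)"
    by (simp add: sum.delta)
  finally show ?thesis .
qed

lemma osp_form_left:
  fixes M :: "'k::field nmat"
  assumes "even n" "i < m + n"
  shows "(\<Sum>k<m + n. osp_form m n i k * M k j) =
    (if i < m then M i j else if i < m + n div 2 then M (i + n div 2) j else - M (i - n div 2) j)"
proof -
  have n: "n = n div 2 + n div 2" using assms(1) by presburger
  let ?q = "if i < m then i else if i < m + n div 2 then i + n div 2 else i - n div 2"
  have "(\<Sum>k<m + n. osp_form m n i k * M k j) = (\<Sum>k<m + n. if k = ?q then
      (if i < m then M i j else if i < m + n div 2 then M (i + n div 2) j else - M (i - n div 2) j) else 0)"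
    by (rule sum.cong[OF refl]) (use n assms(2) in \<open>auto simp: osp_form_def\<close>)
  also have "?q < m + n" using n assms(2) by auto
  then have "(\<Sum>k<m + n. if k = ?q then
      (if i < m then M i j else if i < m + n div 2 then M (i + n div 2) j else - M (i - n div 2) j) else 0)
    = (if i < m then M i j else if i < m + n div 2 then M (i + n div 2) j else - M (i - n div 2) j)"
    by (simp add: sum.delta)
  finally show ?thesis .
qed

text \<open>The symplectic form exchanges the two halves of the odd indices, so the condition
  expresses the upper-right block of an odd matrix through its lower-left block, which is
  arbitrary.\<close>

lemma osp_odd_iff:
  fixes A :: "'k::field nmat"
  assumes n: "even n"
  shows "A \<in> part (osp m n) True \<longleftrightarrow> A \<in> part (gl m n) True \<and>
    (\<forall>i<m. \<forall>a. m \<le> a \<and> a < m + n div 2 \<longrightarrow>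
      A i a = A (a + n div 2) i \<and> A i (a + n div 2) = - A a i)"
proof -
  let ?h = "n div 2"
  have nh: "n = ?h + ?h" using n by presburger
  have "(\<forall>i<m + n. \<forall>j<m + n. (\<Sum>k<m + n. A k i * osp_form m n k j)
        + koszul True (i \<ge> m) * (\<Sum>k<m + n. osp_form m n i k * A k j) = 0) \<longleftrightarrow>
      (\<forall>i<m. \<forall>a. m \<le> a \<and> a < m + ?h \<longrightarrow> A i a = A (a + ?h) i \<and> A i (a + ?h) = - A a i)"
    (is "?L \<longleftrightarrow> ?R") if A: "A \<in> part (gl m n) True"
  proof
    assume L: ?L
    show ?R
    proof (intro allI impI)
      fix i a assume i: "i < m" and a: "m \<le> a \<and> a < m + ?h"
      have "- A (a + ?h) i + A i a = 0"
        using L[rule_format, of i a] i a nh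
        by (simp add: osp_form_right[OF n] osp_form_left[OF n])
      moreover have "A a i + A i (a + ?h) = 0"
        using L[rule_format, of i "a + ?h"] i a nh
        by (simp add: osp_form_right[OF n] osp_form_left[OF n])
      ultimately show "A i a = A (a + ?h) i \<and> A i (a + ?h) = - A a i"
        by (simp add: eq_neg_iff_add_eq_0 add.commute)
    qed
  next
    assume R: ?R
    have Z: "A i j = 0" if "(i < m) = (j < m)" for i j
      using A that by (auto simp: gl_def)
    have R1: "A i j = A (j + ?h) i" if "i < m" "m \<le> j" "j < m + ?h" for i j
      using R that by blast
    have R2: "A i j = - A (j - ?h) i" if "i < m" "m + ?h \<le> j" "j < m + n" for i j
    proof -
      have "m \<le> j - ?h" "j - ?h < m + ?h" "j - ?h + ?h = j" using that nh by linarith+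
      then show ?thesis using R[rule_format, of i "j - ?h"] that(1) by simp
    qed
    show ?L
    proof (intro allI impI)
      fix i j assume ij: "i < m + n" "j < m + n"
      show "(\<Sum>k<m + n. A k i * osp_form m n k j)
        + koszul True (i \<ge> m) * (\<Sum>k<m + n. osp_form m n i k * A k j) = 0"
        unfolding osp_form_right[OF n ij(2)] osp_form_left[OF n ij(1)]
        using ij R1[of i j] R2[of i j] R1[of j i] R2[of j i] nh
        by (cases "i < m"; cases "j < m"; cases "i < m + ?h"; cases "j < m + ?h")
           (simp_all add: Z koszul_def)
    qed
  qed
  then show ?thesis by (auto simp: osp_def)
qed

text \<open>The symplectic Lie algebra is the symmetric square of the odd space, and this linear
  form is twice the one given on it by the standard dot product. On brackets of odd elements it
  becomes -2 times the dot product of their lower-left blocks.\<close>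

lemma nondegenerate_osp:
  assumes n: "even n" and two: "(2::'k::field) \<noteq> 0"
  shows "nondegenerate_on_odd (osp m n :: ('k, 'k nmat) lsa)
    (\<lambda>A. \<Sum>c=m..<m + n div 2. A c (c + n div 2) - A (c + n div 2) c)"
  unfolding nondegenerate_on_odd_def
proof (intro conjI ballI impI)
  let ?h = "n div 2"
  have nh: "n = ?h + ?h" using n by presburger
  let ?f = "\<lambda>A::'k nmat. \<Sum>c=m..<m + ?h. A c (c + ?h) - A (c + ?h) c"
  have s: "smul (osp m n) = (mscale :: 'k \<Rightarrow> _)" by (simp add: osp_def gl_def)
  show "functional (osp m n) ?f"
    unfolding functional_def s
    by (simp add: mscale_def sum.distrib sum_subtractf sum_distrib_left right_diff_distrib)
  have b: "bracket (osp m n) = (supercomm m n :: 'k nmat \<Rightarrow> _)" by (simp add: osp_def gl_def)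
  fix y :: "'k nmat"
  assume y: "y \<in> part (osp m n) True" and z: "\<forall>x\<in>part (osp m n) True. ?f (bracket (osp m n) x y) = 0"
  have yg: "y \<in> part (gl m n) True"
    and y1: "\<And>i a. \<lbrakk>i < m; m \<le> a; a < m + ?h\<rbrakk> \<Longrightarrow> y i a = y (a + ?h) i"
    and y2: "\<And>i a. \<lbrakk>i < m; m \<le> a; a < m + ?h\<rbrakk> \<Longrightarrow> y i (a + ?h) = - y a i"
    using y unfolding osp_odd_iff[OF n] by auto
  have half: "w = 0" if "w + w = 0" for w :: 'k
  proof -
    have "2 * w = 0" using that by (simp only: mult_2)
    then show ?thesis using two by simp
  qed
  have low: "y a i = 0" if i: "i < m" and a: "m \<le> a" "a < m + ?h" for a i
  proof -
    \<comment> \<open>By \<open>osp_odd_iff\<close>, the odd element whose lower-left block is the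
      matrix unit at \<open>(a, i)\<close>.\<close>
    let ?X = "elementary a i + mscale (- 1) (elementary i (a + ?h)) :: 'k nmat"
    have Xg: "?X \<in> part (gl m n) True"
      using i a nh by (auto simp: gl_def mats_def elementary_def mscale_def split: if_splits)
    have X: "?X \<in> part (osp m n) True"
      unfolding osp_odd_iff[OF n] using i a Xg by (auto simp: elementary_def mscale_def)
    have "?f (supercomm m n ?X y) = (\<Sum>c=m..<m + ?h. if c = a then y i (a + ?h) - y a i else 0)"
      by (rule sum.cong[OF refl])
         (use i a nh in \<open>auto simp: supercomm_odd[OF Xg yg] mmul_add_left mmul_add_right
           mmul_mscale_left mmul_mscale_right mmul_elementary_left mmul_elementary_right\<close>)
    also have "\<dots> = - (y a i + y a i)" using a y2[OF i a] by simp
    finally show ?thesis using z X b half[of "y a i"] by (simp add: neg_eq_iff_add_eq_0)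
  qed
  have high: "y (a + ?h) i = 0" if i: "i < m" and a: "m \<le> a" "a < m + ?h" for a i
  proof -
    let ?X = "elementary (a + ?h) i + elementary i a :: 'k nmat"
    have Xg: "?X \<in> part (gl m n) True"
      using i a nh by (auto simp: gl_def mats_def elementary_def split: if_splits)
    have X: "?X \<in> part (osp m n) True"
      unfolding osp_odd_iff[OF n] using i a Xg by (auto simp: elementary_def)
    have "?f (supercomm m n ?X y) = (\<Sum>c=m..<m + ?h. if c = a then - (y i a + y (a + ?h) i) else 0)"
      by (rule sum.cong[OF refl])
         (use i a nh in \<open>auto simp: supercomm_odd[OF Xg yg] mmul_add_left mmul_add_right
           mmul_elementary_left mmul_elementary_right\<close>)
    also have "\<dots> = - (y (a + ?h) i + y (a + ?h) i)" using a y1[OF i a] by simp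
    finally show ?thesis using z X b half[of "y (a + ?h) i"] by (simp add: neg_eq_iff_add_eq_0)
  qed
  show "y = 0"
  proof (intro ext)
    fix i j
    have C: "y a i = 0" if "i < m" "m \<le> a" "a < m + n" for a i
      using low[of i a] high[of i "a - ?h"] that nh by (cases "a < m + ?h") auto
    have B: "y i a = 0" if "i < m" "m \<le> a" "a < m + n" for a i
      using y1[of i a] y2[of i "a - ?h"] C[of i "a + ?h"] C[of i "a - ?h"] that nh
      by (cases "a < m + ?h") auto
    show "y i j = 0 i j"
    proof (cases "i < m + n \<and> j < m + n \<and> (i < m) \<noteq> (j < m)")
      case True
      then show ?thesis using C[of j i] B[of i j] by (cases "i < m") auto
    next
      case False
      then show ?thesis using yg by (auto simp: gl_def mats_def)
    qed
  qed
qed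

section \<open>The families \<open>D21\<close>, \<open>G3\<close> and \<open>F4\<close>\<close>

lemma sum_two: "(\<Sum>i<2. f i) = f 0 + f (Suc 0 :: nat)"
  by (simp add: numeral_2_eq_2)

lemma less_two: "i < 2 \<longleftrightarrow> i = 0 \<or> i = Suc (0::nat)"
  by auto

lemma separating_D21:
  "separating (D21 \<alpha>)
    ((\<lambda>(i, j) (A, B, C, u). A i j) ` ({..<2} \<times> {..<2}) \<union>
     (\<lambda>(i, j) (A, B, C, u). B i j) ` ({..<2} \<times> {..<2}) \<union>
     (\<lambda>(i, j) (A, B, C, u). C i j) ` ({..<2} \<times> {..<2}) \<union>
     (\<lambda>(i, j, k) (A, B, C, u). u i j k) ` ({..<2} \<times> {..<2} \<times> {..<2}))"
  (is "separating _ (?L1 \<union> ?L2 \<union> ?L3 \<union> ?L4)")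
  unfolding separating_def
proof (intro conjI ballI impI)
  fix f assume "f \<in> ?L1 \<union> ?L2 \<union> ?L3 \<union> ?L4"
  then show "functional (D21 \<alpha>) f"
    by (auto simp: functional_def D21_def mscale_def)
next
  fix x assume "x \<in> sspace (D21 \<alpha>)" and z: "\<forall>f\<in>?L1 \<union> ?L2 \<union> ?L3 \<union> ?L4. f x = 0"
  then obtain A B C u where x: "x = (A, B, C, u)" "A \<in> mats 2 2" "B \<in> mats 2 2" "C \<in> mats 2 2"
      "\<forall>i j k. u i j k \<noteq> 0 \<longrightarrow> i < 2 \<and> j < 2 \<and> k < 2"
    by (auto simp: sspace_def D21_def sl2_def)
  have z': "(\<forall>i<2. \<forall>j<2. A i j = 0) \<and> (\<forall>i<2. \<forall>j<2. B i j = 0) \<and> (\<forall>i<2. \<forall>j<2. C i j = 0) \<and>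
      (\<forall>i<2. \<forall>j<2. \<forall>k<2. u i j k = 0)"
    using z unfolding x(1) ball_Un by simp
  have "A i j = 0" "B i j = 0" "C i j = 0" "u i j k = 0" for i j k
  proof -
    have "A i j = 0" "B i j = 0" "C i j = 0" if "i < 2" "j < 2"
      using z' that by simp_all
    then show "A i j = 0" "B i j = 0" "C i j = 0" using x(2-4) unfolding mats_def by blast+
    have "u i j k = 0" if "i < 2" "j < 2" "k < 2"
      using z' that by simp
    then show "u i j k = 0" using x(5) by blast
  qed
  then show "x = 0" by (simp add: x(1) zero_prod_def fun_eq_iff)
qed auto

text \<open>The second \<open>sl2\<close> component of the odd bracket has weight 1, nonzero for
  every \<alpha>. Up to sign the form is the product of \<open>psi\<close> in the outer tensor
  factors and the symmetric pairing of the two basis vectors in the middle one.\<close>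

lemma nondegenerate_D21: "nondegenerate_on_odd (D21 \<alpha>) (\<lambda>(A, B, C, u). B 0 0)"
  unfolding nondegenerate_on_odd_def
proof (intro conjI ballI impI)
  show "functional (D21 \<alpha>) (\<lambda>(A, B, C, u). B 0 0)"
    by (auto simp: functional_def D21_def mscale_def)
  fix y assume y: "y \<in> part (D21 \<alpha>) True"
    and z: "\<forall>x\<in>part (D21 \<alpha>) True. (case bracket (D21 \<alpha>) x y of (A, B, C, u) \<Rightarrow> B 0 0) = 0"
  obtain v where v: "y = (0, 0, 0, v)" "\<And>i j k. v i j k \<noteq> 0 \<Longrightarrow> i < 2 \<and> j < 2 \<and> k < 2"
    using y by (auto simp: D21_def)
  have form: "cube_sl2 (\<lambda>b a c. u a b c) (\<lambda>b a c. v a b c) 0 0 = 0"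
    if "\<forall>i j k. u i j k \<noteq> 0 \<longrightarrow> i < 2 \<and> j < 2 \<and> k < 2" for u
  proof -
    have "(0, 0, 0, u) \<in> part (D21 \<alpha>) True" using that by (auto simp: D21_def)
    then show ?thesis using z by (auto simp: D21_def v(1) mcomm_def mmul_def)
  qed
  have "v i j k = 0" for i j k
  proof (cases "i < 2 \<and> j < 2 \<and> k < 2")
    case True
    \<comment> \<open>Up to sign, the basis vector dual to the one at \<open>(i, j, k)\<close>: all
      three indices are flipped.\<close>
    let ?u = "\<lambda>a b c. if a = 1 - i \<and> b = 1 - j \<and> c = 1 - k then 1 else 0"
    have "cube_sl2 (\<lambda>b a c. ?u a b c) (\<lambda>b a c. v a b c) 0 0 = 0"
      by (rule form) auto
    then show ?thesis
      using True by (auto simp: less_two cube_sl2_def sum_two psi_def)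
  next
    case False
    then show ?thesis using v(2) by blast
  qed
  then show "y = 0" by (simp add: v(1) zero_prod_def fun_eq_iff)
qed

lemma separating_with_sl2:
  assumes h: "h \<subseteq> mats 7 7"
  shows "separating (with_sl2 N h \<rho> Q)
    ((\<lambda>(i, j) (A, B, u). A i j) ` ({..<7} \<times> {..<7}) \<union>
     (\<lambda>(i, j) (A, B, u). B i j) ` ({..<2} \<times> {..<2}) \<union>
     (\<lambda>(i, j) (A, B, u). u i j) ` ({..<N} \<times> {..<2}))"
  (is "separating _ (?L1 \<union> ?L2 \<union> ?L3)")
  unfolding separating_def
proof (intro conjI ballI impI)
  fix f assume "f \<in> ?L1 \<union> ?L2 \<union> ?L3"
  then show "functional (with_sl2 N h \<rho> Q) f"
    by (auto simp: functional_def with_sl2_def mscale_def)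
next
  fix x assume "x \<in> sspace (with_sl2 N h \<rho> Q)" and z: "\<forall>f\<in>?L1 \<union> ?L2 \<union> ?L3. f x = 0"
  then obtain A B u where x: "x = (A, B, u)" "A \<in> mats 7 7" "B \<in> mats 2 2" "u \<in> mats N 2"
    using h by (auto simp: sspace_def with_sl2_def sl2_def)
  have z': "(\<forall>i<7. \<forall>j<7. A i j = 0) \<and> (\<forall>i<2. \<forall>j<2. B i j = 0) \<and> (\<forall>i<N. \<forall>j<2. u i j = 0)"
    using z unfolding x(1) ball_Un by simp
  have "A i j = 0" "B i j = 0" "u i j = 0" for i j
  proof -
    have "A i j = 0" if "i < 7" "j < 7" using z' that by simp
    moreover have "B i j = 0" if "i < 2" "j < 2" using z' that by simp
    moreover have "u i j = 0" if "i < N" "j < 2" using z' that by simp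
    ultimately show "A i j = 0" "B i j = 0" "u i j = 0" using x(2-4) unfolding mats_def by blast+
  qed
  then show "x = 0" by (simp add: x(1) zero_prod_def fun_eq_iff)
qed auto

text \<open>The form is minus the tensor product of the dot product on columns and the symmetric
  pairing of the two basis vectors of \<open>V\<close>; one computation serves both
  \<open>G3\<close> and \<open>F4\<close>.\<close>

lemma nondegenerate_with_sl2: "nondegenerate_on_odd (with_sl2 N h \<rho> Q) (\<lambda>(A, B, u). B 0 0)"
  unfolding nondegenerate_on_odd_def
proof (intro conjI ballI impI)
  let ?g = "with_sl2 N h \<rho> Q"
  show "functional ?g (\<lambda>(A, B, u). B 0 0)"
    by (auto simp: functional_def with_sl2_def mscale_def)
  fix y assume y: "y \<in> part ?g True"
    and z: "\<forall>x\<in>part ?g True. (case bracket ?g x y of (A, B, u) \<Rightarrow> B 0 0) = 0"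
  obtain v where v: "y = (0, 0, v)" "v \<in> mats N 2"
    using y by (auto simp: with_sl2_def)
  have form: "odd_sl2 N u v 0 0 = 0" if "u \<in> mats N 2" for u
  proof -
    have "(0, 0, u) \<in> part ?g True" using that by (auto simp: with_sl2_def)
    then show ?thesis using z by (auto simp: with_sl2_def v(1) mcomm_def mmul_def)
  qed
  have "v s c = 0" for s c
  proof (cases "s < N \<and> c < 2")
    case True
    have "odd_sl2 N (elementary s (1 - c)) v 0 0 = 0"
      by (rule form) (use True in \<open>auto simp: mats_def elementary_def\<close>)
    moreover have "odd_sl2 N (elementary s (1 - c)) v 0 0 = (\<Sum>t<N. if t = s then - v s c else 0)"
      unfolding odd_sl2_def
      by (rule sum.cong[OF refl]) (use True in \<open>auto simp: sum_two psi_def elementary_def less_two\<close>)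
    ultimately show ?thesis using True by simp
  next
    case False
    then show ?thesis using v(2) unfolding mats_def by blast
  qed
  then show "y = 0" by (simp add: v(1) zero_prod_def fun_eq_iff)
qed

section \<open>Conclusion for the whole list\<close>

lemma basic_classical_nondegenerate:
  fixes g :: "('k::field, 'a::ab_group_add) lsa"
  assumes char: "CHAR('k) > 2" and g: "basic_classical g"
  shows "\<exists>L c. separating g L \<and> nondegenerate_on_odd g c"
proof -
  have two: "(2::'k) \<noteq> 0"
    using char of_nat_eq_0_iff_char_dvd[of 2, where 'a = 'k] by (auto dest: dvd_imp_le)
  have lie: "lie_superalgebra g"
    using g unfolding basic_classical_def restricted_lie_superalgebra_def by blast
  note transfer = isomorphic_transfer[OF lie]
  have mats: "part (gl m n) e \<subseteq> mats (m + n) (m + n)" "part (sl m n) e \<subseteq> mats (m + n) (m + n)"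
      "part (osp m n) e \<subseteq> mats (m + n) (m + n)" for m n e
    by (auto simp: gl_def sl_def osp_def)
  have "(\<exists>m n. lsa_isomorphic g (gl m n)) \<or> (\<exists>m n. lsa_isomorphic g (sl m n)) \<or>
      (\<exists>m n. even n \<and> lsa_isomorphic g (osp m n)) \<or> lsa_isomorphic g F4 \<or> lsa_isomorphic g G3 \<or>
      (\<exists>\<alpha>. lsa_isomorphic g (D21 \<alpha>))"
    using g unfolding basic_classical_def by blast
  then consider m n where "lsa_isomorphic g (gl m n)" | m n where "lsa_isomorphic g (sl m n)"
    | m n where "even n" "lsa_isomorphic g (osp m n)" | "lsa_isomorphic g F4" | "lsa_isomorphic g G3"
    | \<alpha> where "lsa_isomorphic g (D21 \<alpha>)" by blast
  then show ?thesis
  proof cases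
    case 1
    then show ?thesis
      by (rule transfer[OF _ separating_matrices[OF mats(1) functional_entry(1)]
            nondegenerate_gl_sl[OF disjI1[OF refl]]])
  next
    case 2
    then show ?thesis
      by (rule transfer[OF _ separating_matrices[OF mats(2) functional_entry(2)]
            nondegenerate_gl_sl[OF disjI2[OF refl]]])
  next
    case 3
    show ?thesis
      by (rule transfer[OF 3(2) separating_matrices[OF mats(3) functional_entry(3)]
            nondegenerate_osp[OF 3(1) two]])
  next
    case 4
    then show ?thesis unfolding F4_def
      by (rule transfer[OF _ separating_with_sl2 nondegenerate_with_sl2]) (auto simp: so7_def)
  next
    case 5
    then show ?thesis unfolding G3_def
      by (rule transfer[OF _ separating_with_sl2 nondegenerate_with_sl2]) (auto simp: g2_def)
  next
    case 6
    then show ?thesis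
      by (rule transfer[OF _ separating_D21 nondegenerate_D21])
  qed
qed

theorem proposition1p6:
  fixes g :: "('k::alg_closed_field, 'a::ab_group_add) lsa"
  assumes "CHAR('k) > 2"
    and "basic_classical g"
  shows "center g \<subseteq> uea_part g False
    \<and> (finitely_generated_module (uea g) (p_center g) (center g)
       \<and> (\<forall>z\<in>center g. integral_over (uea g) (p_center g) z)
       \<and> finitely_generated_commutative_algebra g (center g))
    \<and> (\<forall>z\<in>center g. z \<noteq> \<zero>\<^bsub>uea g\<^esub> \<longrightarrow> \<not> zero_divisor (uea g) z)"
proof -
  interpret restricted_lie_superalgebra g
    using assms(2) by (simp add: basic_classical_def)
  have two: "(2::'k) \<noteq> 0"
    using assms(1) of_nat_eq_0_iff_char_dvd[of 2, where 'a = 'k] by (auto dest: dvd_imp_le)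
  obtain n par b coord where "nondegenerate_superalgebra g n par b coord"
    using basic_classical_nondegenerate[OF assms] adapted_basis[OF two] by blast
  then interpret nondegenerate_superalgebra g n par b coord .
  interpret restricted_nondegenerate_superalgebra g n par b coord
    by unfold_locales (use assms(1) in simp)
  show ?thesis
    using center_even center_finitely_generated_module center_integral
      center_finitely_generated_algebra center_not_zero_divisor by blast
qed

end
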